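(* (i) For homogeneous Carter diagrams $\Gamma$ and $\Gamma'$ (i.e. Carter diagrams belonging to the same homogeneous class), the sizes of the full linkage systems are the same: $$|\mathscr{L}(\Gamma)|=|\mathscr{L}(\Gamma')|.$$ (ii) For these full linkage systems, the number of linkage diagrams is estimated as follows: $$|\mathscr{L}(\Gamma')|=|\mathscr{L}(\Gamma)|\;\le\;\sum\big(|\varPhi(\widetilde\Gamma_i)|-|\varPhi(\Gamma)|\big),$$ where the sum is taken over all vertex extensions $\Gamma'\prec\widetilde\Gamma_i$, and $\Gamma$ is the simply-laced Dynkin diagram of the homogeneous class, with root system $\varPhi(\Gamma)$.
   Context: Only finite root systems with simply-laced Dynkin diagrams are considered, with $(\alpha,\alpha)=2$ for every root $\alpha$. A Carter diagram is a graph with solid and dotted edges whose nodes correspond to linearly independent (not necessarily simple) roots, in which every cycle has an even number of nodes; simply-laced Dynkin diagrams are a particular case. For a Carter diagram $\Gamma$, a $\Gamma$-set is a set $\{\tau_1,\dots,\tau_l\}$ of linearly independent roots in one-to-one correspondence with the nodes of $\Gamma$ such that $(\tau_i,\tau_j)=-1$ if the edge $\{\tau_i,\tau_j\}$ is solid, $(\tau_i,\tau_j)=1$ if it is dotted, and $(\tau_i,\tau_j)=0$ if $\tau_i,\tau_j$ are not connected. Carter diagrams of the same type and the same index form a homogeneous class. In Carter's standard notation the classes are $C(E_6)=\{E_6,E_6(a_k),k=1,2\}$, $C(E_7)=\{E_7,E_7(a_k),1\le k\le4\}$, $C(E_8)=\{E_8,E_8(a_k),1\le k\le8\}$ and $C(D_l)=\{D_l,D_l(a_k),1\le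 k\le\lfloor\frac{l-2}{2}\rfloor\}$ for $l\ge4$. Each homogeneous class contains exactly one Dynkin diagram. Diagrams of one class are connected by transition matrices, each of which maps sets of roots associated with one diagram to sets of roots associated with another by changing only one root $\widetilde\alpha$ into $-\widetilde\alpha$ plus an integer combination of the other roots of the set; in particular the linear span is preserved. Vertex extension: let $\Gamma$ be a simply-laced Dynkin diagram, $\Gamma'\in C(\Gamma)$, $S$ a $\Gamma$-set and $S'$ a $\Gamma'$-set obtained from it by such transformations, so that $S$ and $S'$ have the same linear span $L=L(S)=L(S')$. If $\widetilde\Gamma$ is a Dynkin diagram with root system $\varPhi(\widetilde\Gamma)$ such that $\operatorname{rank}\varPhi(\widetilde\Gamma)=\operatorname{rank}\varPhi(\Gamma)+1$ and $L\subset\operatorname{Span}(\varPhi(\widetilde\Gamma))$, then the pair $\{\Gamma',\widetilde\Gamma\}$ is called a vertex extension of $\Gamma'$, written $\Gamma'\prec\widetilde\Gamma$. For a root $\gamma$ and $S'=\{\tau_1,\dots,\tau_l\}$, the linkage label vector is $\gamma^\nabla=((\gamma,\tau_1),\dots,(\gamma,\tau_l))^t$; linkage label vectors are in one-to-one correspondence with linkage diagrams (the diagrams obtained from $\Gamma'$ by adding the node $\gamma$ with its edges). The partial linkage system is $$\mathscr{L}_{\widetilde\Gamma}(\Gamma')=\{\gamma^\nabla\mid\gamma\in\varPhi(\widetilde\Gamma),\ \gamma\notin L(S')\},$$ where $S'$ is some $\Gamma'$-set in $\varPhi(\widetilde\Gamma)$; the paper shows that this set does not depend on the choice of $S'$.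 The full linkage system is the union over all vertex extensions $$\mathscr{L}(\Gamma')=\bigcup_{\Gamma'\prec\widetilde\Gamma}\mathscr{L}_{\widetilde\Gamma}(\Gamma').$$ *)

theory Defs
  imports "HOL-Analysis.Analysis" "HOL-Analysis.Finite_Function_Topology"
begin

section \<open>Diagrams with solid and dotted edges\<close>

text \<open>The nodes are the numbers \<open>0, \<dots>, num_nodes - 1\<close>; an edge is a two-element set of nodes.\<close>

record diagram =
  num_nodes :: nat
  solid :: "nat set set"
  dotted :: "nat set set"

definition gram :: "diagram \<Rightarrow> nat \<Rightarrow> nat \<Rightarrow> real" where
  "gram G i j =
     (if i = j then 2
      else if {i, j} \<in> solid G then -1
      else if {i, j} \<in> dotted G then 1
      else 0)"

section \<open>Simply-laced Dynkin diagrams and their root systems\<close>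

datatype dynkin = DynA nat | DynD nat | DynE nat

primrec node_count :: "dynkin \<Rightarrow> nat" where
  "node_count (DynA l) = l"
| "node_count (DynD l) = l"
| "node_count (DynE l) = l"

text \<open>The bounds make the types pairwise non-isomorphic (\<open>D\<^sub>3 = A\<^sub>3\<close> and \<open>E\<^sub>5 = D\<^sub>5\<close> are left out).\<close>

primrec is_dynkin :: "dynkin \<Rightarrow> bool" where
  "is_dynkin (DynA l) = (1 \<le> l)"
| "is_dynkin (DynD l) = (4 \<le> l)"
| "is_dynkin (DynE l) = (l \<in> {6, 7, 8})"

text \<open>For \<open>DynD l\<close> and \<open>DynE l\<close> the nodes \<open>0, \<dots>, l - 2\<close> form a chain and \<open>l - 1\<close> is the node
  attached to it.\<close>

primrec dynkin_diagram :: "dynkin \<Rightarrow> diagram" where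
  "dynkin_diagram (DynA l) =
     \<lparr>num_nodes = l, solid = {{i, i + 1} | i. i + 1 < l}, dotted = {}\<rparr>"
| "dynkin_diagram (DynD l) =
     \<lparr>num_nodes = l, solid = insert {l - 3, l - 1} {{i, i + 1} | i. i + 1 < l - 1}, dotted = {}\<rparr>"
| "dynkin_diagram (DynE l) =
     \<lparr>num_nodes = l, solid = insert {2, l - 1} {{i, i + 1} | i. i + 1 < l - 1}, dotted = {}\<rparr>"

text \<open>Vectors are written in coordinates with respect to the simple roots. All types share the
  space of finitely supported vectors; the bilinear form depends on the type.\<close>

type_synonym rvec = "(nat, real) poly_mapping"

abbreviation simple_root :: "nat \<Rightarrow> rvec" where
  "simple_root i \<equiv> Poly_Mapping.single i 1"

definition root_form :: "dynkin \<Rightarrow> rvec \<Rightarrow> rvec \<Rightarrow> real" where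
  "root_form T x y =
     (\<Sum>i<node_count T. \<Sum>j<node_count T.
        Poly_Mapping.lookup x i * gram (dynkin_diagram T) i j * Poly_Mapping.lookup y j)"

text \<open>The orbit of the simple roots under the Weyl group. Since \<open>(\<alpha>, \<alpha>) = 2\<close>, the reflection
  \<open>x \<mapsto> x - 2 (x, \<alpha>) / (\<alpha>, \<alpha>) \<alpha>\<close> is \<open>x \<mapsto> x - (x, \<alpha>) \<alpha>\<close>.\<close>

inductive_set root_system :: "dynkin \<Rightarrow> rvec set" for T where
  simple: "i < node_count T \<Longrightarrow> simple_root i \<in> root_system T"
| reflect: "x \<in> root_system T \<Longrightarrow> i < node_count T \<Longrightarrow>
    x - root_form T x (simple_root i) *\<^sub>R simple_root i \<in> root_system T"

definition root_rank :: "dynkin \<Rightarrow> nat" where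
  "root_rank T = dim (root_system T)"

section \<open>Carter diagrams and homogeneous classes\<close>

text \<open>\<open>carter_D l k\<close> is \<open>D\<^sub>l(a\<^sub>k)\<close>: a square with chains of \<open>k - 1\<close> and \<open>l - k - 3\<close> further nodes
  at two opposite corners. It is realised by the roots \<open>e\<^sub>i - e\<^sub>i\<^sub>+\<^sub>1\<close> for \<open>1 \<le> i < l\<close> (nodes
  \<open>0, \<dots>, l - 2\<close>) together with \<open>e\<^sub>k\<^sub>+\<^sub>1 + e\<^sub>k\<^sub>+\<^sub>2\<close> (node \<open>l - 1\<close>); the square is
  \<open>k - 1, k, k + 1, l - 1\<close>.\<close>

definition carter_D :: "nat \<Rightarrow> nat \<Rightarrow> diagram" where
  "carter_D l k =
     \<lparr>num_nodes = l,
      solid = insert {k - 1, l - 1} {{i, i + 1} | i. i + 1 < l - 1},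
      dotted = {{k + 1, l - 1}}\<rparr>"

text \<open>The diagrams \<open>E\<^sub>l(a\<^sub>k)\<close>, drawn with the four-cycle as basic cycle. They are built from a square
  \<open>0, 1, 2, 3\<close>, from the ladder with sides \<open>0, 1, 2\<close> and \<open>3, 4, 5\<close>, or (\<open>E\<^sub>7(a\<^sub>4)\<close>, \<open>E\<^sub>8(a\<^sub>7)\<close>) from a
  cube without one vertex, where \<open>0\<close> is the vertex antipodal to the missing one;
  \<open>E\<^sub>8(a\<^sub>6)\<close> is the ladder with three squares and \<open>E\<^sub>8(a\<^sub>8)\<close> is the full cube.
  Every square carries an odd number of dotted edges. This determines the dotted edges up to
  replacing roots by their negatives.\<close>

abbreviation square_edges :: "nat set set" where
  "square_edges \<equiv> {{0, 1}, {1, 2}, {2, 3}}"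

abbreviation ladder_edges :: "nat set set" where
  "ladder_edges \<equiv> {{0, 1}, {1, 2}, {3, 4}, {4, 5}, {0, 3}, {2, 5}}"

abbreviation cube_edges :: "nat set set" where
  "cube_edges \<equiv> {{0, 2}, {0, 3}, {1, 4}, {2, 4}, {2, 5}, {3, 6}, {1, 6}}"

definition E6_a1 :: diagram where
  "E6_a1 = \<lparr>num_nodes = 6, solid = square_edges \<union> {{0, 4}, {1, 5}}, dotted = {{0, 3}}\<rparr>"

definition E6_a2 :: diagram where
  "E6_a2 = \<lparr>num_nodes = 6, solid = ladder_edges, dotted = {{1, 4}}\<rparr>"

definition E7_a1 :: diagram where
  "E7_a1 = \<lparr>num_nodes = 7, solid = square_edges \<union> {{0, 4}, {1, 5}, {5, 6}}, dotted = {{0, 3}}\<rparr>"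

definition E7_a2 :: diagram where
  "E7_a2 = \<lparr>num_nodes = 7, solid = square_edges \<union> {{0, 4}, {1, 5}, {2, 6}}, dotted = {{0, 3}}\<rparr>"

definition E7_a3 :: diagram where
  "E7_a3 = \<lparr>num_nodes = 7, solid = ladder_edges \<union> {{0, 6}}, dotted = {{1, 4}}\<rparr>"

definition E7_a4 :: diagram where
  "E7_a4 = \<lparr>num_nodes = 7, solid = cube_edges, dotted = {{0, 1}, {3, 5}}\<rparr>"

definition E8_a1 :: diagram where
  "E8_a1 = \<lparr>num_nodes = 8, solid = square_edges \<union> {{0, 4}, {1, 5}, {5, 6}, {6, 7}},
     dotted = {{0, 3}}\<rparr>"

definition E8_a2 :: diagram where
  "E8_a2 = \<lparr>num_nodes = 8, solid = square_edges \<union> {{0, 4}, {1, 5}, {5, 6}, {3, 7}},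
     dotted = {{0, 3}}\<rparr>"

definition E8_a3 :: diagram where
  "E8_a3 = \<lparr>num_nodes = 8, solid = square_edges \<union> {{0, 4}, {1, 5}, {2, 6}, {3, 7}},
     dotted = {{0, 3}}\<rparr>"

definition E8_a4 :: diagram where
  "E8_a4 = \<lparr>num_nodes = 8, solid = ladder_edges \<union> {{0, 6}, {6, 7}}, dotted = {{1, 4}}\<rparr>"

definition E8_a5 :: diagram where
  "E8_a5 = \<lparr>num_nodes = 8, solid = ladder_edges \<union> {{0, 6}, {5, 7}}, dotted = {{1, 4}}\<rparr>"

definition E8_a6 :: diagram where
  "E8_a6 = \<lparr>num_nodes = 8,
     solid = {{0, 1}, {1, 2}, {2, 3}, {4, 5}, {5, 6}, {6, 7}, {0, 4}, {2, 6}},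
     dotted = {{1, 5}, {3, 7}}\<rparr>"

definition E8_a7 :: diagram where
  "E8_a7 = \<lparr>num_nodes = 8, solid = cube_edges \<union> {{4, 7}}, dotted = {{0, 1}, {3, 5}}\<rparr>"

definition E8_a8 :: diagram where
  "E8_a8 = \<lparr>num_nodes = 8, solid = cube_edges \<union> {{5, 7}, {6, 7}},
     dotted = {{0, 1}, {3, 5}, {4, 7}}\<rparr>"

text \<open>The homogeneous classes \<open>C(E\<^sub>6)\<close>, \<open>C(E\<^sub>7)\<close>, \<open>C(E\<^sub>8)\<close> and \<open>C(D\<^sub>l)\<close> with \<open>l \<ge> 4\<close>, each indexed by
  the type of its unique Dynkin diagram.\<close>

definition homogeneous_class :: "dynkin \<Rightarrow> diagram set" where
  "homogeneous_class T =
     (case T of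
        DynA l \<Rightarrow> {}
      | DynD l \<Rightarrow> (if 4 \<le> l
                then insert (dynkin_diagram (DynD l)) {carter_D l k | k. 1 \<le> k \<and> k \<le> (l - 2) div 2}
                else {})
      | DynE l \<Rightarrow> (if l = 6 then {dynkin_diagram (DynE 6), E6_a1, E6_a2}
                else if l = 7 then {dynkin_diagram (DynE 7), E7_a1, E7_a2, E7_a3, E7_a4}
                else if l = 8 then {dynkin_diagram (DynE 8), E8_a1, E8_a2, E8_a3, E8_a4,
                                    E8_a5, E8_a6, E8_a7, E8_a8}
                else {}))"

section \<open>Sets of roots associated with a diagram\<close>

text \<open>A \<open>G\<close>-set in the root system of type \<open>T\<close>, given with its correspondence to the nodes of \<open>G\<close>.\<close>

definition labelled_gamma_set :: "dynkin \<Rightarrow> diagram \<Rightarrow> (nat \<Rightarrow> rvec) \<Rightarrow> bool" where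
  "labelled_gamma_set T G \<tau> \<longleftrightarrow>
     \<tau> ` {..<num_nodes G} \<subseteq> root_system T \<and>
     inj_on \<tau> {..<num_nodes G} \<and>
     independent (\<tau> ` {..<num_nodes G}) \<and>
     (\<forall>i<num_nodes G. \<forall>j<num_nodes G. i \<noteq> j \<longrightarrow> root_form T (\<tau> i) (\<tau> j) = gram G i j)"

definition gamma_set :: "dynkin \<Rightarrow> diagram \<Rightarrow> rvec set \<Rightarrow> bool" where
  "gamma_set T G S \<longleftrightarrow> (\<exists>\<tau>. labelled_gamma_set T G \<tau> \<and> S = \<tau> ` {..<num_nodes G})"

definition one_root_change :: "rvec set \<Rightarrow> rvec set \<Rightarrow> bool" where
  "one_root_change S S' \<longleftrightarrow>
     (\<exists>\<alpha>\<in>S. \<exists>c :: rvec \<Rightarrow> int.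
        S' = insert (- \<alpha> + (\<Sum>\<beta>\<in>S - {\<alpha>}. of_int (c \<beta>) *\<^sub>R \<beta>)) (S - {\<alpha>}))"

text \<open>One transition inside the root system of type \<open>T\<close>, between sets associated with diagrams of
  the homogeneous class of \<open>X\<close>.\<close>

definition transition :: "dynkin \<Rightarrow> dynkin \<Rightarrow> rvec set \<Rightarrow> rvec set \<Rightarrow> bool" where
  "transition T X S S' \<longleftrightarrow>
     (\<exists>G\<in>homogeneous_class X. gamma_set T G S) \<and>
     (\<exists>G'\<in>homogeneous_class X. gamma_set T G' S') \<and>
     one_root_change S S'"

section \<open>Vertex extensions and linkage systems\<close>

text \<open>\<open>vertex_extension G T\<close> is \<open>G \<prec> T\<close>. The sets \<open>S\<close> and \<open>S'\<close> consist of roots of type \<open>T\<close>; in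
  particular their common span lies in the span of that root system.\<close>

definition vertex_extension :: "diagram \<Rightarrow> dynkin \<Rightarrow> bool" where
  "vertex_extension G T \<longleftrightarrow>
     is_dynkin T \<and>
     (\<exists>X. G \<in> homogeneous_class X \<and>
          root_rank T = root_rank X + 1 \<and>
          (\<exists>S S'. gamma_set T (dynkin_diagram X) S \<and> gamma_set T G S' \<and>
                  (transition T X)\<^sup>*\<^sup>* S S' \<and> span S' = span S))"

definition linkage_label_vector ::
    "dynkin \<Rightarrow> diagram \<Rightarrow> (nat \<Rightarrow> rvec) \<Rightarrow> rvec \<Rightarrow> real list" where
  "linkage_label_vector T G \<tau> \<gamma> = map (\<lambda>i. root_form T \<gamma> (\<tau> i)) [0..<num_nodes G]"

definition partial_linkage_system ::
    "dynkin \<Rightarrow> diagram \<Rightarrow> (nat \<Rightarrow> rvec) \<Rightarrow> real list set" where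
  "partial_linkage_system T G \<tau> =
     {linkage_label_vector T G \<tau> \<gamma> | \<gamma>. \<gamma> \<in> root_system T \<and> \<gamma> \<notin> span (\<tau> ` {..<num_nodes G})}"

text \<open>\<open>\<sigma>\<close> selects, for every vertex extension of \<open>G\<close>, the \<open>G\<close>-set used to compute the partial
  linkage system. Nothing is assumed about \<open>\<sigma>\<close> beyond this. The selection cannot be replaced by
  the union over all \<open>G\<close>-sets: permuting the three end nodes of \<open>D\<^sub>4\<close> inside \<open>D\<^sub>5\<close> gives three
  disjoint sets of eight vectors.\<close>

definition gamma_set_selection ::
    "diagram \<Rightarrow> (dynkin \<Rightarrow> nat \<Rightarrow> rvec) \<Rightarrow> bool" where
  "gamma_set_selection G \<sigma> \<longleftrightarrow> (\<forall>T. vertex_extension G T \<longrightarrow> labelled_gamma_set T G (\<sigma> T))"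

definition full_linkage_system ::
    "diagram \<Rightarrow> (dynkin \<Rightarrow> nat \<Rightarrow> rvec) \<Rightarrow> real list set" where
  "full_linkage_system G \<sigma> = (\<Union>T\<in>{T. vertex_extension G T}. partial_linkage_system T G (\<sigma> T))"

end

theory Submission
  imports Defs
begin

text \<open>
  The diagrams of one homogeneous class are joined by changes of a single root. Such a change is an
  involution with integral coefficients, so it turns \<open>G\<close>-sets into \<open>G'\<close>-sets inside every root system
  at once and acts on linkage label vectors by a linear bijection that does not depend on the
  extension. This reduces the theorem to the Dynkin diagram \<open>X\<close> of the class and to the independence
  of the selected \<open>X\<close>-sets.

  The labels of the roots outside the span of an \<open>X\<close>-set form a union of Weyl group orbits, each with
  a dominant representative. Pairing with the highest root shows that a dominant label is \<open>0\<close> or a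
  minuscule fundamental weight. The orthogonal complement of the span is a line; hence two outer roots
  with projections \<open>p\<close>, \<open>q\<close> and inner product \<open>n\<close> satisfy \<open>(n - (p, q))\<^sup>2 = (2 - (p, p)) (2 - (q, q))\<close>. As
  \<open>n\<close> is an integer, few combinations of dominant labels survive. In \<open>D\<^sub>l\<^sub>+\<^sub>1\<close> the spin weights of \<open>D\<^sub>l\<close> with
  \<open>l \<ge> 5\<close> are excluded by integral orthonormal coordinates, in \<open>E\<^sub>l\<^sub>+\<^sub>1\<close> one of them is forced by a parity
  argument. So the dominant labels depend only on the extension, up to a symmetry of \<open>X\<close> for \<open>D\<^sub>4\<close> and
  \<open>D\<^sub>6\<close>. The bound holds since the root system of \<open>X\<close> embeds into the roots lying in the span.
\<close>

section \<open>The bilinear form\<close>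

text \<open>The union over the extensions shapes the proof. Label sets of different extensions may
  overlap (\<open>D_8\<close> and \<open>E_8\<close> both contribute the vector orbit of
  \<open>D_7\<close>), so the sizes of the partial systems do not determine the size of the union.
  Hence each comparison map, the one along the class and the diagram symmetry of \<open>X\<close>,
  must be a single injection that serves all extensions at once. For \<open>D_4\<close> the
  selection may permute the three end nodes, which is harmless because \<open>D_5\<close> is the
  only possible extension. For \<open>D_6\<close> the selection inside \<open>E_7\<close> may
  exchange the two half-spin nodes; that exchange fixes the vector orbit contributed by
  \<open>D_7\<close>. The second recurring device is that a root is the same as a lattice vector of
  norm two. Whenever a new root is required (a changed root of a set, the highest root of the
  subsystem, the image of a root of \<open>X\<close>, a root with prescribed labels) it is written
  down as an integral combination or shown to lie in the lattice, and only its norm is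
  computed.\<close>

lemma lookup_scaleR [simp]: "Poly_Mapping.lookup (c *\<^sub>R x) i = c * Poly_Mapping.lookup x i" for x :: rvec
proof -
  have "finite {i. c * Poly_Mapping.lookup x i \<noteq> 0}"
    by (rule finite_subset[OF _ finite_keys[of x]]) (auto simp: in_keys_iff)
  then show ?thesis
    by (simp add: scaleR_poly_mapping_def Abs_poly_mapping_inverse)
qed

lemma gram_commute: "gram G i j = gram G j i"
  by (simp add: gram_def insert_commute)

lemma root_form_commute: "root_form T x y = root_form T y x"
  unfolding root_form_def
  by (subst sum.swap, intro sum.cong refl) (simp add: gram_commute mult.commute mult.left_commute)

lemma root_form_add_left: "root_form T (x + y) z = root_form T x z + root_form T y z"
  by (simp add: root_form_def lookup_add algebra_simps sum.distrib)

lemma root_form_scaleR_left: "root_form T (c *\<^sub>R x) z = c * root_form T x z"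
  by (simp add: root_form_def sum_distrib_left algebra_simps)

lemma linear_root_form_left: "linear (\<lambda>x. root_form T x z)"
  by (intro linearI) (simp_all add: root_form_add_left root_form_scaleR_left)

lemma linear_root_form_right: "linear (\<lambda>x. root_form T z x)"
  using linear_root_form_left[of T z] by (simp add: root_form_commute)

lemmas root_form_linear =
  linear_add[OF linear_root_form_left] linear_diff[OF linear_root_form_left]
  linear_neg[OF linear_root_form_left] linear_0[OF linear_root_form_left]
  linear_sum[OF linear_root_form_left] root_form_scaleR_left
  linear_add[OF linear_root_form_right] linear_diff[OF linear_root_form_right]
  linear_neg[OF linear_root_form_right] linear_0[OF linear_root_form_right]
  linear_sum[OF linear_root_form_right] linear_cmul[OF linear_root_form_right, unfolded real_scaleR_def]

lemma lookup_sum: "Poly_Mapping.lookup (sum f A) i = (\<Sum>a\<in>A. Poly_Mapping.lookup (f a) i)"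
  for f :: "'a \<Rightarrow> rvec"
  by (induction A rule: infinite_finite_induct) (auto simp: lookup_add)

section \<open>The forms of types A, D and E in explicit coordinates\<close>

definition chain_form :: "nat \<Rightarrow> (nat \<Rightarrow> real) \<Rightarrow> (nat \<Rightarrow> real) \<Rightarrow> real" where
  "chain_form m u v =
     (\<Sum>i<m. \<Sum>j<m. u i * (if i = j then 2 else if j = i + 1 \<or> i = j + 1 then -1 else 0) * v j)"

lemma chain_form_0 [simp]: "chain_form 0 u v = 0"
  by (simp add: chain_form_def)

lemma chain_form_Suc:
  "chain_form (Suc m) u v = chain_form m u v + 2 * u m * v m
     - (if m = 0 then 0 else u m * v (m - 1) + u (m - 1) * v m)"
proof (cases m)
  case (Suc k)
  have r: "(\<Sum>j<m. u m * (if m = j then 2 else if j = m + 1 \<or> m = j + 1 then -1 else 0) * v j)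
      = (\<Sum>j<m. if j = k then - (u m * v k) else 0)"
    by (rule sum.cong) (auto simp: Suc)
  have c: "(\<Sum>i<m. u i * (if i = m then 2 else if m = i + 1 \<or> i = m + 1 then -1 else 0) * v m)
      = (\<Sum>i<m. if i = k then - (u k * v m) else 0)"
    by (rule sum.cong) (auto simp: Suc)
  show ?thesis
    using r c by (simp add: chain_form_def sum.distrib Suc)
qed (simp add: chain_form_def)

text \<open>With \<open>u\<close> and \<open>v\<close> extended by 0 at both ends, the form of a
  chain is the standard inner product of the consecutive differences. This is the passage to the
  coordinates in which simple roots are \<open>e_i - e_(i+1)\<close>.\<close>

lemma chain_form_squares:
  "chain_form (Suc m) u v =
     u 0 * v 0 + (\<Sum>k<m. (u (Suc k) - u k) * (v (Suc k) - v k)) + u m * v m"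
  by (induction m) (simp_all add: chain_form_Suc algebra_simps)

lemma consecutive_pair_iff:
  "{i, j} \<in> {{k, k + 1} | k. k + 1 < n} \<longleftrightarrow> (j = i + 1 \<and> j < n) \<or> (i = j + 1 \<and> i < n)"
  for i j n :: nat
  by (auto simp: doubleton_eq_iff)

lemma root_form_DynA: "root_form (DynA l) x y = chain_form l (Poly_Mapping.lookup x) (Poly_Mapping.lookup y)"
  unfolding root_form_def chain_form_def
  by (intro sum.cong refl arg_cong2[where f = "(*)"])
    (auto simp: gram_def consecutive_pair_iff[simplified])

definition branch_node :: "dynkin \<Rightarrow> nat" where
  "branch_node T = (case T of DynA l \<Rightarrow> 0 | DynD l \<Rightarrow> l - 3 | DynE l \<Rightarrow> 2)"

definition branched :: "dynkin \<Rightarrow> bool" where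
  "branched T \<longleftrightarrow> is_dynkin T \<and> (\<forall>l. T \<noteq> DynA l)"

lemma branched_node_count: "branched T \<Longrightarrow> 4 \<le> node_count T \<and> branch_node T < node_count T - 2 \<and> 0 < branch_node T"
  by (cases T) (auto simp: branched_def branch_node_def)

lemma gram_branched:
  assumes "branched T"
  shows "gram (dynkin_diagram T) i j =
    (if i = j then 2
     else if (j = i + 1 \<and> j < node_count T - 1) \<or> (i = j + 1 \<and> i < node_count T - 1)
       \<or> (i = branch_node T \<and> j = node_count T - 1) \<or> (j = branch_node T \<and> i = node_count T - 1) then -1
     else 0)"
  using assms
  by (cases T) (auto simp: branched_def branch_node_def gram_def consecutive_pair_iff[simplified] doubleton_eq_iff)

lemma root_form_branched:
  assumes "branched T" "node_count T = Suc m" "a = branch_node T"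
  shows "root_form T x y = chain_form m (Poly_Mapping.lookup x) (Poly_Mapping.lookup y)
     + 2 * Poly_Mapping.lookup x m * Poly_Mapping.lookup y m
     - Poly_Mapping.lookup x a * Poly_Mapping.lookup y m - Poly_Mapping.lookup x m * Poly_Mapping.lookup y a"
proof -
  let ?u = "Poly_Mapping.lookup x" and ?v = "Poly_Mapping.lookup y"
  have a: "a < m" "a \<noteq> m"
    using branched_node_count[OF assms(1)] assms(2,3) by auto
  have r: "(\<Sum>j<m. ?u m * gram (dynkin_diagram T) m j * ?v j) = (\<Sum>j<m. if j = a then - (?u m * ?v a) else 0)"
    using assms a by (intro sum.cong) (auto simp: gram_branched)
  have c: "(\<Sum>i<m. ?u i * gram (dynkin_diagram T) i m * ?v m) = (\<Sum>i<m. if i = a then - (?u a * ?v m) else 0)"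
    using assms a by (intro sum.cong) (auto simp: gram_branched)
  have q: "(\<Sum>i<m. \<Sum>j<m. ?u i * gram (dynkin_diagram T) i j * ?v j) = chain_form m ?u ?v"
    unfolding chain_form_def using assms a
    by (intro sum.cong refl arg_cong2[where f = "(*)"]) (auto simp: gram_branched)
  show ?thesis
    using a r c q by (simp add: root_form_def assms sum.distrib gram_branched)
qed

lemma sum_lessThan_ends:
  "(\<Sum>k<Suc (Suc m). f k) = f 0 + (\<Sum>k<m. f (Suc k)) + f (Suc m)" for f :: "nat \<Rightarrow> real"
  by (subst sum.lessThan_Suc, subst sum.lessThan_Suc_shift) simp

text \<open>The coordinates of \<open>\<real>\<^sup>l\<^sup>+\<^sup>1\<close> for \<open>A\<^sub>l\<close>, in which the simple roots are \<open>e\<^sub>i - e\<^sub>i\<^sub>+\<^sub>1\<close>, and of \<open>\<real>\<^sup>l\<close>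
  for \<open>D\<^sub>l\<close>, in which the last simple root is \<open>e\<^sub>l\<^sub>-\<^sub>2 + e\<^sub>l\<^sub>-\<^sub>1\<close> when counting from \<open>0\<close>.\<close>

definition coord_A :: "nat \<Rightarrow> nat \<Rightarrow> rvec \<Rightarrow> real" where
  "coord_A l k x = (if k < l then Poly_Mapping.lookup x k else 0)
     - (if k = 0 then 0 else Poly_Mapping.lookup x (k - 1))"

definition coord_D :: "nat \<Rightarrow> nat \<Rightarrow> rvec \<Rightarrow> real" where
  "coord_D l k x = Poly_Mapping.lookup x k - (if k = 0 then 0 else Poly_Mapping.lookup x (k - 1))
     + (if k = l - 2 then Poly_Mapping.lookup x (l - 1) else 0)"

lemma root_form_coord_A:
  assumes "1 \<le> l"
  shows "root_form (DynA l) x y = (\<Sum>k\<le>l. coord_A l k x * coord_A l k y)"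
proof -
  obtain m where l: "l = Suc m"
    using assms by (cases l) auto
  have "(\<Sum>k\<le>l. coord_A l k x * coord_A l k y) =
      coord_A l 0 x * coord_A l 0 y + (\<Sum>k<m. coord_A l (Suc k) x * coord_A l (Suc k) y)
      + coord_A l (Suc m) x * coord_A l (Suc m) y"
    by (simp only: lessThan_Suc_atMost[symmetric] sum_lessThan_ends l)
  then show ?thesis
    unfolding root_form_DynA l chain_form_squares by (simp add: coord_A_def)
qed

text \<open>The sum telescopes. Vectors of type A thus lie in the hyperplane of coordinate sum zero,
  and this is what later excludes type A as an extension.\<close>

lemma sum_coord_A:
  assumes "1 \<le> l"
  shows "(\<Sum>k\<le>l. coord_A l k x) = 0"
proof -
  have "(\<Sum>k\<le>n. (if k < l then Poly_Mapping.lookup x k else 0)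
     - (if k = 0 then 0 else Poly_Mapping.lookup x (k - 1))) = (if n < l then Poly_Mapping.lookup x n else 0)"
    if "n \<le> l" for n
    using that by (induction n) auto
  from this[of l] show ?thesis
    by (simp add: coord_A_def)
qed

lemma root_form_coord_D:
  assumes "4 \<le> l"
  shows "root_form (DynD l) x y = (\<Sum>k<l. coord_D l k x * coord_D l k y)"
proof -
  obtain m where "l = m + 4"
    using assms by (metis add.commute le_Suc_ex)
  then have l: "l = Suc (Suc (Suc (Suc m)))"
    by simp
  have "(\<Sum>k<l. coord_D l k x * coord_D l k y) = coord_D l 0 x * coord_D l 0 y
      + (\<Sum>k<Suc m. coord_D l (Suc k) x * coord_D l (Suc k) y)
      + coord_D l (Suc (Suc m)) x * coord_D l (Suc (Suc m)) y
      + coord_D l (Suc (Suc (Suc m))) x * coord_D l (Suc (Suc (Suc m))) y"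
    unfolding l by (subst sum.lessThan_Suc, subst sum_lessThan_ends) simp
  moreover have "root_form (DynD l) x y =
     chain_form (Suc (Suc (Suc m))) (Poly_Mapping.lookup x) (Poly_Mapping.lookup y)
     + 2 * Poly_Mapping.lookup x (Suc (Suc (Suc m))) * Poly_Mapping.lookup y (Suc (Suc (Suc m)))
     - Poly_Mapping.lookup x (Suc m) * Poly_Mapping.lookup y (Suc (Suc (Suc m)))
     - Poly_Mapping.lookup x (Suc (Suc (Suc m))) * Poly_Mapping.lookup y (Suc m)"
    by (rule root_form_branched) (auto simp: branched_def branch_node_def l)
  moreover have "(\<Sum>k<Suc m. coord_D l (Suc k) x * coord_D l (Suc k) y) =
      (\<Sum>k<Suc m. (Poly_Mapping.lookup x (Suc k) - Poly_Mapping.lookup x k) * (Poly_Mapping.lookup y (Suc k) - Poly_Mapping.lookup y k))"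
    by (intro sum.cong) (auto simp: coord_D_def l)
  ultimately show ?thesis
    unfolding chain_form_squares by (simp add: coord_D_def l algebra_simps)
qed

lemma coord_A_inject:
  assumes "\<And>k. k < l \<Longrightarrow> coord_A l k x = 0" "i < l"
  shows "Poly_Mapping.lookup x i = 0"
  using assms(2)
proof (induction i)
  case 0
  then show ?case using assms(1)[of 0] by (simp add: coord_A_def)
next
  case (Suc i)
  then show ?case using assms(1)[of "Suc i"] by (simp add: coord_A_def)
qed

text \<open>The system is triangular up to the last two coordinates, which give the sum and the
  difference of the last two entries.\<close>

lemma coord_D_inject:
  assumes "\<And>k. k < l \<Longrightarrow> coord_D l k x = 0" "i < l" "4 \<le> l"
  shows "Poly_Mapping.lookup x i = 0"
proof -
  have lo: "Poly_Mapping.lookup x j = 0" if "j \<le> l - 3" for j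
    using that
  proof (induction j)
    case 0
    then show ?case using assms(1)[of 0] assms(3) by (simp add: coord_D_def split: if_splits)
  next
    case (Suc j)
    then have "Suc j < l" "Suc j \<noteq> l - 2"
      using assms(3) by linarith+
    then show ?case using Suc assms(1)[of "Suc j"] by (simp add: coord_D_def)
  qed
  have "Poly_Mapping.lookup x (l - 2) + Poly_Mapping.lookup x (l - 1) = 0"
    using assms(1)[of "l - 2"] assms(3) lo[of "l - 3"]
    by (simp add: coord_D_def numeral_3_eq_3 numeral_2_eq_2 split: if_splits)
  moreover have "Poly_Mapping.lookup x (l - 1) - Poly_Mapping.lookup x (l - 2) = 0"
    using assms(1)[of "l - 1"] assms(3)
    by (simp add: coord_D_def numeral_2_eq_2 split: if_splits)
  ultimately have "Poly_Mapping.lookup x (l - 2) = 0" "Poly_Mapping.lookup x (l - 1) = 0"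
    by auto
  moreover have "i \<le> l - 3 \<or> i = l - 2 \<or> i = l - 1"
    using assms(2) by linarith
  ultimately show ?thesis
    using lo by blast
qed


lemma chain_form_numeral:
  "chain_form 5 u v = 2 * u 0 * v 0 + 2 * u 1 * v 1 + 2 * u 2 * v 2 + 2 * u 3 * v 3 + 2 * u 4 * v 4
     - (u 0 * v 1 + u 1 * v 0) - (u 1 * v 2 + u 2 * v 1) - (u 2 * v 3 + u 3 * v 2) - (u 3 * v 4 + u 4 * v 3)"
  "chain_form 6 u v = chain_form 5 u v + 2 * u 5 * v 5 - (u 4 * v 5 + u 5 * v 4)"
  "chain_form 7 u v = chain_form 6 u v + 2 * u 6 * v 6 - (u 5 * v 6 + u 6 * v 5)"
  by (simp_all add: numeral_eq_Suc chain_form_Suc)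

lemma root_form_DynE:
  fixes x y
  defines "u \<equiv> Poly_Mapping.lookup x" and "v \<equiv> Poly_Mapping.lookup y"
  shows "root_form (DynE 6) x y = chain_form 5 u v + 2 * u 5 * v 5 - u 2 * v 5 - u 5 * v 2"
    and "root_form (DynE 7) x y = chain_form 6 u v + 2 * u 6 * v 6 - u 2 * v 6 - u 6 * v 2"
    and "root_form (DynE 8) x y = chain_form 7 u v + 2 * u 7 * v 7 - u 2 * v 7 - u 7 * v 2"
  unfolding u_def v_def
  by (rule root_form_branched; simp add: branched_def branch_node_def)+

text \<open>Squares are completed along the three arms from their ends towards the branch node 2.
  The pivots on an arm are 2, 3/2, 4/3, 5/4, and the coefficient left at the branch node is
  \<open>1/p + 1/q + 1/r - 1\<close> for arms with \<open>p - 1\<close>, \<open>q - 1\<close>,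
  \<open>r - 1\<close> nodes: 1/6, 1/12 and 1/30.\<close>

lemma root_form_DynE_squares:
  fixes x
  defines "u \<equiv> Poly_Mapping.lookup x"
  shows "root_form (DynE 6) x x = 2*(u 0 - u 1/2)\<^sup>2 + 3/2*(u 1 - 2/3 * u 2)\<^sup>2 + 2*(u 5 - u 2/2)\<^sup>2
      + 2*(u 4 - u 3/2)\<^sup>2 + 3/2*(u 3 - 2/3 * u 2)\<^sup>2 + 1/6*(u 2)\<^sup>2"
    and "root_form (DynE 7) x x = 2*(u 0 - u 1/2)\<^sup>2 + 3/2*(u 1 - 2/3 * u 2)\<^sup>2 + 2*(u 6 - u 2/2)\<^sup>2
      + 2*(u 5 - u 4/2)\<^sup>2 + 3/2*(u 4 - 2/3 * u 3)\<^sup>2 + 4/3*(u 3 - 3/4 * u 2)\<^sup>2 + 1/12*(u 2)\<^sup>2"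
    and "root_form (DynE 8) x x = 2*(u 0 - u 1/2)\<^sup>2 + 3/2*(u 1 - 2/3 * u 2)\<^sup>2 + 2*(u 7 - u 2/2)\<^sup>2
      + 2*(u 6 - u 5/2)\<^sup>2 + 3/2*(u 5 - 2/3 * u 4)\<^sup>2 + 4/3*(u 4 - 3/4 * u 3)\<^sup>2
      + 5/4*(u 3 - 4/5 * u 2)\<^sup>2 + 1/30*(u 2)\<^sup>2"
  unfolding root_form_DynE chain_form_numeral u_def power2_eq_square by algebra+

lemma root_form_nonneg_DynE:
  assumes "l \<in> {6, 7, 8}"
  shows "0 \<le> root_form (DynE l) x x"
  using assms by (auto simp: root_form_DynE_squares)

lemma weighted_squares_eq_0D:
  fixes xs :: "(real \<times> real) list"
  assumes "(\<Sum>(r, b)\<leftarrow>xs. r * b\<^sup>2) = 0" "\<forall>(r, b)\<in>set xs. 0 < r"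
  shows "\<forall>(r, b)\<in>set xs. b = 0"
proof -
  have "\<forall>y\<in>set (map (\<lambda>(r, b). r * b\<^sup>2) xs). y = 0"
    using assms by (subst sum_list_nonneg_eq_0_iff[symmetric]) (auto simp: less_imp_le)
  then show ?thesis
    using assms(2) by fastforce
qed

lemma root_form_definite_DynE:
  assumes "l \<in> {6, 7, 8}" "root_form (DynE l) x x = 0" "i < l"
  shows "Poly_Mapping.lookup x i = 0"
proof -
  define u where "u = Poly_Mapping.lookup x"
  consider "l = 6" | "l = 7" | "l = 8"
    using assms(1) by auto
  then have "u i = 0"
  proof cases
    case 1
    have "\<forall>(r, b)\<in>set [(2::real, u 0 - u 1/2), (3/2, u 1 - 2/3 * u 2), (2, u 5 - u 2/2), (2, u 4 - u 3/2), (3/2, u 3 - 2/3 * u 2), (1/6, u 2)]. b = 0"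
      by (rule weighted_squares_eq_0D) (use assms(2) in \<open>simp_all add: 1 root_form_DynE_squares flip: u_def\<close>)
    then have "u 0 - u 1/2 = 0 \<and> u 1 - 2/3 * u 2 = 0 \<and> u 5 - u 2/2 = 0 \<and> u 4 - u 3/2 = 0 \<and> u 3 - 2/3 * u 2 = 0 \<and> u 2 = 0"
      unfolding list.set ball_simps prod.case simp_thms .
    then have "u 0 = 0 \<and> u 1 = 0 \<and> u 2 = 0 \<and> u 3 = 0 \<and> u 4 = 0 \<and> u 5 = 0"
      by (elim conjE, intro conjI; linarith)
    moreover have "i = 0 \<or> i = 1 \<or> i = 2 \<or> i = 3 \<or> i = 4 \<or> i = 5"
      using assms(3) 1 by auto
    ultimately show ?thesis by auto
  next
    case 2
    have "\<forall>(r, b)\<in>set [(2::real, u 0 - u 1/2), (3/2, u 1 - 2/3 * u 2), (2, u 6 - u 2/2), (2, u 5 - u 4/2), (3/2, u 4 - 2/3 * u 3), (4/3, u 3 - 3/4 * u 2), (1/12, u 2)]. b = 0"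
      by (rule weighted_squares_eq_0D) (use assms(2) in \<open>simp_all add: 2 root_form_DynE_squares flip: u_def\<close>)
    then have "u 0 - u 1/2 = 0 \<and> u 1 - 2/3 * u 2 = 0 \<and> u 6 - u 2/2 = 0 \<and> u 5 - u 4/2 = 0 \<and> u 4 - 2/3 * u 3 = 0 \<and> u 3 - 3/4 * u 2 = 0 \<and> u 2 = 0"
      unfolding list.set ball_simps prod.case simp_thms .
    then have "u 0 = 0 \<and> u 1 = 0 \<and> u 2 = 0 \<and> u 3 = 0 \<and> u 4 = 0 \<and> u 5 = 0 \<and> u 6 = 0"
      by (elim conjE, intro conjI; linarith)
    moreover have "i = 0 \<or> i = 1 \<or> i = 2 \<or> i = 3 \<or> i = 4 \<or> i = 5 \<or> i = 6"
      using assms(3) 2 by auto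
    ultimately show ?thesis by auto
  next
    case 3
    have "\<forall>(r, b)\<in>set [(2::real, u 0 - u 1/2), (3/2, u 1 - 2/3 * u 2), (2, u 7 - u 2/2), (2, u 6 - u 5/2), (3/2, u 5 - 2/3 * u 4), (4/3, u 4 - 3/4 * u 3), (5/4, u 3 - 4/5 * u 2), (1/30, u 2)]. b = 0"
      by (rule weighted_squares_eq_0D) (use assms(2) in \<open>simp_all add: 3 root_form_DynE_squares flip: u_def\<close>)
    then have "u 0 - u 1/2 = 0 \<and> u 1 - 2/3 * u 2 = 0 \<and> u 7 - u 2/2 = 0 \<and> u 6 - u 5/2 = 0 \<and> u 5 - 2/3 * u 4 = 0 \<and> u 4 - 3/4 * u 3 = 0 \<and> u 3 - 4/5 * u 2 = 0 \<and> u 2 = 0"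
      unfolding list.set ball_simps prod.case simp_thms .
    then have "u 0 = 0 \<and> u 1 = 0 \<and> u 2 = 0 \<and> u 3 = 0 \<and> u 4 = 0 \<and> u 5 = 0 \<and> u 6 = 0 \<and> u 7 = 0"
      by (elim conjE, intro conjI; linarith)
    moreover have "i = 0 \<or> i = 1 \<or> i = 2 \<or> i = 3 \<or> i = 4 \<or> i = 5 \<or> i = 6 \<or> i = 7"
      using assms(3) 3 by auto
    ultimately show ?thesis by auto
  qed
  then show ?thesis by (simp add: u_def)
qed

lemma sum_squares_pos:
  fixes f :: "'a \<Rightarrow> real"
  assumes "finite I" "k \<in> I" "f k \<noteq> 0"
  shows "0 < (\<Sum>k\<in>I. f k * f k)"
  using assms by (intro sum_pos2[of I k]) (auto simp: zero_less_mult_iff)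

text \<open>All types share one infinite-dimensional space, on which the form sees only the first
  \<open>node_count T\<close> coordinates. Positivity can therefore be claimed only from a nonzero
  entry among these.\<close>

lemma root_form_pos:
  assumes "is_dynkin T" "i < node_count T" "Poly_Mapping.lookup x i \<noteq> 0"
  shows "0 < root_form T x x"
proof (cases T)
  case (DynA l)
  then have "i < l" "1 \<le> l"
    using assms by auto
  then obtain k where "k < l" "coord_A l k x \<noteq> 0"
    using assms(3) coord_A_inject by metis
  then show ?thesis
    using DynA \<open>1 \<le> l\<close> sum_squares_pos[of "{..l}" k "\<lambda>k. coord_A l k x"] by (simp add: root_form_coord_A)
next
  case (DynD l)
  then have "i < l" "4 \<le> l"
    using assms by auto
  then obtain k where "k < l" "coord_D l k x \<noteq> 0"
    using assms(3) coord_D_inject by metis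
  then show ?thesis
    using DynD \<open>4 \<le> l\<close> sum_squares_pos[of "{..<l}" k "\<lambda>k. coord_D l k x"] by (simp add: root_form_coord_D)
next
  case (DynE l)
  then have l: "l \<in> {6, 7, 8}" and "i < l"
    using assms by auto
  then have "root_form (DynE l) x x \<noteq> 0"
    using root_form_definite_DynE[OF l _ \<open>i < l\<close>] assms(3) by blast
  then show ?thesis
    using root_form_nonneg_DynE[OF l, of x] DynE by simp
qed

section \<open>Roots as lattice vectors of norm two\<close>

definition supported :: "dynkin \<Rightarrow> rvec \<Rightarrow> bool" where
  "supported T x \<longleftrightarrow> (\<forall>i\<ge>node_count T. Poly_Mapping.lookup x i = 0)"

definition root_lattice :: "dynkin \<Rightarrow> rvec set" where
  "root_lattice T = {x. supported T x \<and> (\<forall>i. Poly_Mapping.lookup x i \<in> \<int>)}"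

lemma supported_pos: "is_dynkin T \<Longrightarrow> supported T x \<Longrightarrow> x \<noteq> 0 \<Longrightarrow> 0 < root_form T x x"
  by (metis lookup_zero not_le_imp_less poly_mapping_eqI root_form_pos supported_def)

lemma subspace_supported: "subspace (Collect (supported T))"
  by (auto simp: subspace_def supported_def lookup_add)

lemma supported_expand:
  assumes "supported T x"
  shows "x = (\<Sum>i<node_count T. Poly_Mapping.lookup x i *\<^sub>R simple_root i)"
proof (rule poly_mapping_eqI)
  fix j
  have "Poly_Mapping.lookup (\<Sum>i<node_count T. Poly_Mapping.lookup x i *\<^sub>R simple_root i) j
      = (\<Sum>i<node_count T. if i = j then Poly_Mapping.lookup x i else 0)"
    unfolding lookup_sum by (rule sum.cong) (simp_all add: lookup_single when_def)
  also have "\<dots> = (if j < node_count T then Poly_Mapping.lookup x j else 0)"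
    by (simp add: sum.delta)
  also have "\<dots> = Poly_Mapping.lookup x j"
    using assms unfolding supported_def by (cases "j < node_count T") simp_all
  finally show "Poly_Mapping.lookup x j = Poly_Mapping.lookup (\<Sum>i<node_count T. Poly_Mapping.lookup x i *\<^sub>R simple_root i) j" ..
qed

lemma root_lattice_add: "x \<in> root_lattice T \<Longrightarrow> y \<in> root_lattice T \<Longrightarrow> x + y \<in> root_lattice T"
  and root_lattice_diff: "x \<in> root_lattice T \<Longrightarrow> y \<in> root_lattice T \<Longrightarrow> x - y \<in> root_lattice T"
  and root_lattice_0: "0 \<in> root_lattice T"
  and root_lattice_scaleR: "c \<in> \<int> \<Longrightarrow> x \<in> root_lattice T \<Longrightarrow> c *\<^sub>R x \<in> root_lattice T"
  by (auto simp: root_lattice_def supported_def lookup_add lookup_minus)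

lemma root_lattice_sum: "(\<And>i. i \<in> A \<Longrightarrow> f i \<in> root_lattice T) \<Longrightarrow> sum f A \<in> root_lattice T"
  by (induction A rule: infinite_finite_induct) (auto simp: root_lattice_0 root_lattice_add)

lemma root_lattice_simple_root: "i < node_count T \<Longrightarrow> simple_root i \<in> root_lattice T"
  by (auto simp: root_lattice_def supported_def lookup_single when_def)

lemma root_form_simple_root:
  "i < node_count T \<Longrightarrow> j < node_count T \<Longrightarrow> root_form T (simple_root i) (simple_root j) = gram (dynkin_diagram T) i j"
proof -
  assume ij: "i < node_count T" "j < node_count T"
  have "root_form T (simple_root i) (simple_root j)
      = (\<Sum>a<node_count T. \<Sum>b<node_count T. if b = j then (if a = i then gram (dynkin_diagram T) i j else 0) else 0)"
    unfolding root_form_def by (intro sum.cong) (simp_all add: lookup_single when_def)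
  then show ?thesis
    using ij by simp
qed

lemma gram_Ints: "gram G i j \<in> \<int>"
  by (simp add: gram_def)

lemma root_form_Ints: "x \<in> root_lattice T \<Longrightarrow> y \<in> root_lattice T \<Longrightarrow> root_form T x y \<in> \<int>"
  unfolding root_form_def by (intro Ints_sum Ints_mult gram_Ints) (simp_all add: root_lattice_def)

lemma root_form_reflect:
  assumes "root_form T a a = 2"
  shows "root_form T (x - root_form T x a *\<^sub>R a) (y - root_form T y a *\<^sub>R a) = root_form T x y"
  using assms by (simp add: root_form_linear root_form_commute[of T a y] algebra_simps)

lemma root_in_lattice: "x \<in> root_system T \<Longrightarrow> x \<in> root_lattice T"
proof (induction rule: root_system.induct)
  case (simple i)
  then show ?case by (rule root_lattice_simple_root)
next
  case (reflect x i)
  then show ?case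
    by (intro root_lattice_diff root_lattice_scaleR root_form_Ints root_lattice_simple_root)
qed

lemma root_norm: "x \<in> root_system T \<Longrightarrow> root_form T x x = 2"
proof (induction rule: root_system.induct)
  case (simple i)
  then show ?case by (simp add: root_form_simple_root gram_def)
next
  case (reflect x i)
  then have "root_form T (simple_root i) (simple_root i) = 2"
    by (simp add: root_form_simple_root gram_def)
  then show ?case using reflect.IH by (simp add: root_form_reflect)
qed

text \<open>The norms of \<open>x - y\<close> and \<open>x + y\<close> are
  \<open>4 - 2 (x, y)\<close> and \<open>4 + 2 (x, y)\<close>; by definiteness a norm that is not
  positive makes the vector vanish.\<close>

lemma root_form_Cauchy_Schwarz:
  assumes "is_dynkin T" "supported T x" "supported T y" "root_form T x x = 2" "root_form T y y = 2"
  shows "root_form T x y \<ge> 2 \<Longrightarrow> x = y" "root_form T x y \<le> -2 \<Longrightarrow> x = - y"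
proof -
  have s: "supported T (x - y)" "supported T (x + y)"
    using assms(2,3) by (auto simp: supported_def lookup_add lookup_minus)
  show "x = y" if "root_form T x y \<ge> 2"
    using supported_pos[OF assms(1) s(1)] that assms(4,5)
    by (force simp: root_form_linear root_form_commute[of T y x])
  show "x = - y" if "root_form T x y \<le> -2"
    using supported_pos[OF assms(1) s(2)] that assms(4,5)
    by (force simp: root_form_linear root_form_commute[of T y x] add_eq_0_iff)
qed

text \<open>Descent: some \<open>x\<^sub>i (x, \<alpha>\<^sub>i)\<close> is positive, and reflecting in that \<open>\<alpha>\<^sub>i\<close> decreases \<open>\<Sum> \<bar>x\<^sub>i\<bar>\<close>.\<close>

lemma norm_two_in_root_system:
  assumes T: "is_dynkin T"
  shows "x \<in> root_lattice T \<Longrightarrow> root_form T x x = 2 \<Longrightarrow> x \<in> root_system T"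
proof (induction "\<Sum>i<node_count T. nat \<lfloor>\<bar>Poly_Mapping.lookup x i\<bar>\<rfloor>" arbitrary: x rule: less_induct)
  case less
  let ?x = "Poly_Mapping.lookup x"
  have sx: "supported T x" and xint: "\<And>i. ?x i \<in> \<int>"
    using less.prems(1) by (auto simp: root_lattice_def)
  have "root_form T x x = root_form T (\<Sum>i<node_count T. ?x i *\<^sub>R simple_root i) x"
    using supported_expand[OF sx] by simp
  also have "\<dots> = (\<Sum>i<node_count T. ?x i * root_form T x (simple_root i))"
    by (simp add: root_form_linear root_form_commute)
  finally have "(\<Sum>i<node_count T. ?x i * root_form T x (simple_root i)) > 0"
    using less.prems(2) by simp
  then obtain i where i: "i < node_count T" "?x i * root_form T x (simple_root i) > 0"
    by (meson lessThan_iff not_le sum_nonpos)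
  define r where "r = root_form T x (simple_root i)"
  have a: "simple_root i \<in> root_system T"
    using i(1) by (rule root_system.simple)
  note al = root_in_lattice[OF a] and an = root_norm[OF a]
  have sa: "supported T (simple_root i)"
    using al by (simp add: root_lattice_def)
  define y where "y = x - r *\<^sub>R simple_root i"
  have rint: "r \<in> \<int>"
    unfolding r_def using less.prems(1) al by (rule root_form_Ints)
  \<comment> \<open>Reflections are involutions, so membership of \<open>y\<close> in the root
    system returns that of \<open>x\<close>.\<close>
  have x_y: "x = y - root_form T y (simple_root i) *\<^sub>R simple_root i"
    by (simp add: y_def root_form_linear an flip: r_def)
  show ?case
  \<comment> \<open>For these two vectors the reflection is only a change of sign and gives no
    descent.\<close>
  proof (cases "x = simple_root i \<or> x = - simple_root i")
    case True
    moreover have "- simple_root i = simple_root i - root_form T (simple_root i) (simple_root i) *\<^sub>R simple_root i"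
      by (simp add: an scaleR_2)
    ultimately show ?thesis
      using root_system.reflect[OF a i(1)] a by metis
  next
    case False
    have "\<bar>r\<bar> < 2"
      using root_form_Cauchy_Schwarz[OF T sx sa less.prems(2) an] False by (force simp: r_def)
    moreover obtain k where k: "r = of_int k"
      using rint by (auto elim: Ints_cases)
    moreover obtain m where m: "?x i = of_int m"
      using xint by (meson Ints_cases)
    \<comment> \<open>The number \<open>r\<close> is a nonzero integer of absolute value below 2
      with the sign of the entry at \<open>i\<close>, so subtracting it brings this entry closer to
      0 by exactly one.\<close>
    ultimately have km: "k = 1 \<and> m \<ge> 1 \<or> k = -1 \<and> m \<le> -1"
      using i(2) by (auto simp: r_def[symmetric] zero_less_mult_iff)
    have ly: "Poly_Mapping.lookup y j = (if j = i then of_int (m - k) else ?x j)" for j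
      by (simp add: y_def lookup_minus lookup_single k m when_def)
    have "(\<Sum>i<node_count T. nat \<lfloor>\<bar>Poly_Mapping.lookup y i\<bar>\<rfloor>) < (\<Sum>i<node_count T. nat \<lfloor>\<bar>?x i\<bar>\<rfloor>)"
    proof (rule sum_strict_mono_ex1)
      show "\<forall>j\<in>{..<node_count T}. nat \<lfloor>\<bar>Poly_Mapping.lookup y j\<bar>\<rfloor> \<le> nat \<lfloor>\<bar>?x j\<bar>\<rfloor>"
        using km by (auto simp: ly m simp flip: of_int_abs of_int_diff)
      have "nat \<lfloor>\<bar>Poly_Mapping.lookup y i\<bar>\<rfloor> < nat \<lfloor>\<bar>?x i\<bar>\<rfloor>"
        using km by (auto simp: ly m simp flip: of_int_abs of_int_diff)
      then show "\<exists>j\<in>{..<node_count T}. nat \<lfloor>\<bar>Poly_Mapping.lookup y j\<bar>\<rfloor> < nat \<lfloor>\<bar>?x j\<bar>\<rfloor>"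
        using i(1) by blast
    qed simp
    moreover have "y \<in> root_lattice T"
      unfolding y_def using less.prems(1) rint al by (intro root_lattice_diff root_lattice_scaleR)
    moreover have "root_form T y y = 2"
      using root_form_reflect[OF an, of x x] less.prems(2) by (simp add: y_def r_def)
    ultimately have "y \<in> root_system T"
      by (rule less.hyps)
    then show ?thesis
      using root_system.reflect[OF _ i(1), of y] x_y by metis
  qed
qed

lemma root_system_iff: "is_dynkin T \<Longrightarrow> x \<in> root_system T \<longleftrightarrow> x \<in> root_lattice T \<and> root_form T x x = 2"
  using norm_two_in_root_system root_in_lattice root_norm by blast

lemma root_supported: "x \<in> root_system T \<Longrightarrow> supported T x"
  using root_in_lattice by (auto simp: root_lattice_def)

lemma root_form_roots_cases:
  assumes "is_dynkin T" "x \<in> root_system T" "y \<in> root_system T" "x \<noteq> y" "x \<noteq> - y"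
  shows "root_form T x y \<in> {-1, 0, 1}"
proof -
  obtain k where "root_form T x y = of_int k"
    using root_form_Ints root_in_lattice assms(2,3) by (meson Ints_cases)
  moreover have "\<not> root_form T x y \<ge> 2" "\<not> root_form T x y \<le> -2"
    using root_form_Cauchy_Schwarz[of T x y] root_norm root_supported assms by blast+
  ultimately have "k > -2" "k < 2"
    by linarith+
  then have "k = -1 \<or> k = 0 \<or> k = 1"
    by presburger
  with \<open>root_form T x y = of_int k\<close> show ?thesis by auto
qed

lemma span_simple_roots: "span (simple_root ` {..<node_count T}) = Collect (supported T)"
proof
  show "span (simple_root ` {..<node_count T}) \<subseteq> Collect (supported T)"
    by (rule span_minimal) (auto simp: subspace_supported root_supported root_system.simple)
  show "Collect (supported T) \<subseteq> span (simple_root ` {..<node_count T})"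
  proof
    fix x assume "x \<in> Collect (supported T)"
    then have "x = (\<Sum>i<node_count T. Poly_Mapping.lookup x i *\<^sub>R simple_root i)"
      by (intro supported_expand) simp
    also have "\<dots> \<in> span (simple_root ` {..<node_count T})"
      by (intro span_sum span_scale span_base) simp
    finally show "x \<in> span (simple_root ` {..<node_count T})" .
  qed
qed

lemma span_root_system: "span (root_system T) = Collect (supported T)"
proof
  show "span (root_system T) \<subseteq> Collect (supported T)"
    by (rule span_minimal) (auto simp: subspace_supported root_supported)
  show "Collect (supported T) \<subseteq> span (root_system T)"
    unfolding span_simple_roots[symmetric] by (rule span_mono) (auto intro: root_system.simple)
qed

text \<open>By definiteness a root is determined by its inner products with the simple roots, and
  each of these takes one of five values.\<close>

lemma finite_root_system:
  assumes "is_dynkin T"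
  shows "finite (root_system T)"
proof (rule finite_imageD)
  let ?f = "\<lambda>x. map (\<lambda>i. root_form T x (simple_root i)) [0..<node_count T]"
  have "?f ` root_system T \<subseteq> {xs. set xs \<subseteq> {-2, -1, 0, 1, 2} \<and> length xs = node_count T}"
  proof -
    have "\<forall>x\<in>root_system T. \<forall>i<node_count T. root_form T x (simple_root i) \<in> {-2, -1, 0, 1, 2}"
    proof (intro ballI allI impI)
      fix x i assume that: "x \<in> root_system T" "i < node_count T"
      show "root_form T x (simple_root i) \<in> {-2, -1, 0, 1, 2}"
      using root_form_roots_cases[OF assms that(1) root_system.simple[OF that(2)]] that
        root_norm[OF root_system.simple[OF that(2)]]
      by (cases "x = simple_root i \<or> x = - simple_root i") (auto simp: root_form_linear)
    qed
    then show ?thesis by (simp add: image_subset_iff del: insert_iff)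
  qed
  then show "finite (?f ` root_system T)"
    by (rule finite_subset) (simp add: finite_lists_length_eq)
  show "inj_on ?f (root_system T)"
  proof (rule inj_onI)
    fix x y assume xy: "x \<in> root_system T" "y \<in> root_system T" "?f x = ?f y"
    let ?z = "x - y"
    have z: "supported T ?z"
      using root_supported[OF xy(1)] root_supported[OF xy(2)] by (simp add: supported_def lookup_minus)
    have o: "root_form T ?z (simple_root i) = 0" if "i < node_count T" for i
      using xy(3) that by (simp add: root_form_linear)
    have "root_form T ?z ?z = root_form T ?z (\<Sum>i<node_count T. Poly_Mapping.lookup ?z i *\<^sub>R simple_root i)"
      using supported_expand[OF z] by simp
    also have "\<dots> = 0"
      using o by (simp add: root_form_linear(11,12))
    finally show "x = y"
      using supported_pos[OF assms z] by fastforce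
  qed
qed

lemma inj_simple_root: "inj_on simple_root A"
  by (auto simp: inj_on_def) (metis lookup_single_eq lookup_single_not_eq zero_neq_one)

lemma independent_simple_roots: "independent (simple_root ` {..<n})"
proof (rule independent_if_scalars_zero)
  fix f x assume s: "(\<Sum>x\<in>simple_root ` {..<n}. f x *\<^sub>R x) = 0" and x: "x \<in> simple_root ` {..<n}"
  then obtain j where j: "j < n" "x = simple_root j"
    by auto
  have "0 = Poly_Mapping.lookup (\<Sum>i<n. f (simple_root i) *\<^sub>R simple_root i) j"
    using s by (simp add: sum.reindex[OF inj_simple_root])
  also have "\<dots> = (\<Sum>i<n. if i = j then f (simple_root i) else 0)"
    unfolding lookup_sum by (rule sum.cong) (auto simp: lookup_single)
  finally show "f x = 0"
    using j by simp
qed simp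

lemma root_rank_eq: "root_rank T = node_count T"
proof -
  have "dim (root_system T) = dim (simple_root ` {..<node_count T})"
    by (metis dim_span span_root_system span_simple_roots)
  also have "\<dots> = node_count T"
    by (simp add: dim_eq_card_independent independent_simple_roots card_image inj_simple_root)
  finally show ?thesis
    by (simp add: root_rank_def)
qed

section \<open>Changing one root of a set\<close>

text \<open>Sets of roots are given by a node labelling, so injectivity and independence of the
  image are merged into one condition on coefficients indexed by nodes. In this form it survives the
  change of one root by a substitution of coefficients.\<close>

lemma independent_family_iff:
  fixes t :: "'i \<Rightarrow> 'a::real_vector"
  assumes "finite A"
  shows "inj_on t A \<and> independent (t ` A) \<longleftrightarrow> (\<forall>c. (\<Sum>i\<in>A. c i *\<^sub>R t i) = 0 \<longrightarrow> (\<forall>i\<in>A. c i = 0))"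
proof (intro iffI allI impI ballI)
  fix c i assume t: "inj_on t A \<and> independent (t ` A)" and s: "(\<Sum>i\<in>A. c i *\<^sub>R t i) = 0" and i: "i \<in> A"
  have "(\<Sum>v\<in>t ` A. c (inv_into A t v) *\<^sub>R v) = (\<Sum>i\<in>A. c i *\<^sub>R t i)"
    using t by (simp add: sum.reindex)
  then have "c (inv_into A t (t i)) = 0"
    using t s i assms by (intro independentD[of "t ` A" "t ` A" "\<lambda>v. c (inv_into A t v)"]) auto
  then show "c i = 0"
    using t i by simp
next
  assume z: "\<forall>c. (\<Sum>i\<in>A. c i *\<^sub>R t i) = 0 \<longrightarrow> (\<forall>i\<in>A. c i = 0)"
  have inj: "inj_on t A"
  proof (rule inj_onI, rule ccontr)
    fix i j assume ij: "i \<in> A" "j \<in> A" "t i = t j" "i \<noteq> j"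
    have "(\<Sum>k\<in>A. ((if k = i then 1 else 0) - (if k = j then 1 else 0)) *\<^sub>R t k) =
        (\<Sum>k\<in>A. if k = i then t i else 0) - (\<Sum>k\<in>A. if k = j then t j else 0)"
      unfolding sum_subtractf[symmetric] by (rule sum.cong) (auto simp: algebra_simps)
    also have "\<dots> = 0"
      using ij assms by simp
    finally have "\<forall>k\<in>A. (if k = i then 1 else 0) - (if k = j then 1 else 0) = (0::real)"
      using z[rule_format, of "\<lambda>k. (if k = i then 1 else 0) - (if k = j then 1 else 0)"] by blast
    then show False
      using ij by auto
  qed
  moreover have "independent (t ` A)"
  proof (rule independent_if_scalars_zero)
    fix f v assume s: "(\<Sum>v\<in>t ` A. f v *\<^sub>R v) = 0" and v: "v \<in> t ` A"
    have "(\<Sum>i\<in>A. f (t i) *\<^sub>R t i) = 0"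
      using s inj by (simp add: sum.reindex)
    then show "f v = 0"
      using z[rule_format, of "\<lambda>i. f (t i)"] v by blast
  qed (use assms in simp)
  ultimately show "inj_on t A \<and> independent (t ` A)" ..
qed

lemma span_family:
  fixes t :: "'i \<Rightarrow> 'a::real_vector"
  assumes "finite A"
  shows "span (t ` A) = range (\<lambda>c. \<Sum>i\<in>A. c i *\<^sub>R t i)"
proof
  show "range (\<lambda>c. \<Sum>i\<in>A. c i *\<^sub>R t i) \<subseteq> span (t ` A)"
    by (intro image_subsetI span_sum span_scale) (simp add: span_base)
  show "span (t ` A) \<subseteq> range (\<lambda>c. \<Sum>i\<in>A. c i *\<^sub>R t i)"
  proof (rule span_minimal)
    show "t ` A \<subseteq> range (\<lambda>c. \<Sum>i\<in>A. c i *\<^sub>R t i)"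
    proof
      fix v assume "v \<in> t ` A"
      then obtain j where j: "j \<in> A" "v = t j"
        by auto
      have "(\<Sum>i\<in>A. (if i = j then 1 else 0) *\<^sub>R t i) = (\<Sum>i\<in>A. if i = j then t j else 0)"
        by (rule sum.cong) auto
      also have "\<dots> = v"
        using j assms by simp
      finally show "v \<in> range (\<lambda>c. \<Sum>i\<in>A. c i *\<^sub>R t i)"
        by (intro range_eqI[of _ _ "\<lambda>i. if i = j then 1 else 0"]) simp
    qed
    show "subspace (range (\<lambda>c. \<Sum>i\<in>A. c i *\<^sub>R t i))"
    proof (unfold subspace_def, intro conjI ballI allI)
      show "0 \<in> range (\<lambda>c. \<Sum>i\<in>A. c i *\<^sub>R t i)"
        by (rule range_eqI[of _ _ "\<lambda>i. 0"]) simp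
    next
      fix x y assume "x \<in> range (\<lambda>c. \<Sum>i\<in>A. c i *\<^sub>R t i)" "y \<in> range (\<lambda>c. \<Sum>i\<in>A. c i *\<^sub>R t i)"
      then obtain c d where "x = (\<Sum>i\<in>A. c i *\<^sub>R t i)" "y = (\<Sum>i\<in>A. d i *\<^sub>R t i)"
        by auto
      then show "x + y \<in> range (\<lambda>c. \<Sum>i\<in>A. c i *\<^sub>R t i)"
        by (intro range_eqI[of _ _ "\<lambda>i. c i + d i"]) (simp add: scaleR_add_left sum.distrib)
    next
      fix r x assume "x \<in> range (\<lambda>c. \<Sum>i\<in>A. c i *\<^sub>R t i)"
      then obtain c where "x = (\<Sum>i\<in>A. c i *\<^sub>R t i)"
        by auto
      then show "r *\<^sub>R x \<in> range (\<lambda>c. \<Sum>i\<in>A. c i *\<^sub>R t i)"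
        by (intro range_eqI[of _ _ "\<lambda>i. r * c i"]) (simp add: scaleR_sum_right)
    qed
  qed
qed

text \<open>The Gram matrix \<open>g\<close> is an arbitrary function, diagonal included: between
  the change of a root and the relabelling of the nodes it need not be the \<open>gram\<close> of
  any named diagram.\<close>

definition root_tuple :: "dynkin \<Rightarrow> nat \<Rightarrow> (nat \<Rightarrow> nat \<Rightarrow> real) \<Rightarrow> (nat \<Rightarrow> rvec) \<Rightarrow> bool" where
  "root_tuple T l g t \<longleftrightarrow> (\<forall>i<l. t i \<in> root_system T) \<and>
     (\<forall>c. (\<Sum>i<l. c i *\<^sub>R t i) = 0 \<longrightarrow> (\<forall>i<l. c i = 0)) \<and>
     (\<forall>i<l. \<forall>j<l. root_form T (t i) (t j) = g i j)"

lemma labelled_gamma_set_iff: "labelled_gamma_set T G t \<longleftrightarrow> root_tuple T (num_nodes G) (gram G) t"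
proof -
  let ?n = "num_nodes G"
  have roots: "t ` {..<?n} \<subseteq> root_system T \<longleftrightarrow> (\<forall>i<?n. t i \<in> root_system T)"
    by auto
  have ind: "inj_on t {..<?n} \<and> independent (t ` {..<?n}) \<longleftrightarrow>
      (\<forall>c. (\<Sum>i<?n. c i *\<^sub>R t i) = 0 \<longrightarrow> (\<forall>i<?n. c i = 0))"
    by (subst independent_family_iff) (simp_all add: Ball_def)
  have "root_form T (t i) (t i) = gram G i i" if "t i \<in> root_system T" for i
    using root_norm[OF that] by (simp add: gram_def)
  then have gr: "(\<forall>i<?n. \<forall>j<?n. i \<noteq> j \<longrightarrow> root_form T (t i) (t j) = gram G i j) \<longleftrightarrow>
      (\<forall>i<?n. \<forall>j<?n. root_form T (t i) (t j) = gram G i j)" if "\<forall>i<?n. t i \<in> root_system T"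
    using that by blast
  show ?thesis
    unfolding labelled_gamma_set_def root_tuple_def ind[symmetric] roots using gr by argo
qed

text \<open>The lemmas take \<open>c a = -1\<close>. Keeping this coefficient inside
  \<open>c\<close> makes the new root a single sum over all nodes, and its inner products are then
  plain matrix products.\<close>

definition change_at :: "nat \<Rightarrow> nat \<Rightarrow> (nat \<Rightarrow> int) \<Rightarrow> (nat \<Rightarrow> rvec) \<Rightarrow> nat \<Rightarrow> rvec" where
  "change_at l a c t = t(a := \<Sum>i<l. of_int (c i) *\<^sub>R t i)"

definition change_gram :: "nat \<Rightarrow> nat \<Rightarrow> (nat \<Rightarrow> int) \<Rightarrow> (nat \<Rightarrow> nat \<Rightarrow> real) \<Rightarrow> nat \<Rightarrow> nat \<Rightarrow> real" where
  "change_gram l a c g i j =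
     (if i = a then (if j = a then \<Sum>k<l. of_int (c k) * (\<Sum>m<l. of_int (c m) * g k m)
                     else \<Sum>k<l. of_int (c k) * g k j)
      else if j = a then \<Sum>k<l. of_int (c k) * g i k
      else g i j)"

lemma sum_lessThan_remove: "a < l \<Longrightarrow> (\<Sum>i<l. f i) = f a + (\<Sum>i\<in>{..<l} - {a}. f i)"
  for f :: "nat \<Rightarrow> 'a::comm_monoid_add"
  by (rule sum.remove) auto

text \<open>With \<open>s\<close> the sum over the other nodes,
  \<open>- (- t a + s) + s = t a\<close>.\<close>

lemma change_at_involution:
  assumes "a < l" "c a = -1"
  shows "change_at l a c (change_at l a c t) = t"
proof -
  have "(\<Sum>i<l. of_int (c i) *\<^sub>R change_at l a c t i) =
      - (\<Sum>i<l. of_int (c i) *\<^sub>R t i) + (\<Sum>i\<in>{..<l} - {a}. of_int (c i) *\<^sub>R t i)"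
    by (subst sum_lessThan_remove[OF assms(1)]) (simp add: change_at_def assms(2))
  also have "\<dots> = t a"
    by (subst sum_lessThan_remove[OF assms(1)]) (simp add: assms(2))
  finally show ?thesis
    by (simp add: change_at_def fun_eq_iff)
qed

text \<open>The numerical counterpart of \<open>change_at_involution\<close>, for any symmetric
  matrix and without vectors. It identifies the Gram matrix obtained when a step is undone.\<close>

lemma change_gram_involution:
  assumes "a < l" "c a = -1" "\<And>i j. i < l \<Longrightarrow> j < l \<Longrightarrow> g i j = g j i" "i < l" "j < l"
  shows "change_gram l a c (change_gram l a c g) i j = g i j"
proof -
  let ?h = "change_gram l a c g" and ?R = "{..<l} - {a}"
  have row: "(\<Sum>k<l. of_int (c k) * ?h k j) = g a j" if "j < l" "j \<noteq> a" for j
  proof -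
    have "(\<Sum>k<l. of_int (c k) * ?h k j) = - (\<Sum>k<l. of_int (c k) * g k j) + (\<Sum>k\<in>?R. of_int (c k) * g k j)"
      using that by (subst sum_lessThan_remove[OF assms(1)]) (simp add: change_gram_def assms(2))
    also have "\<dots> = g a j"
      by (subst sum_lessThan_remove[OF assms(1)]) (simp add: assms(2))
    finally show ?thesis .
  qed
  have sym: "?h i j = ?h j i" if "i < l" "j < l" for i j
    using that assms(3) by (auto simp: change_gram_def intro!: sum.cong)
  have col: "(\<Sum>k<l. of_int (c k) * ?h i k) = g i a" if "i < l" "i \<noteq> a" for i
  proof -
    have "(\<Sum>k<l. of_int (c k) * ?h i k) = (\<Sum>k<l. of_int (c k) * ?h k i)"
      using that(1) sym by (intro sum.cong) auto
    then show ?thesis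
      using row[OF that] assms(1,3) that(1) by simp
  qed
  have "(\<Sum>m\<in>?R. of_int (c m) * ?h a m) = (\<Sum>m\<in>?R. of_int (c m) * (\<Sum>k<l. of_int (c k) * g k m))"
    by (intro sum.cong) (auto simp: change_gram_def)
  also have "\<dots> = (\<Sum>m<l. of_int (c m) * (\<Sum>k<l. of_int (c k) * g k m)) + (\<Sum>k<l. of_int (c k) * g k a)"
    by (subst sum_lessThan_remove[OF assms(1)]) (simp add: assms(2))
  also have "(\<Sum>m<l. of_int (c m) * (\<Sum>k<l. of_int (c k) * g k m)) = ?h a a"
    using assms(3) by (auto simp: change_gram_def intro!: sum.cong arg_cong2[where f = "(*)"])
  finally have aa: "(\<Sum>m<l. of_int (c m) * ?h a m) = (\<Sum>k<l. of_int (c k) * g k a)"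
    by (subst sum_lessThan_remove[OF assms(1)]) (simp add: assms(2))
  have "(\<Sum>k<l. of_int (c k) * (\<Sum>m<l. of_int (c m) * ?h k m)) =
      - (\<Sum>k<l. of_int (c k) * g k a) + (\<Sum>k\<in>?R. of_int (c k) * g k a)"
    using aa col by (subst sum_lessThan_remove[OF assms(1)]) (simp add: assms(2))
  also have "\<dots> = g a a"
    by (subst sum_lessThan_remove[OF assms(1)]) (simp add: assms(2))
  finally have norm: "(\<Sum>k<l. of_int (c k) * (\<Sum>m<l. of_int (c m) * ?h k m)) = g a a" .
  show ?thesis
    using row col norm assms(4,5)
    by (subst change_gram_def) (auto simp: change_gram_def[of _ _ _ g])
qed

lemma root_form_change_at:
  assumes "\<And>i j. i < l \<Longrightarrow> j < l \<Longrightarrow> root_form T (t i) (t j) = g i j" "i < l" "j < l"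
  shows "root_form T (change_at l a c t i) (change_at l a c t j) = change_gram l a c g i j"
  using assms by (auto simp: change_at_def change_gram_def root_form_linear intro!: sum.cong)

lemma change_at_span_subset: "change_at l a c t ` {..<l} \<subseteq> span (t ` {..<l})"
proof -
  have "(\<Sum>i<l. of_int (c i) *\<^sub>R t i) \<in> span (t ` {..<l})"
    by (intro span_sum span_scale span_base) simp
  then show ?thesis
    by (auto simp: change_at_def span_base)
qed

lemma span_change_at:
  assumes "a < l" "c a = -1"
  shows "span (change_at l a c t ` {..<l}) = span (t ` {..<l})"
  using change_at_span_subset[of l a c t] change_at_span_subset[of l a c "change_at l a c t"] assms
  by (simp add: change_at_involution span_minimal subset_antisym)

text \<open>The coefficients are integers, so the new vector stays in the root lattice; having norm
  two it is a root, whatever the ambient type \<open>T\<close> is.\<close>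

lemma root_tuple_change_at:
  assumes T: "is_dynkin T" and t: "root_tuple T l g t" and a: "a < l" "c a = -1" "change_gram l a c g a a = 2"
  shows "root_tuple T l (change_gram l a c g) (change_at l a c t)"
  unfolding root_tuple_def
proof (intro conjI allI impI)
  fix i j assume "i < l" "j < l"
  then show "root_form T (change_at l a c t i) (change_at l a c t j) = change_gram l a c g i j"
    using t by (intro root_form_change_at) (auto simp: root_tuple_def)
next
  fix i assume i: "i < l"
  have "root_form T (change_at l a c t a) (change_at l a c t a) = 2"
    using t a by (subst root_form_change_at[where g = g]) (auto simp: root_tuple_def)
  moreover have "(\<Sum>i<l. of_int (c i) *\<^sub>R t i) \<in> root_lattice T"
    using t by (intro root_lattice_sum root_lattice_scaleR root_in_lattice) (simp_all add: root_tuple_def)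
  then have "change_at l a c t a \<in> root_lattice T"
    by (simp add: change_at_def)
  ultimately have "change_at l a c t a \<in> root_system T"
    using T by (simp add: root_system_iff)
  then show "change_at l a c t i \<in> root_system T"
    using i t by (cases "i = a") (auto simp: change_at_def root_tuple_def)
next
  fix d i assume s: "(\<Sum>i<l. d i *\<^sub>R change_at l a c t i) = 0" and i: "i < l"
  let ?R = "{..<l} - {a}"
  \<comment> \<open>These are the coefficients of the given relation after expanding the changed
    root in terms of \<open>t\<close>. The entry at \<open>a\<close> is \<open>- d a\<close> because
    \<open>c a = -1\<close>.\<close>
  define e where "e k = (if k = a then - d a else d k + d a * of_int (c k))" for k
  have "(\<Sum>k<l. e k *\<^sub>R t k) = - d a *\<^sub>R t a + (\<Sum>k\<in>?R. d k *\<^sub>R t k) + d a *\<^sub>R (\<Sum>k\<in>?R. of_int (c k) *\<^sub>R t k)"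
    by (subst sum_lessThan_remove[OF a(1)])
      (simp add: e_def scaleR_add_left sum.distrib scaleR_sum_right)
  also have "\<dots> = (\<Sum>k\<in>?R. d k *\<^sub>R t k) + d a *\<^sub>R (\<Sum>k<l. of_int (c k) *\<^sub>R t k)"
    by (subst sum_lessThan_remove[OF a(1)]) (simp add: a(2) algebra_simps)
  also have "\<dots> = (\<Sum>i<l. d i *\<^sub>R change_at l a c t i)"
    by (rule sym, subst sum_lessThan_remove[OF a(1)]) (simp add: change_at_def)
  finally have "\<forall>k<l. e k = 0"
    using t s by (auto simp: root_tuple_def)
  moreover from this have "d a = 0"
    using a(1) by (auto simp: e_def)
  ultimately show "d i = 0"
    using i by (auto simp: e_def split: if_splits)
qed

lemma root_tuple_relabel:
  assumes "root_tuple T l g t" "bij_betw r {..<l} {..<l}"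
  shows "root_tuple T l (\<lambda>i j. g (r i) (r j)) (t \<circ> r)"
  unfolding root_tuple_def
proof (intro conjI allI impI)
  have r: "r i < l" if "i < l" for i
    using assms(2) that by (auto simp: bij_betw_def)
  fix i j assume i: "i < l" and j: "j < l"
  show "(t \<circ> r) i \<in> root_system T" "root_form T ((t \<circ> r) i) ((t \<circ> r) j) = g (r i) (r j)"
    using assms(1) r i j by (auto simp: root_tuple_def)
next
  fix d i assume s: "(\<Sum>i<l. d i *\<^sub>R (t \<circ> r) i) = 0" and i: "i < l"
  let ?q = "inv_into {..<l} r"
  have q: "?q (r k) = k" if "k < l" for k
    using assms(2) that by (simp add: bij_betw_inv_into_left)
  have "(\<Sum>k<l. d (?q k) *\<^sub>R t k) = (\<Sum>i<l. d (?q (r i)) *\<^sub>R t (r i))"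
    using assms(2) by (rule sum.reindex_bij_betw[symmetric])
  also have "\<dots> = 0"
    using s q by simp
  finally have "\<forall>k<l. d (?q k) = 0"
    using assms(1) by (auto simp: root_tuple_def)
  then show "d i = 0"
    using q[OF i] assms(2) i by (metis bij_betwE lessThan_iff)
qed

lemma root_tuple_inj:
  assumes "root_tuple T l g t"
  shows "inj_on t {..<l}" "independent (t ` {..<l})"
  using assms independent_family_iff[of "{..<l}" t] by (auto simp: root_tuple_def)

lemma root_tuple_cong:
  assumes "\<And>i j. i < l \<Longrightarrow> j < l \<Longrightarrow> g i j = h i j"
  shows "root_tuple T l g t \<longleftrightarrow> root_tuple T l h t"
  using assms by (simp add: root_tuple_def)

lemma one_root_change_change_at:
  assumes "inj_on t {..<l}" "a < l" "c a = -1"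
  shows "one_root_change (t ` {..<l}) (change_at l a c t ` {..<l})"
proof -
  let ?R = "{..<l} - {a}"
  \<comment> \<open>Coefficients in \<open>one_root_change\<close> are indexed by roots, those of
    \<open>change_at\<close> by nodes; injectivity of \<open>t\<close> translates one into the
    other.\<close>
  define d where "d b = c (inv_into {..<l} t b)" for b
  have R: "t ` {..<l} - {t a} = t ` ?R"
    using assms by (auto simp: inj_on_def)
  have injR: "inj_on t ?R"
    using assms(1) by (rule inj_on_subset) auto
  have "(\<Sum>b\<in>t ` {..<l} - {t a}. of_int (d b) *\<^sub>R b) = (\<Sum>k\<in>?R. of_int (c k) *\<^sub>R t k)"
    unfolding R sum.reindex[OF injR] using assms(1) by (intro sum.cong) (auto simp: d_def)
  then have "- t a + (\<Sum>b\<in>t ` {..<l} - {t a}. of_int (d b) *\<^sub>R b) = change_at l a c t a"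
    by (simp add: change_at_def sum_lessThan_remove[OF assms(2)] assms(3))
  moreover have "change_at l a c t ` {..<l} = insert (change_at l a c t a) (t ` ?R)"
    using assms(2) by (auto simp: change_at_def image_iff)
  ultimately have "change_at l a c t ` {..<l} =
      insert (- t a + (\<Sum>b\<in>t ` {..<l} - {t a}. of_int (d b) *\<^sub>R b)) (t ` {..<l} - {t a})"
    using R by simp
  then show ?thesis
    unfolding one_root_change_def using assms(2) by blast
qed

text \<open>Here \<open>r\<close> sends a node of \<open>G'\<close> to the node of \<open>G\<close> whose (possibly changed) root it carries.\<close>

definition diagram_step :: "nat \<Rightarrow> (nat \<Rightarrow> int) \<Rightarrow> (nat \<Rightarrow> nat) \<Rightarrow> diagram \<Rightarrow> diagram \<Rightarrow> bool" where
  "diagram_step a c r G G' \<longleftrightarrow>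
     num_nodes G' = num_nodes G \<and> a < num_nodes G \<and> c a = -1 \<and>
     bij_betw r {..<num_nodes G} {..<num_nodes G} \<and>
     change_gram (num_nodes G) a c (gram G) a a = 2 \<and>
     (\<forall>i<num_nodes G. \<forall>j<num_nodes G. gram G' i j = change_gram (num_nodes G) a c (gram G) (r i) (r j))"

lemma bij_betw_image_comp: "bij_betw r A A \<Longrightarrow> (f \<circ> r) ` A = f ` A"
  by (metis bij_betw_imp_surj_on image_comp)

lemma diagram_step_forward:
  assumes T: "is_dynkin T" and st: "diagram_step a c r G G'" and t: "labelled_gamma_set T G t"
  defines "t' \<equiv> change_at (num_nodes G) a c t \<circ> r"
  shows "labelled_gamma_set T G' t'"
    and "one_root_change (t ` {..<num_nodes G}) (t' ` {..<num_nodes G'})"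
    and "span (t' ` {..<num_nodes G'}) = span (t ` {..<num_nodes G})"
proof -
  let ?l = "num_nodes G"
  have n: "num_nodes G' = ?l" and a: "a < ?l" "c a = -1" "change_gram ?l a c (gram G) a a = 2"
    and r: "bij_betw r {..<?l} {..<?l}"
    and g: "\<And>i j. i < ?l \<Longrightarrow> j < ?l \<Longrightarrow> gram G' i j = change_gram ?l a c (gram G) (r i) (r j)"
    using st by (auto simp: diagram_step_def)
  have tt: "root_tuple T ?l (gram G) t"
    using t by (simp add: labelled_gamma_set_iff)
  have "root_tuple T ?l (\<lambda>i j. change_gram ?l a c (gram G) (r i) (r j)) t'"
    unfolding t'_def by (intro root_tuple_relabel root_tuple_change_at T tt a r)
  then show "labelled_gamma_set T G' t'"
    using g root_tuple_cong[of ?l "gram G'"] by (simp add: labelled_gamma_set_iff n)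
  have im: "t' ` {..<num_nodes G'} = change_at ?l a c t ` {..<?l}"
    unfolding t'_def n using r by (rule bij_betw_image_comp)
  show "one_root_change (t ` {..<?l}) (t' ` {..<num_nodes G'})"
    unfolding im using root_tuple_inj(1)[OF tt] a by (intro one_root_change_change_at)
  show "span (t' ` {..<num_nodes G'}) = span (t ` {..<?l})"
    unfolding im using a by (intro span_change_at)
qed

text \<open>A selected \<open>G'\<close>-set is arbitrary and need not have arisen from a
  transition, so the step must be invertible on every \<open>G'\<close>-set. Since the change is an
  involution, it suffices to undo the relabelling and to apply the same change again.\<close>

lemma diagram_step_backward:
  assumes T: "is_dynkin T" and st: "diagram_step a c r G G'" and t': "labelled_gamma_set T G' t'"
  defines "t \<equiv> change_at (num_nodes G) a c (t' \<circ> inv_into {..<num_nodes G} r)"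
  shows "labelled_gamma_set T G t"
    and "span (t ` {..<num_nodes G}) = span (t' ` {..<num_nodes G'})"
    and "i < num_nodes G \<Longrightarrow> t' i = change_at (num_nodes G) a c t (r i)"
proof -
  let ?l = "num_nodes G"
  define q where "q = inv_into {..<?l} r"
  have n: "num_nodes G' = ?l" and a: "a < ?l" "c a = -1" "change_gram ?l a c (gram G) a a = 2"
    and r: "bij_betw r {..<?l} {..<?l}"
    and g: "\<And>i j. i < ?l \<Longrightarrow> j < ?l \<Longrightarrow> gram G' i j = change_gram ?l a c (gram G) (r i) (r j)"
    using st by (auto simp: diagram_step_def)
  have q: "bij_betw q {..<?l} {..<?l}" "\<And>i. i < ?l \<Longrightarrow> r (q i) = i" "\<And>i. i < ?l \<Longrightarrow> q (r i) = i"
    using r by (auto simp: q_def bij_betw_inv_into bij_betw_inv_into_left bij_betw_inv_into_right)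
  have ql: "q i < ?l" if "i < ?l" for i
    using q(1) that by (auto simp: bij_betw_def)
  have "root_tuple T ?l (\<lambda>i j. gram G' (q i) (q j)) (t' \<circ> q)"
    using t' n by (intro root_tuple_relabel q(1)) (simp add: labelled_gamma_set_iff)
  then have 1: "root_tuple T ?l (change_gram ?l a c (gram G)) (t' \<circ> q)"
    using g ql q(2) root_tuple_cong[of ?l "\<lambda>i j. gram G' (q i) (q j)" "change_gram ?l a c (gram G)"] by simp
  have inv: "change_gram ?l a c (change_gram ?l a c (gram G)) i j = gram G i j" if "i < ?l" "j < ?l" for i j
    using that a by (intro change_gram_involution gram_commute)
  have "root_tuple T ?l (change_gram ?l a c (change_gram ?l a c (gram G))) t"
    unfolding t_def q_def[symmetric] using inv[OF a(1) a(1)] by (intro root_tuple_change_at T 1 a) (simp add: gram_def)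
  then show "labelled_gamma_set T G t"
    using inv root_tuple_cong[of ?l "change_gram ?l a c (change_gram ?l a c (gram G))"]
    by (simp add: labelled_gamma_set_iff)
  have "t ` {..<?l} = change_at ?l a c (t' \<circ> q) ` {..<?l}"
    by (simp add: t_def q_def)
  then show "span (t ` {..<?l}) = span (t' ` {..<num_nodes G'})"
    using a by (simp only: span_change_at bij_betw_image_comp[OF q(1)] n)
  show "t' i = change_at ?l a c t (r i)" if "i < ?l"
    using that a q(3) by (simp add: t_def q_def[symmetric] change_at_involution)
qed

section \<open>Integer matrices as certificates for the steps of type E\<close>

definition gram_matrix :: "diagram \<Rightarrow> int list list \<Rightarrow> bool" where
  "gram_matrix G M \<longleftrightarrow> num_nodes G = length M \<and> (\<forall>i<length M. \<forall>j<length M. gram G i j = of_int (M ! i ! j))"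

definition change_entry :: "nat \<Rightarrow> int list \<Rightarrow> int list list \<Rightarrow> nat \<Rightarrow> nat \<Rightarrow> int" where
  "change_entry a cs M i j =
     (if i = a then (if j = a then \<Sum>k\<leftarrow>[0..<length M]. cs ! k * (\<Sum>m\<leftarrow>[0..<length M]. cs ! m * M ! k ! m)
                     else \<Sum>k\<leftarrow>[0..<length M]. cs ! k * M ! k ! j)
      else if j = a then \<Sum>k\<leftarrow>[0..<length M]. cs ! k * M ! i ! k
      else M ! i ! j)"

text \<open>An executable version of \<open>diagram_step\<close>: real entries become integers,
  functions become lists, and bijectivity of the relabelling becomes distinctness of a list of nodes
  of full length.\<close>

definition step_check :: "nat \<Rightarrow> int list \<Rightarrow> nat list \<Rightarrow> int list list \<Rightarrow> int list list \<Rightarrow> bool" where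
  "step_check a cs rs M M' \<longleftrightarrow> length M' = length M \<and> a < length M \<and> cs ! a = -1 \<and>
     length rs = length M \<and> distinct rs \<and> list_all (\<lambda>x. x < length M) rs \<and>
     change_entry a cs M a a = 2 \<and>
     list_all (\<lambda>i. list_all (\<lambda>j. M' ! i ! j = change_entry a cs M (rs ! i) (rs ! j)) [0..<length M]) [0..<length M]"

lemma change_gram_matrix:
  assumes "gram_matrix G M" "i < length M" "j < length M" "a < length M"
  shows "change_gram (length M) a ((!) cs) (gram G) i j = of_int (change_entry a cs M i j)"
  using assms
  by (simp add: gram_matrix_def change_gram_def change_entry_def sum_list_distinct_conv_sum_set atLeast0LessThan)

lemma diagram_stepI:
  assumes "gram_matrix G M" "gram_matrix G' M'" "step_check a cs rs M M'"
  shows "diagram_step a ((!) cs) ((!) rs) G G'"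
proof -
  let ?l = "length M"
  have n: "num_nodes G = ?l" "num_nodes G' = ?l" and a: "a < ?l" "cs ! a = -1" "change_entry a cs M a a = 2"
    and rs: "length rs = ?l" "distinct rs" "\<forall>i<?l. rs ! i < ?l"
    and e: "\<And>i j. i < ?l \<Longrightarrow> j < ?l \<Longrightarrow> M' ! i ! j = change_entry a cs M (rs ! i) (rs ! j)"
    and M': "length M' = ?l"
    using assms by (auto simp: gram_matrix_def step_check_def list_all_iff)
  have inj: "inj_on ((!) rs) {..<?l}"
    using rs by (simp add: inj_on_def nth_eq_iff_index_eq)
  have "(!) rs ` {..<?l} = {..<?l}"
    by (rule endo_inj_surj) (use inj rs in auto)
  then have "bij_betw ((!) rs) {..<?l} {..<?l}"
    using inj by (simp add: bij_betw_def)
  moreover have "gram G' i j = change_gram ?l a ((!) cs) (gram G) (rs ! i) (rs ! j)" if "i < ?l" "j < ?l" for i j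
    using assms(2) that e rs(3) a(1) by (simp add: change_gram_matrix[OF assms(1)] gram_matrix_def M')
  ultimately show ?thesis
    using a by (simp add: diagram_step_def n change_gram_matrix[OF assms(1)])
qed

lemma num_nodes_dynkin_diagram [simp]: "num_nodes (dynkin_diagram T) = node_count T"
  by (cases T) auto

text \<open>The data of the steps between the diagrams of type \<open>E\<close> were found by a search over all roots.\<close>

definition E6_matrix :: "int list list" where
  "E6_matrix =
    [[2, -1, 0, 0, 0, 0],
     [-1, 2, -1, 0, 0, 0],
     [0, -1, 2, -1, 0, -1],
     [0, 0, -1, 2, -1, 0],
     [0, 0, 0, -1, 2, 0],
     [0, 0, -1, 0, 0, 2]]"

lemma gram_E6: "gram_matrix (dynkin_diagram (DynE 6)) E6_matrix"
  by (simp add: gram_matrix_def E6_matrix_def gram_branched branched_def branch_node_def All_less_Suc numeral_eq_Suc num_nodes_dynkin_diagram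
    del: dynkin_diagram.simps)

definition E6_a1_matrix :: "int list list" where
  "E6_a1_matrix =
    [[2, -1, 0, 1, -1, 0],
     [-1, 2, -1, 0, 0, -1],
     [0, -1, 2, -1, 0, 0],
     [1, 0, -1, 2, 0, 0],
     [-1, 0, 0, 0, 2, 0],
     [0, -1, 0, 0, 0, 2]]"

lemma gram_E6_a1: "gram_matrix (E6_a1) E6_a1_matrix"
  by (simp add: gram_matrix_def E6_a1_def E6_a1_matrix_def gram_def All_less_Suc numeral_eq_Suc doubleton_eq_iff)

definition E6_a2_matrix :: "int list list" where
  "E6_a2_matrix =
    [[2, -1, 0, -1, 0, 0],
     [-1, 2, -1, 0, 1, 0],
     [0, -1, 2, 0, 0, -1],
     [-1, 0, 0, 2, -1, 0],
     [0, 1, 0, -1, 2, -1],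
     [0, 0, -1, 0, -1, 2]]"

lemma gram_E6_a2: "gram_matrix (E6_a2) E6_a2_matrix"
  by (simp add: gram_matrix_def E6_a2_def E6_a2_matrix_def gram_def All_less_Suc numeral_eq_Suc doubleton_eq_iff)

lemma step_E6_E6_a1:
  "diagram_step 0 ((!) [-1, -1, -1, 0, 0, -1]) ((!) [3, 2, 5, 0, 4, 1]) (dynkin_diagram (DynE 6)) E6_a1"
  by (rule diagram_stepI[OF gram_E6 gram_E6_a1]) code_simp

lemma step_E6_E6_a2:
  "diagram_step 5 ((!) [-1, -1, -1, -1, -1, -1]) ((!) [0, 5, 4, 1, 2, 3]) (dynkin_diagram (DynE 6)) E6_a2"
  by (rule diagram_stepI[OF gram_E6 gram_E6_a2]) code_simp

definition E7_matrix :: "int list list" where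
  "E7_matrix =
    [[2, -1, 0, 0, 0, 0, 0],
     [-1, 2, -1, 0, 0, 0, 0],
     [0, -1, 2, -1, 0, 0, -1],
     [0, 0, -1, 2, -1, 0, 0],
     [0, 0, 0, -1, 2, -1, 0],
     [0, 0, 0, 0, -1, 2, 0],
     [0, 0, -1, 0, 0, 0, 2]]"

lemma gram_E7: "gram_matrix (dynkin_diagram (DynE 7)) E7_matrix"
  by (simp add: gram_matrix_def E7_matrix_def gram_branched branched_def branch_node_def All_less_Suc numeral_eq_Suc num_nodes_dynkin_diagram
    del: dynkin_diagram.simps)

definition E7_a1_matrix :: "int list list" where
  "E7_a1_matrix =
    [[2, -1, 0, 1, -1, 0, 0],
     [-1, 2, -1, 0, 0, -1, 0],
     [0, -1, 2, -1, 0, 0, 0],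
     [1, 0, -1, 2, 0, 0, 0],
     [-1, 0, 0, 0, 2, 0, 0],
     [0, -1, 0, 0, 0, 2, -1],
     [0, 0, 0, 0, 0, -1, 2]]"

lemma gram_E7_a1: "gram_matrix (E7_a1) E7_a1_matrix"
  by (simp add: gram_matrix_def E7_a1_def E7_a1_matrix_def gram_def All_less_Suc numeral_eq_Suc doubleton_eq_iff)

definition E7_a2_matrix :: "int list list" where
  "E7_a2_matrix =
    [[2, -1, 0, 1, -1, 0, 0],
     [-1, 2, -1, 0, 0, -1, 0],
     [0, -1, 2, -1, 0, 0, -1],
     [1, 0, -1, 2, 0, 0, 0],
     [-1, 0, 0, 0, 2, 0, 0],
     [0, -1, 0, 0, 0, 2, 0],
     [0, 0, -1, 0, 0, 0, 2]]"

lemma gram_E7_a2: "gram_matrix (E7_a2) E7_a2_matrix"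
  by (simp add: gram_matrix_def E7_a2_def E7_a2_matrix_def gram_def All_less_Suc numeral_eq_Suc doubleton_eq_iff)

definition E7_a3_matrix :: "int list list" where
  "E7_a3_matrix =
    [[2, -1, 0, -1, 0, 0, -1],
     [-1, 2, -1, 0, 1, 0, 0],
     [0, -1, 2, 0, 0, -1, 0],
     [-1, 0, 0, 2, -1, 0, 0],
     [0, 1, 0, -1, 2, -1, 0],
     [0, 0, -1, 0, -1, 2, 0],
     [-1, 0, 0, 0, 0, 0, 2]]"

lemma gram_E7_a3: "gram_matrix (E7_a3) E7_a3_matrix"
  by (simp add: gram_matrix_def E7_a3_def E7_a3_matrix_def gram_def All_less_Suc numeral_eq_Suc doubleton_eq_iff)

definition E7_a4_matrix :: "int list list" where
  "E7_a4_matrix =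
    [[2, 1, -1, -1, 0, 0, 0],
     [1, 2, 0, 0, -1, 0, -1],
     [-1, 0, 2, 0, -1, -1, 0],
     [-1, 0, 0, 2, 0, 1, -1],
     [0, -1, -1, 0, 2, 0, 0],
     [0, 0, -1, 1, 0, 2, 0],
     [0, -1, 0, -1, 0, 0, 2]]"

lemma gram_E7_a4: "gram_matrix (E7_a4) E7_a4_matrix"
  by (simp add: gram_matrix_def E7_a4_def E7_a4_matrix_def gram_def All_less_Suc numeral_eq_Suc doubleton_eq_iff)

lemma step_E7_E7_a1:
  "diagram_step 5 ((!) [0, 0, -1, -1, -1, -1, -1]) ((!) [1, 2, 6, 5, 0, 3, 4]) (dynkin_diagram (DynE 7)) E7_a1"
  by (rule diagram_stepI[OF gram_E7 gram_E7_a1]) code_simp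

lemma step_E7_E7_a2:
  "diagram_step 4 ((!) [-1, -2, -2, -1, -1, -1, -1]) ((!) [4, 1, 2, 3, 5, 0, 6]) (dynkin_diagram (DynE 7)) E7_a2"
  by (rule diagram_stepI[OF gram_E7 gram_E7_a2]) code_simp

lemma step_E7_E7_a3:
  "diagram_step 0 ((!) [-1, -2, -2, -1, -1, -1, -1]) ((!) [2, 3, 4, 1, 0, 5, 6]) (dynkin_diagram (DynE 7)) E7_a3"
  by (rule diagram_stepI[OF gram_E7 gram_E7_a3]) code_simp

lemma step_E7_a2_E7_a4:
  "diagram_step 5 ((!) [-1, -1, -1, 0, -1, -1, -1]) ((!) [1, 5, 2, 0, 6, 3, 4]) (E7_a2) E7_a4"
  by (rule diagram_stepI[OF gram_E7_a2 gram_E7_a4]) code_simp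

definition E8_matrix :: "int list list" where
  "E8_matrix =
    [[2, -1, 0, 0, 0, 0, 0, 0],
     [-1, 2, -1, 0, 0, 0, 0, 0],
     [0, -1, 2, -1, 0, 0, 0, -1],
     [0, 0, -1, 2, -1, 0, 0, 0],
     [0, 0, 0, -1, 2, -1, 0, 0],
     [0, 0, 0, 0, -1, 2, -1, 0],
     [0, 0, 0, 0, 0, -1, 2, 0],
     [0, 0, -1, 0, 0, 0, 0, 2]]"

lemma gram_E8: "gram_matrix (dynkin_diagram (DynE 8)) E8_matrix"
  by (simp add: gram_matrix_def E8_matrix_def gram_branched branched_def branch_node_def All_less_Suc numeral_eq_Suc num_nodes_dynkin_diagram
    del: dynkin_diagram.simps)

definition E8_a1_matrix :: "int list list" where
  "E8_a1_matrix =
    [[2, -1, 0, 1, -1, 0, 0, 0],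
     [-1, 2, -1, 0, 0, -1, 0, 0],
     [0, -1, 2, -1, 0, 0, 0, 0],
     [1, 0, -1, 2, 0, 0, 0, 0],
     [-1, 0, 0, 0, 2, 0, 0, 0],
     [0, -1, 0, 0, 0, 2, -1, 0],
     [0, 0, 0, 0, 0, -1, 2, -1],
     [0, 0, 0, 0, 0, 0, -1, 2]]"

lemma gram_E8_a1: "gram_matrix (E8_a1) E8_a1_matrix"
  by (simp add: gram_matrix_def E8_a1_def E8_a1_matrix_def gram_def All_less_Suc numeral_eq_Suc doubleton_eq_iff)

definition E8_a2_matrix :: "int list list" where
  "E8_a2_matrix =
    [[2, -1, 0, 1, -1, 0, 0, 0],
     [-1, 2, -1, 0, 0, -1, 0, 0],
     [0, -1, 2, -1, 0, 0, 0, 0],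
     [1, 0, -1, 2, 0, 0, 0, -1],
     [-1, 0, 0, 0, 2, 0, 0, 0],
     [0, -1, 0, 0, 0, 2, -1, 0],
     [0, 0, 0, 0, 0, -1, 2, 0],
     [0, 0, 0, -1, 0, 0, 0, 2]]"

lemma gram_E8_a2: "gram_matrix (E8_a2) E8_a2_matrix"
  by (simp add: gram_matrix_def E8_a2_def E8_a2_matrix_def gram_def All_less_Suc numeral_eq_Suc doubleton_eq_iff)

definition E8_a3_matrix :: "int list list" where
  "E8_a3_matrix =
    [[2, -1, 0, 1, -1, 0, 0, 0],
     [-1, 2, -1, 0, 0, -1, 0, 0],
     [0, -1, 2, -1, 0, 0, -1, 0],
     [1, 0, -1, 2, 0, 0, 0, -1],
     [-1, 0, 0, 0, 2, 0, 0, 0],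
     [0, -1, 0, 0, 0, 2, 0, 0],
     [0, 0, -1, 0, 0, 0, 2, 0],
     [0, 0, 0, -1, 0, 0, 0, 2]]"

lemma gram_E8_a3: "gram_matrix (E8_a3) E8_a3_matrix"
  by (simp add: gram_matrix_def E8_a3_def E8_a3_matrix_def gram_def All_less_Suc numeral_eq_Suc doubleton_eq_iff)

definition E8_a4_matrix :: "int list list" where
  "E8_a4_matrix =
    [[2, -1, 0, -1, 0, 0, -1, 0],
     [-1, 2, -1, 0, 1, 0, 0, 0],
     [0, -1, 2, 0, 0, -1, 0, 0],
     [-1, 0, 0, 2, -1, 0, 0, 0],
     [0, 1, 0, -1, 2, -1, 0, 0],
     [0, 0, -1, 0, -1, 2, 0, 0],
     [-1, 0, 0, 0, 0, 0, 2, -1],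
     [0, 0, 0, 0, 0, 0, -1, 2]]"

lemma gram_E8_a4: "gram_matrix (E8_a4) E8_a4_matrix"
  by (simp add: gram_matrix_def E8_a4_def E8_a4_matrix_def gram_def All_less_Suc numeral_eq_Suc doubleton_eq_iff)

definition E8_a5_matrix :: "int list list" where
  "E8_a5_matrix =
    [[2, -1, 0, -1, 0, 0, -1, 0],
     [-1, 2, -1, 0, 1, 0, 0, 0],
     [0, -1, 2, 0, 0, -1, 0, 0],
     [-1, 0, 0, 2, -1, 0, 0, 0],
     [0, 1, 0, -1, 2, -1, 0, 0],
     [0, 0, -1, 0, -1, 2, 0, -1],
     [-1, 0, 0, 0, 0, 0, 2, 0],
     [0, 0, 0, 0, 0, -1, 0, 2]]"

lemma gram_E8_a5: "gram_matrix (E8_a5) E8_a5_matrix"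
  by (simp add: gram_matrix_def E8_a5_def E8_a5_matrix_def gram_def All_less_Suc numeral_eq_Suc doubleton_eq_iff)

definition E8_a6_matrix :: "int list list" where
  "E8_a6_matrix =
    [[2, -1, 0, 0, -1, 0, 0, 0],
     [-1, 2, -1, 0, 0, 1, 0, 0],
     [0, -1, 2, -1, 0, 0, -1, 0],
     [0, 0, -1, 2, 0, 0, 0, 1],
     [-1, 0, 0, 0, 2, -1, 0, 0],
     [0, 1, 0, 0, -1, 2, -1, 0],
     [0, 0, -1, 0, 0, -1, 2, -1],
     [0, 0, 0, 1, 0, 0, -1, 2]]"

lemma gram_E8_a6: "gram_matrix (E8_a6) E8_a6_matrix"
  by (simp add: gram_matrix_def E8_a6_def E8_a6_matrix_def gram_def All_less_Suc numeral_eq_Suc doubleton_eq_iff)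

definition E8_a7_matrix :: "int list list" where
  "E8_a7_matrix =
    [[2, 1, -1, -1, 0, 0, 0, 0],
     [1, 2, 0, 0, -1, 0, -1, 0],
     [-1, 0, 2, 0, -1, -1, 0, 0],
     [-1, 0, 0, 2, 0, 1, -1, 0],
     [0, -1, -1, 0, 2, 0, 0, -1],
     [0, 0, -1, 1, 0, 2, 0, 0],
     [0, -1, 0, -1, 0, 0, 2, 0],
     [0, 0, 0, 0, -1, 0, 0, 2]]"

lemma gram_E8_a7: "gram_matrix (E8_a7) E8_a7_matrix"
  by (simp add: gram_matrix_def E8_a7_def E8_a7_matrix_def gram_def All_less_Suc numeral_eq_Suc doubleton_eq_iff)

definition E8_a8_matrix :: "int list list" where
  "E8_a8_matrix =
    [[2, 1, -1, -1, 0, 0, 0, 0],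
     [1, 2, 0, 0, -1, 0, -1, 0],
     [-1, 0, 2, 0, -1, -1, 0, 0],
     [-1, 0, 0, 2, 0, 1, -1, 0],
     [0, -1, -1, 0, 2, 0, 0, 1],
     [0, 0, -1, 1, 0, 2, 0, -1],
     [0, -1, 0, -1, 0, 0, 2, -1],
     [0, 0, 0, 0, 1, -1, -1, 2]]"

lemma gram_E8_a8: "gram_matrix (E8_a8) E8_a8_matrix"
  by (simp add: gram_matrix_def E8_a8_def E8_a8_matrix_def gram_def All_less_Suc numeral_eq_Suc doubleton_eq_iff)

lemma step_E8_E8_a1:
  "diagram_step 6 ((!) [0, 0, -1, -1, -1, -1, -1, -1]) ((!) [1, 2, 7, 6, 0, 3, 4, 5]) (dynkin_diagram (DynE 8)) E8_a1"
  by (rule diagram_stepI[OF gram_E8 gram_E8_a1]) code_simp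

lemma step_E8_E8_a2:
  "diagram_step 5 ((!) [0, 0, -1, -1, -1, -1, -1, -1]) ((!) [1, 2, 7, 5, 0, 3, 4, 6]) (dynkin_diagram (DynE 8)) E8_a2"
  by (rule diagram_stepI[OF gram_E8 gram_E8_a2]) code_simp

lemma step_E8_E8_a3:
  "diagram_step 5 ((!) [-1, -2, -2, -1, -1, -1, -1, -1]) ((!) [3, 2, 1, 5, 4, 7, 0, 6]) (dynkin_diagram (DynE 8)) E8_a3"
  by (rule diagram_stepI[OF gram_E8 gram_E8_a3]) code_simp

lemma step_E8_E8_a4:
  "diagram_step 7 ((!) [-1, -2, -3, -2, -1, -1, -1, -1]) ((!) [2, 7, 6, 3, 4, 5, 1, 0]) (dynkin_diagram (DynE 8)) E8_a4"
  by (rule diagram_stepI[OF gram_E8 gram_E8_a4]) code_simp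

lemma step_E8_E8_a5:
  "diagram_step 0 ((!) [-1, -2, -3, -2, -2, -2, -1, -2]) ((!) [2, 3, 4, 7, 0, 5, 1, 6]) (dynkin_diagram (DynE 8)) E8_a5"
  by (rule diagram_stepI[OF gram_E8 gram_E8_a5]) code_simp

lemma step_E8_a4_E8_a6:
  "diagram_step 7 ((!) [-2, -1, -1, -2, -1, -1, -1, -1]) ((!) [2, 1, 0, 6, 5, 4, 3, 7]) (E8_a4) E8_a6"
  by (rule diagram_stepI[OF gram_E8_a4 gram_E8_a6]) code_simp

lemma step_E8_a4_E8_a7:
  "diagram_step 7 ((!) [-3, -2, -1, -2, 0, 0, -2, -1]) ((!) [4, 1, 3, 5, 0, 7, 2, 6]) (E8_a4) E8_a7"
  by (rule diagram_stepI[OF gram_E8_a4 gram_E8_a7]) code_simp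

lemma step_E8_a7_E8_a8:
  "diagram_step 7 ((!) [0, -1, -1, 0, -1, -1, -1, -1]) ((!) [0, 1, 2, 3, 4, 5, 6, 7]) (E8_a7) E8_a8"
  by (rule diagram_stepI[OF gram_E8_a7 gram_E8_a8]) code_simp

section \<open>The steps of type D\<close>

lemma gram_carter_D:
  "gram (carter_D l k) i j =
    (if i = j then 2
     else if (i = k - 1 \<and> j = l - 1) \<or> (i = l - 1 \<and> j = k - 1)
       \<or> (j = i + 1 \<and> j < l - 1) \<or> (i = j + 1 \<and> i < l - 1) then -1
     else if (i = k + 1 \<and> j = l - 1) \<or> (i = l - 1 \<and> j = k + 1) then 1
     else 0)"
  unfolding gram_def carter_D_def diagram.select_convs insert_iff consecutive_pair_iff doubleton_eq_iff empty_iff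
  by (simp only: simp_thms disj_assoc)

lemma sum_chain_row:
  fixes f :: "nat \<Rightarrow> real"
  assumes "j < m"
  shows "(\<Sum>k<m. f k * (if k = j then 2 else if j = k + 1 \<or> k = j + 1 then -1 else 0)) =
     2 * f j - (if 0 < j then f (j - 1) else 0) - (if j + 1 < m then f (j + 1) else 0)"
proof -
  have "(\<Sum>k<m. f k * (if k = j then 2 else if j = k + 1 \<or> k = j + 1 then -1 else 0)) =
     (\<Sum>k<m. (if k = j then 2 * f j else 0) - (if k = j - 1 then if 0 < j then f (j - 1) else 0 else 0)
       - (if k = j + 1 then f (j + 1) else 0))"
    by (intro sum.cong) auto
  then show ?thesis
    using assms by (simp add: sum_subtractf)
qed

text \<open>A row vector times the Cartan matrix involves only the neighbours of each node. The
  changed root of a step, the highest root and the columns of the inverse Cartan matrix are all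
  verified in this form.\<close>

lemma sum_gram_branched:
  assumes "branched T" "j < node_count T"
  shows "(\<Sum>k<node_count T. f k * gram (dynkin_diagram T) k j) = 2 * f j
     - (if 0 < j \<and> j < node_count T - 1 then f (j - 1) else 0)
     - (if j + 1 < node_count T - 1 then f (j + 1) else 0)
     - (if j = branch_node T then f (node_count T - 1) else 0)
     - (if j = node_count T - 1 then f (branch_node T) else 0)"
proof -
  let ?b = "branch_node T" and ?g = "gram (dynkin_diagram T)"
  obtain m where m: "node_count T = Suc m" "?b < m - 1"
    using branched_node_count[OF assms(1)] by (cases "node_count T") auto
  have bm: "?b < m" "m \<noteq> ?b"
    using m(2) by auto
  show ?thesis
  proof (cases "j = m")
    case True
    have "(\<Sum>k<m. f k * ?g k j) = (\<Sum>k<m. if k = ?b then - f ?b else 0)"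
      using m True by (intro sum.cong) (auto simp: gram_branched[OF assms(1)])
    then show ?thesis
      using m bm True by (simp add: gram_branched[OF assms(1)])
  next
    case False
    then have j: "j < m"
      using assms(2) m by simp
    have "(\<Sum>k<m. f k * ?g k j) = (\<Sum>k<m. f k * (if k = j then 2 else if j = k + 1 \<or> k = j + 1 then -1 else 0))"
      using m j by (intro sum.cong) (auto simp: gram_branched[OF assms(1)])
    moreover have "?g m j = (if j = ?b then -1 else 0)"
      using m j by (auto simp: gram_branched[OF assms(1)])
    ultimately show ?thesis
      using m j by (simp add: sum_chain_row[OF j])
  qed
qed

text \<open>In the coordinates \<open>e\<^sub>1, \<dots>, e\<^sub>l\<close> of \<open>D\<^sub>l\<close> with \<open>l = a + k + 3\<close>, the root
  \<open>e\<^sub>a\<^sub>+\<^sub>1 - e\<^sub>a\<^sub>+\<^sub>2\<close> is replaced by \<open>- (e\<^sub>1 + e\<^sub>l)\<close>.\<close>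

definition carter_D_node :: "nat \<Rightarrow> nat \<Rightarrow> nat \<Rightarrow> nat" where
  "carter_D_node a k m =
     (if m = a + k + 2 then a + k + 1 else if m = k then a + k + 2 else if m = k + 1 then a
      else if m < k then m + a + 1 else m - k - 2)"

lemma bij_carter_D_node: "bij_betw (carter_D_node a k) {..<a + k + 3} {..<a + k + 3}"
  by (rule bij_betw_byWitness[where f' = "\<lambda>n. if n = a + k + 1 then a + k + 2 else if n = a + k + 2 then k
      else if n = a then k + 1 else if a < n then n - a - 1 else n + k + 2"])
    (auto simp: carter_D_node_def)

text \<open>Dropping node \<open>a\<close> cuts the chain of \<open>D_l\<close>. The new root is
  joined to both end nodes \<open>l - 2\<close> and \<open>l - 1\<close>, with a dotted edge to
  \<open>l - 2\<close>, and so closes a square with the branch node \<open>a + k\<close>. The tail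
  \<open>a + 1, ..., a + k - 1\<close> hangs at the branch node and the tail
  \<open>0, ..., a - 1\<close> at the new root, which are the chains of \<open>k - 1\<close> and
  \<open>l - k - 3\<close> nodes of \<open>D_l(a_k)\<close>.\<close>

lemma step_carter_D:
  assumes k: "1 \<le> k" "k \<le> a + 1"
  defines "l \<equiv> a + k + 3"
  shows "diagram_step a (\<lambda>i. if i = a + k + 1 then 0 else -1) (carter_D_node a k)
    (dynkin_diagram (DynD l)) (carter_D l k)"
    (is "diagram_step _ ?c _ _ _")
proof -
  let ?D = "dynkin_diagram (DynD l)" and ?r = "carter_D_node a k"
  \<comment> \<open>The values of \<open>w\<close> are the inner products of
    \<open>- (e_1 + e_l)\<close> with the simple roots. The root \<open>e_1 + e_l\<close> is the sum
    of all simple roots except \<open>e_(l-1) - e_l\<close>, which is node \<open>a + k + 1\<close>;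
    this explains the coefficients \<open>?c\<close>.\<close>
  define w :: "nat \<Rightarrow> real" where
    "w j = (if j = 0 then -1 else if j = a + k + 1 then 1 else if j = a + k + 2 then -1 else 0)" for j
  have br: "branched (DynD l)" "branch_node (DynD l) = a + k"
    using k by (auto simp: l_def branched_def branch_node_def)
  have w: "(\<Sum>i<l. of_int (?c i) * gram ?D i j) = w j" if "j < l" for j
  proof -
    define C :: "nat \<Rightarrow> real" where "C i = (if i = a + k + 1 then 0 else -1)" for i
    have "of_int (?c i) = C i" for i
      by (simp add: C_def)
    then have "(\<Sum>i<l. of_int (?c i) * gram ?D i j) = 2 * C j
        - (if 0 < j \<and> j < a + k + 2 then C (j - 1) else 0) - (if j + 1 < a + k + 2 then C (j + 1) else 0)
        - (if j = a + k then C (a + k + 2) else 0) - (if j = a + k + 2 then C (a + k) else 0)"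
      using sum_gram_branched[OF br(1), of j C] that unfolding br(2) node_count.simps
      by (simp only: l_def) (simp del: dynkin_diagram.simps)
    also have "\<dots> = w j"
      using that k(1) unfolding C_def w_def l_def
      by (cases "j = 0"; cases "j = a + k"; cases "j = a + k + 1"; cases "j = a + k + 2") auto
    finally show ?thesis .
  qed
  have w': "(\<Sum>i<l. of_int (?c i) * gram ?D j i) = w j" if "j < l" for j
    using w[OF that] gram_commute[of ?D j] by (metis (no_types, lifting) sum.cong)
  have "(\<Sum>i<l. of_int (?c i) * w i) = (\<Sum>i<l. (if i = 0 then 1 else 0) + (if i = a + k + 2 then 1 else 0))"
    using k by (intro sum.cong) (auto simp: w_def)
  also have "\<dots> = 2"
    by (simp add: sum.distrib l_def)
  finally have norm: "(\<Sum>i<l. of_int (?c i) * (\<Sum>m<l. of_int (?c m) * gram ?D i m)) = 2"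
    using w' by simp
  have h: "change_gram l a ?c (gram ?D) i j =
      (if i = a then if j = a then 2 else w j else if j = a then w i else gram ?D i j)" if "i < l" "j < l" for i j
    unfolding change_gram_def using w[of j] w'[of i] norm that by simp
  have r: "?r i < l" if "i < l" for i
    using bij_carter_D_node[of a k] that by (auto simp: bij_betw_def l_def)
  obtain k' where k': "k = Suc k'" "k' \<le> a"
    using k by (cases k) auto
  \<comment> \<open>The nodes are split according to the clauses of \<open>carter_D_node\<close>.
    The last tail is written as \<open>k' + 3 + n\<close> so that no truncated subtraction is left
    when the images under the relabelling are compared.\<close>
  have C: "i = a + k' + 3 \<or> i = k' + 1 \<or> i = k' + 2 \<or> i \<le> k' \<or> (\<exists>n<a. i = k' + 3 + n)" if "i < l" for i
  proof (cases "k' + 3 \<le> i \<and> i < a + k' + 3")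
    case True
    then have "i = k' + 3 + (i - (k' + 3))" "i - (k' + 3) < a"
      by auto
    then show ?thesis by blast
  next
    case False
    then have "i = a + k' + 3 \<or> i = k' + 1 \<or> i = k' + 2 \<or> i \<le> k'"
      using that by (auto simp: l_def k')
    then show ?thesis by blast
  qed
  have rn: "?r (a + k' + 3) = a + k' + 2" "?r (k' + 1) = a + k' + 3" "?r (k' + 2) = a"
    "\<And>m. m \<le> k' \<Longrightarrow> ?r m = m + a + 1" "\<And>n. n < a \<Longrightarrow> ?r (k' + 3 + n) = n"
    by (auto simp: carter_D_node_def k')
  have D: "gram ?D i j = (if i = j then 2
     else if (j = i + 1 \<and> j < a + k' + 3) \<or> (i = j + 1 \<and> i < a + k' + 3)
       \<or> (i = a + k' + 1 \<and> j = a + k' + 3) \<or> (j = a + k' + 1 \<and> i = a + k' + 3) then -1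
     else 0)" for i j
    unfolding gram_branched[OF br(1)] br(2) by (simp add: k' l_def)
  have E: "gram (carter_D l k) i j = (if i = j then 2
     else if (i = k' \<and> j = a + k' + 3) \<or> (i = a + k' + 3 \<and> j = k')
       \<or> (j = i + 1 \<and> j < a + k' + 3) \<or> (i = j + 1 \<and> i < a + k' + 3) then -1
     else if (i = k' + 2 \<and> j = a + k' + 3) \<or> (i = a + k' + 3 \<and> j = k' + 2) then 1
     else 0)" for i j
    unfolding gram_carter_D by (simp add: k' l_def)
  have W: "w j = (if j = 0 then -1 else if j = a + k' + 2 then 1 else if j = a + k' + 3 then -1 else 0)" for j
    by (simp add: w_def k')
  have "gram (carter_D l k) i j = change_gram l a ?c (gram ?D) (?r i) (?r j)" if "i < l" "j < l" for i j
    unfolding h[OF r[OF that(1)] r[OF that(2)]] E D W using C[OF that(1)] C[OF that(2)]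
    by (elim disjE conjE exE; hypsubst?; simp only: rn) (use k'(2) in simp_all)
  then show ?thesis
    using bij_carter_D_node[of a k] h[of a a] by (simp add: diagram_step_def carter_D_def[of "a + k + 3" k] l_def del: dynkin_diagram.simps)
qed

section \<open>Homogeneous classes\<close>

definition class_step :: "dynkin \<Rightarrow> diagram \<Rightarrow> diagram \<Rightarrow> bool" where
  "class_step X G G' \<longleftrightarrow> G \<in> homogeneous_class X \<and> G' \<in> homogeneous_class X \<and> (\<exists>a c r. diagram_step a c r G G')"

lemma homogeneous_class_branched:
  assumes "G \<in> homogeneous_class X"
  shows "branched X" "dynkin_diagram X \<in> homogeneous_class X" "num_nodes G = node_count X"
  using assms
  by (cases X; auto simp: homogeneous_class_def branched_def carter_D_def E6_a1_def E6_a2_def E7_a1_def E7_a2_def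
      E7_a3_def E7_a4_def E8_a1_def E8_a2_def E8_a3_def E8_a4_def E8_a5_def E8_a6_def E8_a7_def E8_a8_def
      simp del: dynkin_diagram.simps split: if_splits)+

lemma homogeneous_class_connected:
  assumes "G \<in> homogeneous_class X"
  shows "(class_step X)\<^sup>*\<^sup>* (dynkin_diagram X) G"
proof -
  note X = homogeneous_class_branched(2)[OF assms]
  have step: "(class_step X)\<^sup>*\<^sup>* (dynkin_diagram X) G'"
    if "(class_step X)\<^sup>*\<^sup>* (dynkin_diagram X) G" "diagram_step a c r G G'" "G \<in> homogeneous_class X" "G' \<in> homogeneous_class X"
    for a c r G G'
    using that by (meson class_step_def rtranclp.rtrancl_into_rtrancl)
  note step0 = step[OF rtranclp.rtrancl_refl _ X]
  show ?thesis
  proof (cases X)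
    case (DynA l)
    then show ?thesis using assms by (simp add: homogeneous_class_def)
  next
    case (DynD l)
    then consider "G = dynkin_diagram X" | k where "G = carter_D l k" "1 \<le> k" "k \<le> (l - 2) div 2" "4 \<le> l"
      using assms by (auto simp: homogeneous_class_def simp del: dynkin_diagram.simps split: if_splits)
    then show ?thesis
    proof cases
      case 2
      \<comment> \<open>With this \<open>a\<close> the bound \<open>k \<le> (l - 2) div 2\<close>
        becomes \<open>k \<le> a + 1\<close>.\<close>
      define a where "a = l - k - 3"
      have a: "k \<le> a + 1" "l = a + k + 3"
        using 2 by (auto simp: a_def)
      show ?thesis
        using step0[of _ _ _ G] step_carter_D[OF 2(2) a(1)] assms 2(1) a(2) DynD by blast
    qed simp
  next
    case (DynE l)
    have mem: "E6_a1 \<in> homogeneous_class (DynE 6)" "E6_a2 \<in> homogeneous_class (DynE 6)"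
      "E7_a1 \<in> homogeneous_class (DynE 7)" "E7_a2 \<in> homogeneous_class (DynE 7)"
      "E7_a3 \<in> homogeneous_class (DynE 7)" "E7_a4 \<in> homogeneous_class (DynE 7)"
      "E8_a1 \<in> homogeneous_class (DynE 8)" "E8_a2 \<in> homogeneous_class (DynE 8)"
      "E8_a3 \<in> homogeneous_class (DynE 8)" "E8_a4 \<in> homogeneous_class (DynE 8)"
      "E8_a5 \<in> homogeneous_class (DynE 8)" "E8_a6 \<in> homogeneous_class (DynE 8)"
      "E8_a7 \<in> homogeneous_class (DynE 8)" "E8_a8 \<in> homogeneous_class (DynE 8)"
      by (simp_all add: homogeneous_class_def del: dynkin_diagram.simps)
    consider "G = dynkin_diagram X"
      | "l = 6" "G \<in> {E6_a1, E6_a2}"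
      | "l = 7" "G \<in> {E7_a1, E7_a2, E7_a3}" | "l = 7" "G = E7_a4"
      | "l = 8" "G \<in> {E8_a1, E8_a2, E8_a3, E8_a4, E8_a5}" | "l = 8" "G \<in> {E8_a6, E8_a7}" | "l = 8" "G = E8_a8"
      using assms DynE by (auto simp: homogeneous_class_def simp del: dynkin_diagram.simps split: if_splits)
    then show ?thesis
    proof cases
      case 2
      then show ?thesis using step0 step_E6_E6_a1 step_E6_E6_a2 assms DynE by blast
    next
      case 3
      then show ?thesis using step0 step_E7_E7_a1 step_E7_E7_a2 step_E7_E7_a3 assms DynE by blast
    next
      case 4
      then have "(class_step X)\<^sup>*\<^sup>* (dynkin_diagram X) E7_a2"
        using step0 step_E7_E7_a2 mem DynE by blast
      then show ?thesis using step step_E7_a2_E7_a4 mem DynE 4 by blast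
    next
      case 5
      then show ?thesis
        using step0 step_E8_E8_a1 step_E8_E8_a2 step_E8_E8_a3 step_E8_E8_a4 step_E8_E8_a5 assms DynE by blast
    next
      case 6
      then have "(class_step X)\<^sup>*\<^sup>* (dynkin_diagram X) E8_a4"
        using step0 step_E8_E8_a4 mem DynE by blast
      then show ?thesis using step step_E8_a4_E8_a6 step_E8_a4_E8_a7 mem DynE 6 by blast
    next
      case 7
      then have "(class_step X)\<^sup>*\<^sup>* (dynkin_diagram X) E8_a4"
        using step0 step_E8_E8_a4 mem DynE by blast
      then have "(class_step X)\<^sup>*\<^sup>* (dynkin_diagram X) E8_a7"
        using step step_E8_a4_E8_a7 mem DynE 7 by blast
      then show ?thesis using step step_E8_a7_E8_a8 mem DynE 7 by blast
    qed simp
  qed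
qed

text \<open>Classes of equal rank are told apart by edges of labelled nodes. An E diagram having all
  three of these chain edges is the Dynkin diagram, which has no dotted edges and contains
  \<open>{2, l - 1}\<close>; a D diagram without dotted edges lacks that edge.\<close>

lemma homogeneous_class_DynD_edges:
  assumes "G \<in> homogeneous_class (DynD l)" "6 \<le> l"
  shows "{0, 1} \<in> solid G" "{2, 3} \<in> solid G" "{3, 4} \<in> solid G" "dotted G = {} \<Longrightarrow> {2, l - 1} \<notin> solid G"
proof -
  have c: "i + 1 < l - 1 \<Longrightarrow> {i, i + 1} \<in> solid G" for i
    using assms by (auto simp: homogeneous_class_def carter_D_def split: if_splits)
  show "{0, 1} \<in> solid G" "{2, 3} \<in> solid G" "{3, 4} \<in> solid G"
    using c[of 0] c[of 2] c[of 3] assms(2) by simp_all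
  assume "dotted G = {}"
  then have "G = dynkin_diagram (DynD l)"
    using assms by (auto simp: homogeneous_class_def carter_D_def split: if_splits)
  then show "{2, l - 1} \<notin> solid G"
    using assms(2) by (auto simp: doubleton_eq_iff)
qed

lemma homogeneous_class_DynE_edges:
  assumes "G \<in> homogeneous_class (DynE l)"
  shows "{0, 1} \<notin> solid G \<or> {2, 3} \<notin> solid G \<or> {3, 4} \<notin> solid G \<or> (dotted G = {} \<and> {2, l - 1} \<in> solid G)"
  using assms
  by (auto simp: homogeneous_class_def E6_a1_def E6_a2_def E7_a1_def E7_a2_def
      E7_a3_def E7_a4_def E8_a1_def E8_a2_def E8_a3_def E8_a4_def E8_a5_def E8_a6_def E8_a7_def E8_a8_def
      doubleton_eq_iff split: if_splits)

text \<open>The type of the class is quantified existentially in \<open>vertex_extension\<close>;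
  uniqueness allows it to be replaced by the given \<open>X\<close>.\<close>

lemma homogeneous_class_unique:
  assumes "G \<in> homogeneous_class X" "G \<in> homogeneous_class Y"
  shows "X = Y"
proof -
  have n: "node_count X = node_count Y"
    using homogeneous_class_branched(3) assms by metis
  have DE: "\<not> (G \<in> homogeneous_class (DynD l) \<and> G \<in> homogeneous_class (DynE l))" for l
    using homogeneous_class_DynD_edges[of G l] homogeneous_class_DynE_edges[of G l]
      homogeneous_class_branched(1)[of G "DynE l"] by (fastforce simp: branched_def)
  show ?thesis
    using n DE assms homogeneous_class_branched(1)[OF assms(1)] homogeneous_class_branched(1)[OF assms(2)]
    by (cases X; cases Y; auto simp: branched_def)
qed

section \<open>Transfer of linkage labels along a homogeneous class\<close>

text \<open>The value 0 beyond the nodes makes a label vector a function determined by its entries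
  at the nodes, so label vectors can be compared as functions.\<close>

definition labels :: "dynkin \<Rightarrow> nat \<Rightarrow> (nat \<Rightarrow> rvec) \<Rightarrow> rvec \<Rightarrow> nat \<Rightarrow> real" where
  "labels T l t x i = (if i < l then root_form T x (t i) else 0)"

definition label_space :: "nat \<Rightarrow> (nat \<Rightarrow> real) set" where
  "label_space l = {p. \<forall>i\<ge>l. p i = 0}"

lemma labels_in_label_space: "labels T l t x \<in> label_space l"
  by (simp add: labels_def label_space_def)

definition change_labels :: "nat \<Rightarrow> nat \<Rightarrow> (nat \<Rightarrow> int) \<Rightarrow> (nat \<Rightarrow> nat) \<Rightarrow> (nat \<Rightarrow> real) \<Rightarrow> nat \<Rightarrow> real" where
  "change_labels l a c r p i =
     (if i < l then if r i = a then \<Sum>k<l. of_int (c k) * p k else p (r i) else 0)"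

text \<open>All labels but one are copied, and the one at \<open>a\<close> can be recovered from the
  sum because its coefficient is -1.\<close>

lemma inj_on_change_labels:
  assumes "a < l" "c a = -1" "bij_betw r {..<l} {..<l}"
  shows "inj_on (change_labels l a c r) (label_space l)"
proof (rule inj_onI)
  fix p q assume p: "p \<in> label_space l" and q: "q \<in> label_space l"
    and e: "change_labels l a c r p = change_labels l a c r q"
  have surj: "\<exists>i<l. r i = k" if "k < l" for k
    using assms(3) that by (metis bij_betw_imp_surj_on imageE lessThan_iff)
  have ne: "p k = q k" if k: "k < l" "k \<noteq> a" for k
  proof -
    obtain i where "i < l" "r i = k"
      using surj[OF k(1)] by blast
    then show ?thesis
      using fun_cong[OF e, of i] k by (simp add: change_labels_def)
  qed
  obtain i where i: "i < l" "r i = a"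
    using surj assms(1) by blast
  have "(\<Sum>k<l. of_int (c k) * p k) = (\<Sum>k<l. of_int (c k) * q k)"
    using fun_cong[OF e, of i] i by (simp add: change_labels_def)
  then have "p a = q a"
    unfolding sum_lessThan_remove[OF assms(1), of "\<lambda>k. of_int (c k) * p k"]
      sum_lessThan_remove[OF assms(1), of "\<lambda>k. of_int (c k) * q k"]
    using ne by (simp add: assms(2))
  moreover have "p k = q k" if "\<not> k < l" for k
    using p q that by (simp add: label_space_def)
  ultimately show "p = q"
    using ne by (intro ext) blast
qed

text \<open>Both directions are used. From an \<open>X\<close>-set transitions lead to a
  \<open>G\<close>-set, which provides the vertex extensions. Conversely every \<open>G\<close>-set
  comes from an \<open>X\<close>-set with the same span, and here \<open>\<phi>\<close> is chosen
  before \<open>T\<close>, so that one injection carries the labels of all extensions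
  simultaneously.\<close>

lemma homogeneous_class_transfer:
  assumes "G \<in> homogeneous_class X"
  defines "l \<equiv> node_count X"
  shows "(\<forall>T t. is_dynkin T \<longrightarrow> labelled_gamma_set T (dynkin_diagram X) t \<longrightarrow>
      (\<exists>t'. labelled_gamma_set T G t' \<and> (transition T X)\<^sup>*\<^sup>* (t ` {..<l}) (t' ` {..<l}) \<and>
            span (t' ` {..<l}) = span (t ` {..<l})))
    \<and> (\<exists>\<phi>. inj_on \<phi> (label_space l) \<and> \<phi> ` label_space l \<subseteq> label_space l \<and>
      (\<forall>T t'. is_dynkin T \<longrightarrow> labelled_gamma_set T G t' \<longrightarrow>
        (\<exists>t. labelled_gamma_set T (dynkin_diagram X) t \<and> span (t' ` {..<l}) = span (t ` {..<l}) \<and>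
             (\<forall>x. labels T l t' x = \<phi> (labels T l t x)))))"
  using homogeneous_class_connected[OF assms(1)]
proof (induction rule: rtranclp_induct)
  case base
  show ?case
    by (intro conjI exI[of _ id]) (auto intro: rtranclp.rtrancl_refl)
next
  case (step G G')
  then obtain a c r where st: "diagram_step a c r G G'" and cl: "G \<in> homogeneous_class X" "G' \<in> homogeneous_class X"
    by (auto simp: class_step_def)
  have n: "num_nodes G = l" "num_nodes G' = l"
    using cl homogeneous_class_branched(3) by (auto simp: l_def)
  have a: "a < l" "c a = -1" and r: "bij_betw r {..<l} {..<l}"
    using st n by (auto simp: diagram_step_def)
  show ?case
  proof (intro conjI allI impI)
    fix T t assume T: "is_dynkin T" and t: "labelled_gamma_set T (dynkin_diagram X) t"
    obtain t' where t': "labelled_gamma_set T G t'" "(transition T X)\<^sup>*\<^sup>* (t ` {..<l}) (t' ` {..<l})"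
      "span (t' ` {..<l}) = span (t ` {..<l})"
      using step.IH[THEN conjunct1, rule_format, OF T t] by blast
    define u where "u = change_at l a c t' \<circ> r"
    note f = diagram_step_forward[OF T st t'(1), unfolded n, folded u_def]
    have "transition T X (t' ` {..<l}) (u ` {..<l})"
      unfolding transition_def gamma_set_def
      by (intro conjI bexI[of _ G] bexI[of _ G'] exI[of _ t'] exI[of _ u]) (use cl t'(1) f(1,2) n in auto)
    then show "\<exists>t'. labelled_gamma_set T G' t' \<and> (transition T X)\<^sup>*\<^sup>* (t ` {..<l}) (t' ` {..<l}) \<and>
        span (t' ` {..<l}) = span (t ` {..<l})"
      using f t'(2,3) by (metis rtranclp.rtrancl_into_rtrancl)
  next
    obtain \<phi> where \<phi>: "inj_on \<phi> (label_space l)" "\<phi> ` label_space l \<subseteq> label_space l"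
      "\<And>T t'. is_dynkin T \<Longrightarrow> labelled_gamma_set T G t' \<Longrightarrow>
        \<exists>t. labelled_gamma_set T (dynkin_diagram X) t \<and> span (t' ` {..<l}) = span (t ` {..<l}) \<and>
             (\<forall>x. labels T l t' x = \<phi> (labels T l t x))"
      using step.IH[THEN conjunct2] by (elim exE conjE) metis
    let ?\<psi> = "change_labels l a c r \<circ> \<phi>"
    have "inj_on (change_labels l a c r) (label_space l)"
      using a r by (rule inj_on_change_labels)
    then have "inj_on ?\<psi> (label_space l)"
      using \<phi>(1,2) by (metis comp_inj_on inj_on_subset)
    moreover have "?\<psi> ` label_space l \<subseteq> label_space l"
      by (auto simp: change_labels_def label_space_def)
    moreover have "\<exists>t. labelled_gamma_set T (dynkin_diagram X) t \<and> span (u ` {..<l}) = span (t ` {..<l}) \<and>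
        (\<forall>x. labels T l u x = ?\<psi> (labels T l t x))" if T: "is_dynkin T" and u: "labelled_gamma_set T G' u" for T u
    proof -
      define t' where "t' = change_at l a c (u \<circ> inv_into {..<l} r)"
      note b = diagram_step_backward[OF T st u, unfolded n, folded t'_def]
      obtain t where t: "labelled_gamma_set T (dynkin_diagram X) t" "span (t' ` {..<l}) = span (t ` {..<l})"
        "\<And>x. labels T l t' x = \<phi> (labels T l t x)"
        using \<phi>(3)[OF T b(1)] by blast
      have "labels T l u x = change_labels l a c r (labels T l t' x)" for x
      proof
        fix i
        have "r i < l" if "i < l"
          using r that by (auto simp: bij_betw_def)
        then show "labels T l u x i = change_labels l a c r (labels T l t' x) i"
          using b(3)[of i] by (auto simp: labels_def change_labels_def change_at_def root_form_linear)
      qed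
      then show ?thesis
        using t b(2) by auto
    qed
    ultimately show "\<exists>\<phi>. inj_on \<phi> (label_space l) \<and> \<phi> ` label_space l \<subseteq> label_space l \<and>
      (\<forall>T t'. is_dynkin T \<longrightarrow> labelled_gamma_set T G' t' \<longrightarrow>
        (\<exists>t. labelled_gamma_set T (dynkin_diagram X) t \<and> span (t' ` {..<l}) = span (t ` {..<l}) \<and>
             (\<forall>x. labels T l t' x = \<phi> (labels T l t x))))"
      by (intro exI[of _ ?\<psi>]) blast
  qed
qed

text \<open>The right-hand side no longer depends on \<open>G\<close>: the chain of transitions and
  the equality of spans come for free from any \<open>X\<close>-set. Hence all members of a class
  have the same extensions.\<close>

lemma vertex_extension_iff:
  assumes "G \<in> homogeneous_class X"
  shows "vertex_extension G T \<longleftrightarrow> is_dynkin T \<and> node_count T = node_count X + 1 \<and>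
     (\<exists>t. labelled_gamma_set T (dynkin_diagram X) t)"
proof
  assume "vertex_extension G T"
  then obtain Y S where Y: "is_dynkin T" "G \<in> homogeneous_class Y" "root_rank T = root_rank Y + 1"
    "gamma_set T (dynkin_diagram Y) S"
    unfolding vertex_extension_def by blast
  then have "Y = X"
    using homogeneous_class_unique assms by blast
  then show "is_dynkin T \<and> node_count T = node_count X + 1 \<and> (\<exists>t. labelled_gamma_set T (dynkin_diagram X) t)"
    using Y by (auto simp: root_rank_eq gamma_set_def)
next
  assume r: "is_dynkin T \<and> node_count T = node_count X + 1 \<and> (\<exists>t. labelled_gamma_set T (dynkin_diagram X) t)"
  then obtain t where t: "labelled_gamma_set T (dynkin_diagram X) t"
    by blast
  let ?l = "node_count X"
  obtain t' where t': "labelled_gamma_set T G t'" "(transition T X)\<^sup>*\<^sup>* (t ` {..<?l}) (t' ` {..<?l})"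
      "span (t' ` {..<?l}) = span (t ` {..<?l})"
    using homogeneous_class_transfer[OF assms, THEN conjunct1, rule_format, OF _ t] r by blast
  have "gamma_set T (dynkin_diagram X) (t ` {..<?l})" "gamma_set T G (t' ` {..<?l})"
    unfolding gamma_set_def using t t'(1) homogeneous_class_branched(3)[OF assms] by auto
  then show "vertex_extension G T"
    unfolding vertex_extension_def root_rank_eq using r assms t' by blast
qed

section \<open>Linkage labels of the roots outside a subsystem of corank one\<close>

text \<open>Connectedness of the diagram as a propagation rule. It will show that the roots outside
  the span of an \<open>X\<close>-set cannot all be orthogonal to that span.\<close>

lemma dynkin_connected:
  assumes "is_dynkin T" "k < node_count T" "Q k" "j < node_count T"
    and Q: "\<And>i j. i < node_count T \<Longrightarrow> j < node_count T \<Longrightarrow> gram (dynkin_diagram T) i j \<noteq> 0 \<Longrightarrow> Q i \<Longrightarrow> Q j"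
  shows "Q j"
proof -
  let ?n = "node_count T"
  have Q': "Q i \<longleftrightarrow> Q j" if "i < ?n" "j < ?n" "gram (dynkin_diagram T) i j \<noteq> 0" for i j
    using Q that by (metis gram_commute)
  have "\<forall>j<?n. Q j \<longleftrightarrow> Q 0"
  proof (cases "branched T")
    case True
    note b = branched_node_count[OF True]
    have chain: "Q i \<longleftrightarrow> Q 0" if "i < ?n - 1" for i
      using that
    proof (induction i)
      case (Suc i)
      have "Q i \<longleftrightarrow> Q (Suc i)"
        by (rule Q') (use Suc.prems in \<open>auto simp: gram_branched[OF True]\<close>)
      moreover have "Q i \<longleftrightarrow> Q 0"
        using Suc.prems by (intro Suc.IH) simp
      ultimately show ?case by blast
    qed simp
    have "Q (branch_node T) \<longleftrightarrow> Q (?n - 1)"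
      by (rule Q') (use b in \<open>auto simp: gram_branched[OF True]\<close>)
    moreover have "branch_node T < ?n - 1"
      using b by linarith
    ultimately have "Q (?n - 1) \<longleftrightarrow> Q 0"
      using chain by blast
    then show ?thesis
      using chain by (metis Suc_diff_1 gr_implies_not0 less_Suc_eq not_gr_zero)
  next
    case False
    then obtain l where A: "T = DynA l"
      using assms(1) by (auto simp: branched_def)
    have "Q i \<longleftrightarrow> Q 0" if "i < l" for i
      using that
    proof (induction i)
      case (Suc i)
      have "{i, Suc i} \<in> {{k, k + 1} | k. k + 1 < l}"
        unfolding consecutive_pair_iff using Suc.prems by simp
      then have "gram (dynkin_diagram T) i (Suc i) = -1"
        by (simp only: A gram_def dynkin_diagram.simps diagram.select_convs n_not_Suc_n if_True if_False)
      then have "gram (dynkin_diagram T) i (Suc i) \<noteq> 0"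
        by linarith
      moreover have "i < ?n" "Suc i < ?n"
        using Suc.prems A by simp_all
      ultimately have "Q i \<longleftrightarrow> Q (Suc i)"
        using Q' by blast
      moreover have "Q i \<longleftrightarrow> Q 0"
        using Suc.prems by (intro Suc.IH) simp
      ultimately show ?case by blast
    qed simp
    then show ?thesis unfolding A node_count.simps by blast
  qed
  then show ?thesis
    using assms(2-4) by blast
qed

section \<open>Weyl group orbits of label vectors\<close>

definition reflect_labels :: "dynkin \<Rightarrow> nat \<Rightarrow> (nat \<Rightarrow> real) \<Rightarrow> nat \<Rightarrow> real" where
  "reflect_labels X i p j = (if j < node_count X then p j - p i * gram (dynkin_diagram X) i j else 0)"

text \<open>The orbit depends on \<open>X\<close> and \<open>p\<close> alone, neither on the ambient
  root system nor on the chosen \<open>X\<close>-set. This is what makes the labels of different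
  selections comparable.\<close>

inductive_set label_orbit :: "dynkin \<Rightarrow> (nat \<Rightarrow> real) \<Rightarrow> (nat \<Rightarrow> real) set" for X p where
  base: "p \<in> label_orbit X p"
| reflect: "q \<in> label_orbit X p \<Longrightarrow> i < node_count X \<Longrightarrow> reflect_labels X i q \<in> label_orbit X p"

lemma label_orbit_trans: "r \<in> label_orbit X q \<Longrightarrow> q \<in> label_orbit X p \<Longrightarrow> r \<in> label_orbit X p"
  by (induction rule: label_orbit.induct) (auto intro: label_orbit.reflect)

lemma label_orbit_space: "q \<in> label_orbit X p \<Longrightarrow> p \<in> label_space (node_count X) \<Longrightarrow> q \<in> label_space (node_count X)"
  by (induction rule: label_orbit.induct) (auto simp: reflect_labels_def label_space_def)

lemma reflect_labels_involution:
  "i < node_count X \<Longrightarrow> p \<in> label_space (node_count X) \<Longrightarrow> reflect_labels X i (reflect_labels X i p) = p"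
  by (auto simp: reflect_labels_def label_space_def fun_eq_iff gram_def)

lemma label_orbit_sym:
  assumes "q \<in> label_orbit X p" "p \<in> label_space (node_count X)"
  shows "p \<in> label_orbit X q"
  using assms
proof (induction rule: label_orbit.induct)
  case (reflect q i)
  have "q \<in> label_orbit X (reflect_labels X i q)"
    using label_orbit.reflect[OF label_orbit.base, of i X "reflect_labels X i q"] reflect
      reflect_labels_involution[of i X q] label_orbit_space by simp
  then show ?case
    using reflect label_orbit_trans by blast
qed (rule label_orbit.base)

text \<open>The vector with labels \<open>p\<close> in the span of the tuple has the coordinates \<open>c\<close> with respect to the
  tuple.\<close>

definition weight_coeffs :: "dynkin \<Rightarrow> (nat \<Rightarrow> real) \<Rightarrow> (nat \<Rightarrow> real) \<Rightarrow> bool" where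
  "weight_coeffs X p c \<longleftrightarrow> p \<in> label_space (node_count X) \<and>
     (\<forall>j<node_count X. (\<Sum>k<node_count X. c k * gram (dynkin_diagram X) k j) = p j)"

text \<open>The inner product of the combination with coefficients \<open>c\<close> and a vector
  with labels \<open>p\<close>. If \<open>c\<close> belongs to a label \<open>q\<close> by
  \<open>weight_coeffs\<close>, it is the inner product of the weights \<open>q\<close> and
  \<open>p\<close>.\<close>

definition pairing :: "dynkin \<Rightarrow> (nat \<Rightarrow> real) \<Rightarrow> (nat \<Rightarrow> real) \<Rightarrow> real" where
  "pairing X c p = (\<Sum>k<node_count X. c k * p k)"

section \<open>Geometry of an \<open>X\<close>-set in a root system of rank one more\<close>

locale corank_one =
  fixes T X :: dynkin and t :: "nat \<Rightarrow> rvec"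
  assumes T: "is_dynkin T" and X: "branched X" and rank: "node_count T = node_count X + 1"
    and labelled: "labelled_gamma_set T (dynkin_diagram X) t"
begin

abbreviation "l \<equiv> node_count X"
abbreviation "g \<equiv> gram (dynkin_diagram X)"
abbreviation "L \<equiv> span (t ` {..<l})"
abbreviation "form \<equiv> root_form T"
abbreviation "lab \<equiv> labels T l t"

definition outer :: "rvec set" where
  "outer = {x \<in> root_system T. x \<notin> L}"

definition comb :: "(nat \<Rightarrow> real) \<Rightarrow> rvec" where
  "comb c = (\<Sum>i<l. c i *\<^sub>R t i)"

lemma tuple: "root_tuple T l g t"
  using labelled by (simp add: labelled_gamma_set_iff)

lemma t_root: "i < l \<Longrightarrow> t i \<in> root_system T"
  and form_t: "i < l \<Longrightarrow> j < l \<Longrightarrow> form (t i) (t j) = g i j"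
  using tuple by (auto simp: root_tuple_def)

lemma L_eq: "L = range comb"
  unfolding comb_def by (rule span_family) simp

lemma comb_in_L: "comb c \<in> L"
  by (simp add: L_eq)

lemma L_supported: "x \<in> L \<Longrightarrow> supported T x"
  using span_mono[of "t ` {..<l}" "root_system T"] t_root span_root_system[of T] by auto

lemma form_comb_right: "form x (comb c) = pairing X c (lab x)"
  by (simp add: comb_def pairing_def labels_def root_form_linear)

lemma form_comb_t: "j < l \<Longrightarrow> form (comb c) (t j) = (\<Sum>k<l. c k * g k j)"
  by (simp add: comb_def root_form_linear form_t)

lemma form_comb_comb: "weight_coeffs X p c \<Longrightarrow> form (comb c) (comb d) = pairing X d p"
  unfolding form_comb_right by (simp add: pairing_def labels_def weight_coeffs_def form_comb_t)

lemma orth_L: "(\<And>j. j < l \<Longrightarrow> form x (t j) = 0) \<Longrightarrow> y \<in> L \<Longrightarrow> form x y = 0"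
  by (auto simp: L_eq comb_def root_form_linear)

lemma dim_supported: "dim (Collect (supported T)) = l + 1"
  using root_rank_eq[of T] rank by (metis dim_span root_rank_def span_root_system)

lemma ex_outer: "\<exists>x. x \<in> outer"
proof (rule ccontr)
  assume "\<not> ?thesis"
  then have "root_system T \<subseteq> L"
    by (auto simp: outer_def)
  then have "span (root_system T) \<subseteq> L"
    by (simp add: span_minimal)
  then have "Collect (supported T) \<subseteq> span (t ` {..<l})"
    by (simp add: span_root_system)
  from dim_le_card[OF this] have "l + 1 \<le> card (t ` {..<l})"
    by (simp add: dim_supported)
  also have "\<dots> \<le> l"
    using card_image_le[of "{..<l}" t] by simp
  finally show False by simp
qed

lemma outerD: "x \<in> outer \<Longrightarrow> x \<in> root_system T" "x \<in> outer \<Longrightarrow> x \<notin> L"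
  "x \<in> outer \<Longrightarrow> supported T x" "x \<in> outer \<Longrightarrow> form x x = 2" "x \<in> outer \<Longrightarrow> x \<in> root_lattice T"
  by (auto simp: outer_def root_supported root_norm root_in_lattice)

lemma lab_in_space [simp]: "lab x \<in> label_space l"
  by (rule labels_in_label_space)

lemma lab_Ints: "x \<in> root_lattice T \<Longrightarrow> lab x i \<in> \<int>"
  using t_root by (auto simp: labels_def intro!: root_form_Ints root_in_lattice)

text \<open>The vector \<open>comb c\<close> has the same labels as \<open>x\<close>, so it is the
  orthogonal projection of \<open>x\<close> to \<open>L\<close>; the last equation is the theorem of
  Pythagoras.\<close>

lemma orthogonal_part:
  assumes "weight_coeffs X (lab x) c"
  shows "j < l \<Longrightarrow> form (x - comb c) (t j) = 0"
    and "y \<in> L \<Longrightarrow> form (x - comb c) y = 0"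
    and "form (x - comb c) (x - comb c) = form x x - pairing X c (lab x)"
proof -
  show *: "form (x - comb c) (t j) = 0" if "j < l" for j
    using that assms by (simp add: root_form_linear form_comb_t weight_coeffs_def labels_def)
  show **: "form (x - comb c) y = 0" if "y \<in> L" for y
    using * that by (rule orth_L)
  have "form (x - comb c) (x - comb c) = form (x - comb c) x"
    using **[OF comb_in_L] by (simp add: root_form_linear)
  also have "\<dots> = form x x - pairing X c (lab x)"
    by (simp add: root_form_linear root_form_commute[of T "comb c" x] form_comb_right)
  finally show "form (x - comb c) (x - comb c) = form x x - pairing X c (lab x)" .
qed

text \<open>The pairing is the squared length of the projection of \<open>x\<close> to
  \<open>L\<close>, which is strictly below 2 because \<open>x\<close> lies outside
  \<open>L\<close>.\<close>

lemma pairing_less_2: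
  assumes "x \<in> outer" "weight_coeffs X (lab x) c"
  shows "pairing X c (lab x) < 2"
proof -
  have "x - comb c \<noteq> 0"
    using assms(1) comb_in_L[of c] by (auto simp: outer_def)
  moreover have "supported T (x - comb c)"
    using outerD(3)[OF assms(1)] L_supported[OF comb_in_L[of c]]
    by (simp add: supported_def lookup_minus)
  ultimately have "0 < form (x - comb c) (x - comb c)"
    using T by (intro supported_pos)
  then show ?thesis
    using orthogonal_part(3)[OF assms(2)] outerD(4)[OF assms(1)] by simp
qed

text \<open>The orthogonal complement of \<open>L\<close> in the span of the root system is a line, so the
  Cauchy-Schwarz inequality is an equality there.\<close>

lemma orthogonal_parts_collinear:
  assumes "supported T u" "supported T v" "\<And>j. j < l \<Longrightarrow> form u (t j) = 0" "\<And>j. j < l \<Longrightarrow> form v (t j) = 0"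
  shows "(form u v)\<^sup>2 = form u u * form v v"
proof (cases "u = 0")
  case True
  then show ?thesis by (simp add: root_form_linear)
next
  case False
  have uL: "u \<notin> L"
    using orth_L[OF assms(3), of u] supported_pos[OF T assms(1) False] by auto
  let ?B = "insert u (t ` {..<l})"
  have "independent ?B"
    using root_tuple_inj(2)[OF tuple] uL by (rule independent_insertI[rotated])
  have "card ?B = l + 1"
    using root_tuple_inj(1)[OF tuple] uL span_base[of u "t ` {..<l}"] by (subst card_insert_disjoint) (auto simp: card_image)
  have "?B \<subseteq> Collect (supported T)"
    using assms(1) t_root root_supported by auto
  \<comment> \<open>A combination of \<open>u\<close> and \<open>v\<close> orthogonal to
    \<open>u\<close> and to \<open>L\<close>. By dimension it lies in the span of \<open>u\<close>
    and \<open>L\<close>, hence it is orthogonal to itself and vanishes; pairing with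
    \<open>v\<close> then gives the claimed equality.\<close>
  define z where "z = form u u *\<^sub>R v - form u v *\<^sub>R u"
  have z_supp: "supported T z"
    using assms(1,2) by (simp add: z_def supported_def lookup_minus)
  have "z \<in> span ?B"
  proof (rule ccontr)
    assume z: "z \<notin> span ?B"
    have "independent (insert z ?B)"
      using z \<open>independent ?B\<close> by (rule independent_insertI)
    moreover have "insert z ?B \<subseteq> span (simple_root ` {..<node_count T})"
      using z_supp \<open>?B \<subseteq> Collect (supported T)\<close> by (simp add: span_simple_roots)
    ultimately have "card (insert z ?B) \<le> card (simple_root ` {..<node_count T})"
      using independent_span_bound[of "simple_root ` {..<node_count T}" "insert z ?B"] by simp
    also have "\<dots> \<le> l + 1"
      using card_image_le[of "{..<node_count T}" simple_root] rank by simp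
    finally show False
      using z \<open>card ?B = l + 1\<close> span_base[of z ?B] by (subst (asm) card_insert_disjoint) auto
  qed
  then obtain k where k: "z - k *\<^sub>R u \<in> L"
    by (auto simp: span_insert)
  have zu: "form z u = 0"
    by (simp add: z_def root_form_linear root_form_commute[of T v u])
  have "form z (z - k *\<^sub>R u) = 0"
    by (rule orth_L[OF _ k]) (simp add: z_def root_form_linear assms)
  then have "form z z = 0"
    using zu by (simp add: root_form_linear)
  then have "z = 0"
    using supported_pos[OF T z_supp] by fastforce
  then have "form z v = 0"
    by (simp add: root_form_linear)
  then show ?thesis
    by (simp add: z_def root_form_linear power2_eq_square)
qed

lemma outer_square:
  assumes "x \<in> outer" "y \<in> outer" "weight_coeffs X (lab x) c" "weight_coeffs X (lab y) d"
  shows "(form x y - pairing X c (lab y))\<^sup>2 = (2 - pairing X c (lab x)) * (2 - pairing X d (lab y))"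
proof -
  let ?u = "x - comb c" and ?v = "y - comb d"
  have "form ?u ?v = form ?u y"
    using orthogonal_part(2)[OF assms(3) comb_in_L] by (simp add: root_form_linear)
  also have "\<dots> = form x y - pairing X c (lab y)"
    by (simp add: root_form_linear root_form_commute[of T "comb c" y] form_comb_right)
  finally have uv: "form ?u ?v = form x y - pairing X c (lab y)" .
  have "supported T ?u" "supported T ?v"
    using assms(1,2)[THEN outerD(3)] L_supported[OF comb_in_L] by (simp_all add: supported_def lookup_minus)
  then have "(form ?u ?v)\<^sup>2 = form ?u ?u * form ?v ?v"
    using orthogonal_part(1)[OF assms(3)] orthogonal_part(1)[OF assms(4)] by (rule orthogonal_parts_collinear)
  then show ?thesis
    using uv orthogonal_part(3)[OF assms(3)] orthogonal_part(3)[OF assms(4)] assms(1,2)[THEN outerD(4)] by simp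
qed

text \<open>A root with prescribed labels \<open>q\<close> is built as \<open>m\<close> times the
  orthogonal part of \<open>x\<close> plus the vector of \<open>L\<close> with labels
  \<open>q\<close>. The hypothesis \<open>int\<close> places it in the lattice, \<open>norm\<close>
  makes it a root, and \<open>m \<noteq> 0\<close> keeps it outside \<open>L\<close>.\<close>

lemma outer_shift:
  assumes "x \<in> outer" "weight_coeffs X (lab x) c" "weight_coeffs X q d" "m \<noteq> (0::int)"
    and int: "\<And>j. j < l \<Longrightarrow> d j - of_int m * c j \<in> \<int>"
    and norm: "(of_int m)\<^sup>2 * (2 - pairing X c (lab x)) + pairing X d q = 2"
  shows "\<exists>y\<in>outer. lab y = q"
proof
  define y where "y = of_int m *\<^sub>R x + comb (\<lambda>j. d j - of_int m * c j)"
  let ?u = "x - comb c"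
  have y: "y = of_int m *\<^sub>R ?u + comb d"
    by (simp add: y_def comb_def algebra_simps sum_subtractf scaleR_sum_right)
  have ud: "form ?u (comb d) = 0"
    using assms(2) comb_in_L by (rule orthogonal_part(2))
  have norm_sum: "form (r *\<^sub>R u + w) (r *\<^sub>R u + w) = r\<^sup>2 * form u u + form w w" if "form u w = 0" for r u w
    using that root_form_commute[of T w u] by (simp add: root_form_linear power2_eq_square)
  have "form y y = (of_int m)\<^sup>2 * form ?u ?u + form (comb d) (comb d)"
    unfolding y by (rule norm_sum[OF ud])
  also have "\<dots> = 2"
    using norm by (simp add: orthogonal_part(3)[OF assms(2)] outerD(4)[OF assms(1)] form_comb_comb[OF assms(3)])
  finally have "form y y = 2" .
  moreover have "y \<in> root_lattice T"
    unfolding y_def comb_def using root_in_lattice[OF t_root] int outerD(5)[OF assms(1)]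
    by (intro root_lattice_add root_lattice_scaleR root_lattice_sum) auto
  ultimately have "y \<in> root_system T"
    by (simp add: root_system_iff T)
  moreover have "y \<notin> L"
  proof
    assume "y \<in> L"
    then have "(1 / of_int m) *\<^sub>R (y - comb (\<lambda>j. d j - of_int m * c j)) \<in> L"
      using comb_in_L by (intro span_scale span_diff)
    then show False
      using assms(1,4) by (simp add: y_def outer_def)
  qed
  ultimately show "y \<in> outer"
    by (simp add: outer_def)
  show "lab y = q"
  proof
    fix j
    show "lab y j = q j"
    proof (cases "j < l")
      case True
      then show ?thesis
        using assms(3) orthogonal_part(1)[OF assms(2) True]
        by (simp add: y labels_def root_form_linear(1,6) form_comb_t weight_coeffs_def)
    next
      case False
      then show ?thesis
        using assms(3) by (simp add: labels_def weight_coeffs_def label_space_def)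
    qed
  qed
qed

lemma lab_reflect:
  assumes "i < l"
  shows "lab (x - form x (t i) *\<^sub>R t i) = reflect_labels X i (lab x)"
  using assms by (auto simp: labels_def reflect_labels_def root_form_linear form_t)

lemma outer_reflect:
  assumes "x \<in> outer" "i < l"
  shows "x - form x (t i) *\<^sub>R t i \<in> outer"
proof -
  have ti: "t i \<in> root_system T"
    using assms(2) by (rule t_root)
  have "x - form x (t i) *\<^sub>R t i \<in> root_lattice T"
    using outerD(5)[OF assms(1)] root_in_lattice[OF ti]
    by (intro root_lattice_diff root_lattice_scaleR root_form_Ints)
  moreover have "form (x - form x (t i) *\<^sub>R t i) (x - form x (t i) *\<^sub>R t i) = 2"
    using root_form_reflect[OF root_norm[OF ti], of x x] outerD(4)[OF assms(1)] by simp
  moreover have "x - form x (t i) *\<^sub>R t i \<notin> L"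
  proof
    assume "x - form x (t i) *\<^sub>R t i \<in> L"
    moreover have "form x (t i) *\<^sub>R t i \<in> L"
      using assms(2) by (intro span_scale span_base) simp
    ultimately have "x - form x (t i) *\<^sub>R t i + form x (t i) *\<^sub>R t i \<in> L"
      by (rule span_add)
    then show False
      using assms(1) by (simp add: outer_def)
  qed
  ultimately show ?thesis
    by (simp add: outer_def root_system_iff T)
qed

definition dominant_labels :: "(nat \<Rightarrow> real) set" where
  "dominant_labels = {p \<in> lab ` outer. \<forall>i<l. 0 \<le> p i}"

text \<open>Maximise over the orbit a linear functional that is positive on all \<open>t i\<close>.\<close>

lemma ex_dominant:
  assumes "x \<in> outer"
  shows "\<exists>d\<in>dominant_labels. d \<in> label_orbit X (lab x)"
proof -
  obtain f :: "rvec \<Rightarrow> real" where f: "linear f" "\<forall>v\<in>t ` {..<l}. f v = 1"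
    using linear_independent_extend[OF root_tuple_inj(2)[OF tuple], of "\<lambda>_. 1"] by auto
  define A where "A = {y \<in> outer. lab y \<in> label_orbit X (lab x)}"
  have "finite A"
    by (rule finite_subset[OF _ finite_root_system[OF T]]) (auto simp: A_def outer_def)
  moreover have "x \<in> A"
    using assms by (simp add: A_def label_orbit.base)
  ultimately have "Max (f ` A) \<in> f ` A"
    by (intro Max_in) auto
  then obtain y where "y \<in> A" "f y = Max (f ` A)"
    by (metis imageE)
  then have y: "y \<in> A" "\<And>z. z \<in> A \<Longrightarrow> f z \<le> f y"
    using \<open>finite A\<close> by simp_all
  have "0 \<le> lab y i" if "i < l" for i
  proof -
    let ?z = "y - form y (t i) *\<^sub>R t i"
    have "?z \<in> A"
      using y(1) that outer_reflect lab_reflect label_orbit.reflect by (simp add: A_def)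
    then have "f ?z \<le> f y"
      by (rule y(2))
    then show ?thesis
      using f that by (simp add: linear_diff linear_cmul labels_def)
  qed
  then show ?thesis
    using y(1) by (auto simp: A_def dominant_labels_def)
qed

lemma labels_outer_eq: "lab ` outer = (\<Union>d\<in>dominant_labels. label_orbit X d)"
proof
  show "lab ` outer \<subseteq> (\<Union>d\<in>dominant_labels. label_orbit X d)"
    using ex_dominant label_orbit_sym lab_in_space by blast
  have "q \<in> lab ` outer" if "q \<in> label_orbit X d" "d \<in> dominant_labels" for q d
    using that
  proof (induction rule: label_orbit.induct)
    case base
    then show ?case by (simp add: dominant_labels_def)
  next
    case (reflect q i)
    then obtain x where "x \<in> outer" "q = lab x"
      by blast
    then show ?case
      using outer_reflect[of x i] lab_reflect[of i x] reflect.hyps(2) by (metis imageI)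
  qed
  then show "(\<Union>d\<in>dominant_labels. label_orbit X d) \<subseteq> lab ` outer"
    by blast
qed

text \<open>Otherwise every simple root of \<open>T\<close> lies in \<open>L\<close> or is
  orthogonal to \<open>L\<close>, and since the diagram is connected all are of the same kind. If
  all lie in \<open>L\<close>, no root is left outside; if none does, \<open>t 0\<close> is
  orthogonal to everything.\<close>

lemma ex_outer_nonorthogonal: "\<exists>x\<in>outer. lab x \<noteq> (\<lambda>_. 0)"
proof (rule ccontr)
  assume "\<not> ?thesis"
  then have "lab x = (\<lambda>_. 0)" if "x \<in> outer" for x
    using that by blast
  then have "form x (t j) = 0" if "x \<in> outer" "j < l" for x j
    using that by (metis labels_def)
  then have orth: "form x y = 0" if "x \<in> outer" "y \<in> L" for x y
    using that orth_L by blast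
  let ?n = "node_count T"
  define Q where "Q i \<longleftrightarrow> simple_root i \<in> L" for i
  have Q: "Q j" if "i < ?n" "j < ?n" "gram (dynkin_diagram T) i j \<noteq> 0" "Q i" for i j
  proof (rule ccontr)
    assume "\<not> Q j"
    then have "simple_root j \<in> outer"
      using that(2) by (simp add: Q_def outer_def root_system.simple)
    then have "form (simple_root j) (simple_root i) = 0"
      using orth that(4) by (simp add: Q_def)
    then show False
      using that(1-3) by (simp add: root_form_simple_root gram_commute)
  qed
  show False
  proof (cases "\<exists>i<?n. Q i")
    case True
    then have "Q j" if "j < ?n" for j
      using dynkin_connected[OF T _ _ that] Q by blast
    then have all: "x \<in> L" if "supported T x" for x
      using supported_expand[OF that] by (metis (no_types, lifting) Q_def lessThan_iff span_scale span_sum)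
    then show False
      using ex_outer outerD(2,3) by blast
  next
    case False
    have l: "0 < l"
      using branched_node_count[OF X] by simp
    have "form (t 0) (simple_root i) = 0" if "i < ?n" for i
    proof -
      have "simple_root i \<in> outer"
        using False that by (simp add: Q_def outer_def root_system.simple)
      then show ?thesis
        using orth[of "simple_root i" "t 0"] l by (simp add: span_base root_form_commute)
    qed
    then have "form (t 0) x = 0" if "supported T x" for x
      using supported_expand[OF that] by (metis (no_types, lifting) lessThan_iff linear_root_form_right linear_cmul linear_sum mult_zero_right real_scaleR_def sum.neutral)
    then show False
      using root_norm[OF t_root[OF l]] root_supported[OF t_root[OF l]] by force
  qed
qed

end

section \<open>Highest roots and minuscule weights\<close>

definition highest_coeff :: "dynkin \<Rightarrow> nat \<Rightarrow> real" where
  "highest_coeff X i = (case X of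
     DynA l \<Rightarrow> 1
   | DynD l \<Rightarrow> (if i = 0 \<or> i = l - 2 \<or> i = l - 1 then 1 else 2)
   | DynE l \<Rightarrow> (if l = 6 then [1, 2, 3, 2, 1, 2] ! i
       else if l = 7 then [2, 3, 4, 3, 2, 1, 2] ! i else [2, 4, 6, 5, 4, 3, 2, 3] ! i))"

lemma branched_cases:
  assumes "branched X"
  obtains (D) l where "X = DynD l" "4 \<le> l" | (E6) "X = DynE 6" | (E7) "X = DynE 7" | (E8) "X = DynE 8"
  using assms by (cases X) (auto simp: branched_def)

lemma branch_node_simps [simp]: "branch_node (DynD l) = l - 3" "branch_node (DynE l) = 2"
  by (simp_all add: branch_node_def)

lemma branched_simps [simp]: "branched (DynD l) \<longleftrightarrow> 4 \<le> l" "branched (DynE l) \<longleftrightarrow> l \<in> {6, 7, 8}"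
  by (auto simp: branched_def)

lemma sum_gram_DynE:
  assumes "l \<in> {6, 7, 8}" "j < l"
  shows "(\<Sum>k<l. f k * gram (dynkin_diagram (DynE l)) k j) = 2 * f j
     - (if 0 < j \<and> j < l - 1 then f (j - 1) else 0) - (if j + 1 < l - 1 then f (j + 1) else 0)
     - (if j = 2 then f (l - 1) else 0) - (if j = l - 1 then f 2 else 0)"
  using sum_gram_branched[of "DynE l" j f] assms by (simp del: dynkin_diagram.simps)

lemma sum_gram_DynD:
  assumes "4 \<le> l" "j < l"
  shows "(\<Sum>k<l. f k * gram (dynkin_diagram (DynD l)) k j) = 2 * f j
     - (if 0 < j \<and> j < l - 1 then f (j - 1) else 0) - (if j + 1 < l - 1 then f (j + 1) else 0)
     - (if j = l - 3 then f (l - 1) else 0) - (if j = l - 1 then f (l - 3) else 0)"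
  using sum_gram_branched[of "DynD l" j f] assms by (simp del: dynkin_diagram.simps)

definition fundamental :: "nat \<Rightarrow> nat \<Rightarrow> real" where
  "fundamental i j = (if j = i then 1 else 0)"

text \<open>The coefficients are those of the highest root in the simple roots. For these types it
  is the fundamental weight of the node \<open>h\<close> to which the affine node would be attached;
  the coefficient there is 2, so the norm of this vector is 2 as well.\<close>

lemma highest_coeff_gram:
  assumes "branched X"
  obtains h where "h < node_count X" "highest_coeff X h = 2" "weight_coeffs X (fundamental h) (highest_coeff X)"
  using assms
proof (cases X rule: branched_cases)
  case (D l)
  obtain m where m: "l = m + 4"
    using D(2) by (metis add.commute le_Suc_ex)
  define f where "f = highest_coeff X"
  have f: "f i = (if i = 0 \<or> i = m + 2 \<or> i = m + 3 then 1 else 2)" for i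
    by (simp add: f_def D(1) m highest_coeff_def add.commute)
  have "(\<Sum>k<node_count X. f k * gram (dynkin_diagram X) k j) = fundamental 1 j" if j: "j < l" for j
  proof -
    have "(\<Sum>k<node_count X. f k * gram (dynkin_diagram X) k j) = 2 * f j
        - (if 0 < j \<and> j < m + 3 then f (j - 1) else 0) - (if j + 1 < m + 3 then f (j + 1) else 0)
        - (if j = m + 1 then f (m + 3) else 0) - (if j = m + 3 then f (m + 1) else 0)"
      using sum_gram_DynD[OF D(2) j, of f] unfolding D(1) node_count.simps by (simp only: m) (simp add: add.commute del: dynkin_diagram.simps)
    also have "\<dots> = fundamental 1 j"
    proof -
      consider "j = 0" | "j = 1" | j' where "j = Suc j'" "1 \<le> j'" "j' < m" | "j = m + 1" "1 \<le> m" | "j = m + 2" | "j = m + 3"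
        using j m by (cases j) (auto, linarith)
      then show ?thesis
        by cases (simp_all add: f fundamental_def)
    qed
    finally show ?thesis .
  qed
  then have "weight_coeffs X (fundamental 1) (highest_coeff X)"
    using D by (simp add: f_def weight_coeffs_def label_space_def fundamental_def)
  moreover have "highest_coeff X 1 = 2"
    using D(2) by (auto simp: D(1) highest_coeff_def)
  ultimately show ?thesis
    using that[of 1] D by simp
next
  case E6
  have "(\<Sum>k<6. highest_coeff (DynE 6) k * gram (dynkin_diagram (DynE 6)) k j) = fundamental 5 j" if "j < 6" for j
  proof -
    have "j = 0 \<or> j = 1 \<or> j = 2 \<or> j = 3 \<or> j = 4 \<or> j = 5"
      using that by auto
    then show ?thesis
      by (elim disjE; simp add: sum_gram_DynE highest_coeff_def fundamental_def del: dynkin_diagram.simps)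
  qed
  then show ?thesis
    using that[of 5] E6 by (simp add: weight_coeffs_def label_space_def highest_coeff_def fundamental_def del: dynkin_diagram.simps)
next
  case E7
  have "(\<Sum>k<7. highest_coeff (DynE 7) k * gram (dynkin_diagram (DynE 7)) k j) = fundamental 0 j" if "j < 7" for j
  proof -
    have "j = 0 \<or> j = 1 \<or> j = 2 \<or> j = 3 \<or> j = 4 \<or> j = 5 \<or> j = 6"
      using that by auto
    then show ?thesis
      by (elim disjE; simp add: sum_gram_DynE highest_coeff_def fundamental_def del: dynkin_diagram.simps)
  qed
  then show ?thesis
    using that[of 0] E7 by (simp add: weight_coeffs_def label_space_def highest_coeff_def fundamental_def del: dynkin_diagram.simps)
next
  case E8
  have "(\<Sum>k<8. highest_coeff (DynE 8) k * gram (dynkin_diagram (DynE 8)) k j) = fundamental 6 j" if "j < 8" for j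
  proof -
    have "j = 0 \<or> j = 1 \<or> j = 2 \<or> j = 3 \<or> j = 4 \<or> j = 5 \<or> j = 6 \<or> j = 7"
      using that by auto
    then show ?thesis
      by (elim disjE; simp add: sum_gram_DynE highest_coeff_def fundamental_def del: dynkin_diagram.simps)
  qed
  then show ?thesis
    using that[of 6] E8 by (simp add: weight_coeffs_def label_space_def highest_coeff_def fundamental_def del: dynkin_diagram.simps)
qed

lemma highest_coeff_cases:
  assumes "branched X" "i < node_count X"
  shows "highest_coeff X i \<ge> 1"
    and "highest_coeff X i < 2 \<Longrightarrow> (case X of DynA l \<Rightarrow> False | DynD l \<Rightarrow> i = 0 \<or> i = l - 2 \<or> i = l - 1
      | DynE l \<Rightarrow> (l = 6 \<and> (i = 0 \<or> i = 4)) \<or> (l = 7 \<and> i = 5))"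
proof -
  have E: "\<forall>i<6. highest_coeff (DynE 6) i \<ge> 1 \<and> (highest_coeff (DynE 6) i < 2 \<longrightarrow> i = 0 \<or> i = 4)"
    "\<forall>i<7. highest_coeff (DynE 7) i \<ge> 1 \<and> (highest_coeff (DynE 7) i < 2 \<longrightarrow> i = 5)"
    "\<forall>i<8. highest_coeff (DynE 8) i \<ge> 1 \<and> \<not> highest_coeff (DynE 8) i < 2"
    by (simp_all add: All_less_Suc numeral_eq_Suc highest_coeff_def)
  have "highest_coeff X i \<ge> 1 \<and> (highest_coeff X i < 2 \<longrightarrow> (case X of DynA l \<Rightarrow> False
      | DynD l \<Rightarrow> i = 0 \<or> i = l - 2 \<or> i = l - 1 | DynE l \<Rightarrow> (l = 6 \<and> (i = 0 \<or> i = 4)) \<or> (l = 7 \<and> i = 5)))"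
    by (rule branched_cases[OF assms(1)]) (use E assms(2) in \<open>auto simp: highest_coeff_def[of "DynD _"]\<close>)
  then show "highest_coeff X i \<ge> 1"
    "highest_coeff X i < 2 \<Longrightarrow> (case X of DynA l \<Rightarrow> False | DynD l \<Rightarrow> i = 0 \<or> i = l - 2 \<or> i = l - 1
      | DynE l \<Rightarrow> (l = 6 \<and> (i = 0 \<or> i = 4)) \<or> (l = 7 \<and> i = 5))"
    by blast+
qed

text \<open>For the branched types these are the nodes with coefficient 1 in the highest root: the
  vector node and the two half-spin nodes of \<open>D_l\<close>, the ends of the two long arms of
  \<open>E_6\<close>, and the end of the longest arm of \<open>E_7\<close>.\<close>

definition minuscule :: "dynkin \<Rightarrow> nat set" where
  "minuscule X = (case X of DynA l \<Rightarrow> {} | DynD l \<Rightarrow> {0, l - 2, l - 1}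
     | DynE l \<Rightarrow> (if l = 6 then {0, 4} else if l = 7 then {5} else {}))"

text \<open>Columns of the inverse Cartan matrix.\<close>

definition minuscule_coeffs :: "dynkin \<Rightarrow> nat \<Rightarrow> nat \<Rightarrow> real" where
  "minuscule_coeffs X i k = (case X of
     DynA l \<Rightarrow> 0
   | DynD l \<Rightarrow> (if i = 0 then if k < l - 2 then 1 else 1 / 2
       else if k < l - 2 then (k + 1) / 2 else if k = i then l / 4 else (real l - 2) / 4)
   | DynE l \<Rightarrow> (if l = 7 then [1, 2, 3, 5 / 2, 2, 3 / 2, 3 / 2] ! k
       else if i = 0 then [4 / 3, 5 / 3, 2, 4 / 3, 2 / 3, 1] ! k
       else [2 / 3, 4 / 3, 2, 5 / 3, 4 / 3, 1] ! k))"

lemma minuscule_less: "branched X \<Longrightarrow> i \<in> minuscule X \<Longrightarrow> i < node_count X"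
  by (cases X) (auto simp: minuscule_def split: if_splits)

lemma weight_coeffs_minuscule:
  assumes "branched X" "i \<in> minuscule X"
  shows "weight_coeffs X (fundamental i) (minuscule_coeffs X i)"
proof -
  have "(\<Sum>k<node_count X. minuscule_coeffs X i k * gram (dynkin_diagram X) k j) = fundamental i j"
    if "j < node_count X" for j
    using assms(1)
  proof (cases X rule: branched_cases)
    case (D l)
    then have j: "j < l" using that by simp
    obtain m where m: "l = m + 4"
      using D(2) by (metis add.commute le_Suc_ex)
    define f where "f = minuscule_coeffs X i"
    have f: "f k = (if i = 0 then if k < m + 2 then 1 else 1 / 2
       else if k < m + 2 then (k + 1) / 2 else if k = i then (m + 4) / 4 else (m + 2) / 4)" for k
      by (simp add: f_def D(1) m minuscule_coeffs_def add.commute)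
    have i: "i = 0 \<or> i = m + 2 \<or> i = m + 3"
      using assms(2) by (simp add: D(1) m minuscule_def add.commute)
    have "(\<Sum>k<node_count X. f k * gram (dynkin_diagram X) k j) = 2 * f j
        - (if 0 < j \<and> j < m + 3 then f (j - 1) else 0) - (if j + 1 < m + 3 then f (j + 1) else 0)
        - (if j = m + 1 then f (m + 3) else 0) - (if j = m + 3 then f (m + 1) else 0)"
      using sum_gram_DynD[OF D(2) j, of f] unfolding D(1) node_count.simps by (simp only: m) (simp add: add.commute del: dynkin_diagram.simps)
    also have "\<dots> = fundamental i j"
    proof -
      consider "j = 0" | j' where "j = Suc j'" "j' < m" | "j = m + 1" | "j = m + 2" | "j = m + 3"
        using j m by (cases j) (auto, linarith)
      then show ?thesis
        using i by cases (elim disjE; simp add: f fundamental_def field_simps)+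
    qed
    finally show ?thesis by (simp add: f_def)
  next
    case E6
    have "i = 0 \<or> i = 4"
      using assms(2) E6 by (simp add: minuscule_def)
    moreover have "j = 0 \<or> j = 1 \<or> j = 2 \<or> j = 3 \<or> j = 4 \<or> j = 5"
      using that E6 by auto
    ultimately show ?thesis
      unfolding E6 node_count.simps
      by (elim disjE; simp add: sum_gram_DynE minuscule_coeffs_def fundamental_def del: dynkin_diagram.simps)
  next
    case E7
    have "i = 5"
      using assms(2) E7 by (simp add: minuscule_def)
    moreover have "j = 0 \<or> j = 1 \<or> j = 2 \<or> j = 3 \<or> j = 4 \<or> j = 5 \<or> j = 6"
      using that E7 by auto
    ultimately show ?thesis
      unfolding E7 node_count.simps
      by (elim disjE; simp add: sum_gram_DynE minuscule_coeffs_def fundamental_def del: dynkin_diagram.simps)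
  next
    case E8
    then show ?thesis using assms(2) by (simp add: minuscule_def)
  qed
  then show ?thesis
    using minuscule_less[OF assms] by (auto simp: weight_coeffs_def label_space_def fundamental_def)
qed

lemma weight_coeffs_0: "weight_coeffs X (\<lambda>_. 0) (\<lambda>_. 0)"
  by (simp add: weight_coeffs_def label_space_def)

lemma pairing_fundamental: "i < node_count X \<Longrightarrow> pairing X c (fundamental i) = c i"
proof -
  assume "i < node_count X"
  moreover have "pairing X c (fundamental i) = (\<Sum>k<node_count X. if k = i then c i else 0)"
    unfolding pairing_def by (rule sum.cong) (auto simp: fundamental_def)
  ultimately show ?thesis by simp
qed

lemma pairing_0 [simp]: "pairing X c (\<lambda>_. 0) = 0" "pairing X (\<lambda>_. 0) p = 0"
  by (simp_all add: pairing_def)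

context corank_one
begin

text \<open>The highest root of the subsystem is itself a root of \<open>T\<close>. It lies in
  \<open>L\<close>, so it differs from \<open>x\<close> and from \<open>- x\<close>, and distinct
  non-opposite roots have inner product at most 1.\<close>

lemma highest_bound:
  assumes "x \<in> outer"
  shows "pairing X (highest_coeff X) (lab x) \<le> 1"
proof -
  obtain h where h: "h < l" "highest_coeff X h = 2" "weight_coeffs X (fundamental h) (highest_coeff X)"
    using highest_coeff_gram[OF X] by blast
  let ?r = "comb (highest_coeff X)"
  have "form ?r ?r = 2"
    using h form_comb_comb[OF h(3)] by (simp add: pairing_fundamental)
  moreover have "highest_coeff X i \<in> \<int>" if "i < l" for i
  proof -
    have E: "\<forall>i<6. highest_coeff (DynE 6) i \<in> \<int>" "\<forall>i<7. highest_coeff (DynE 7) i \<in> \<int>" "\<forall>i<8. highest_coeff (DynE 8) i \<in> \<int>"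
      by (simp_all add: All_less_Suc numeral_eq_Suc highest_coeff_def)
    show ?thesis
      by (rule branched_cases[OF X]) (use E that in \<open>auto simp: highest_coeff_def[of "DynD _"]\<close>)
  qed
  then have "?r \<in> root_lattice T"
    unfolding comb_def using root_in_lattice[OF t_root] by (intro root_lattice_sum root_lattice_scaleR) auto
  ultimately have r: "?r \<in> root_system T"
    by (simp add: root_system_iff T)
  have "x \<noteq> ?r" "x \<noteq> - ?r"
    using outerD(2)[OF assms] comb_in_L[of "highest_coeff X"] span_neg by auto
  then have "form x ?r \<in> {-1, 0, 1}"
    using root_form_roots_cases[OF T outerD(1)[OF assms] r] by blast
  then show ?thesis
    by (auto simp: form_comb_right)
qed

text \<open>Dominant labels are nonnegative integers and the coefficients of the highest root are at
  least 1. A weighted sum of at most 1 thus leaves room for a single label 1, at a node of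
  coefficient 1.\<close>

lemma dominant_cases:
  assumes "p \<in> dominant_labels"
  shows "p = (\<lambda>_. 0) \<or> (\<exists>i\<in>minuscule X. p = fundamental i)"
proof (cases "p = (\<lambda>_. 0)")
  case False
  obtain x where x: "x \<in> outer" "p = lab x" and nonneg: "\<And>i. i < l \<Longrightarrow> 0 \<le> p i"
    using assms by (auto simp: dominant_labels_def)
  have out: "p i = 0" if "\<not> i < l" for i
    using x(2) that by (simp add: labels_def)
  obtain i where i: "i < l" "p i \<noteq> 0"
    using False out by (metis ext)
  have int: "p j \<in> \<int>" for j
    unfolding x(2) using outerD(5)[OF x(1)] by (rule lab_Ints)
  have pos: "p j \<ge> 1" if "j < l" "p j \<noteq> 0" for j
    using int[of j] nonneg[OF that(1)] that(2) by (auto elim!: Ints_cases)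
  have term_nonneg: "0 \<le> highest_coeff X j * p j" if "j < l" for j
    using highest_coeff_cases(1)[OF X that] nonneg[OF that] by simp
  have sum: "(\<Sum>j<l. highest_coeff X j * p j) \<le> 1"
    using highest_bound[OF x(1)] x(2) by (simp add: pairing_def)
  have le: "highest_coeff X i * p i + (\<Sum>j\<in>{..<l} - {i}. highest_coeff X j * p j) \<le> 1"
    using sum unfolding sum_lessThan_remove[OF i(1), of "\<lambda>j. highest_coeff X j * p j"] .
  have rest: "0 \<le> (\<Sum>j\<in>{..<l} - {i}. highest_coeff X j * p j)"
    using term_nonneg by (intro sum_nonneg) simp
  have "1 \<le> highest_coeff X i" "1 \<le> p i"
    using highest_coeff_cases(1)[OF X i(1)] pos[OF i] by auto
  moreover from this have "highest_coeff X i \<le> highest_coeff X i * p i" "p i \<le> highest_coeff X i * p i"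
    by simp_all
  ultimately have m: "highest_coeff X i = 1" "p i = 1" and zero: "(\<Sum>j\<in>{..<l} - {i}. highest_coeff X j * p j) = 0"
    using le rest by linarith+
  have "p j = 0" if "j < l" "j \<noteq> i" for j
  proof -
    have "highest_coeff X j * p j = 0"
      using zero term_nonneg that by (subst (asm) sum_nonneg_eq_0_iff) auto
    then show ?thesis
      using highest_coeff_cases(1)[OF X that(1)] by auto
  qed
  then have "p = fundamental i"
    using m(2) out by (auto simp: fundamental_def fun_eq_iff)
  moreover have "i \<in> minuscule X"
    by (rule branched_cases[OF X]) (use highest_coeff_cases(2)[OF X i(1)] m(1) in \<open>auto simp: minuscule_def\<close>)
  ultimately show ?thesis by blast
qed simp

lemma orbit_0: "p \<in> label_orbit X (\<lambda>_. 0) \<Longrightarrow> p = (\<lambda>_. 0)"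
  by (induction rule: label_orbit.induct) (auto simp: reflect_labels_def)

lemma ex_minuscule: "\<exists>i\<in>minuscule X. fundamental i \<in> dominant_labels"
proof -
  obtain x where x: "x \<in> outer" "lab x \<noteq> (\<lambda>_. 0)"
    using ex_outer_nonorthogonal by blast
  obtain d where d: "d \<in> dominant_labels" "d \<in> label_orbit X (lab x)"
    using ex_dominant[OF x(1)] by blast
  have "d \<noteq> (\<lambda>_. 0)"
    using label_orbit_sym[OF d(2)] orbit_0 x(2) by auto
  then show ?thesis
    using dominant_cases[OF d(1)] d(1) by auto
qed

lemma fundamental_dominant_iff: "fundamental i \<in> dominant_labels \<longleftrightarrow> fundamental i \<in> lab ` outer"
  and zero_dominant_iff: "(\<lambda>_. 0) \<in> dominant_labels \<longleftrightarrow> (\<lambda>_. 0) \<in> lab ` outer"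
  by (auto simp: dominant_labels_def fundamental_def)

text \<open>Since \<open>minuscule_coeffs X i\<close> is a column of the inverse Cartan matrix, its
  entry at \<open>j\<close> is the inner product of the fundamental weights \<open>i\<close> and
  \<open>j\<close>, and its entry at \<open>i\<close> is a squared length. The conditions of
  \<open>outer_shift\<close> thus become statements about these entries.\<close>

lemma minuscule_shift:
  assumes "i \<in> minuscule X" "fundamental i \<in> dominant_labels" "weight_coeffs X q d" "m \<noteq> (0::int)"
    and "\<And>j. j < l \<Longrightarrow> d j - of_int m * minuscule_coeffs X i j \<in> \<int>"
    and "(of_int m)\<^sup>2 * (2 - minuscule_coeffs X i i) + pairing X d q = 2"
  shows "q \<in> lab ` outer"
proof -
  obtain x where x: "x \<in> outer" "lab x = fundamental i"
    using assms(2) by (auto simp: dominant_labels_def)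
  have "\<exists>y\<in>outer. lab y = q"
    using x(2) weight_coeffs_minuscule[OF X assms(1)] assms minuscule_less[OF X assms(1)]
    by (intro outer_shift[OF x(1) _ assms(3,4), of "minuscule_coeffs X i"]) (simp_all add: pairing_fundamental)
  then show ?thesis by blast
qed

lemma minuscule_norm:
  assumes "i \<in> minuscule X" "fundamental i \<in> dominant_labels"
  shows "minuscule_coeffs X i i < 2"
proof -
  obtain x where x: "x \<in> outer" "lab x = fundamental i"
    using assms(2) by (auto simp: dominant_labels_def)
  then show ?thesis
    using pairing_less_2[OF x(1), of "minuscule_coeffs X i"] weight_coeffs_minuscule[OF X assms(1)]
      minuscule_less[OF X assms(1)] by (simp add: pairing_fundamental)
qed

lemma minuscule_square:
  assumes "i \<in> minuscule X" "fundamental i \<in> dominant_labels" "j \<in> minuscule X" "fundamental j \<in> dominant_labels"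
  shows "\<exists>n::int. (of_int n - minuscule_coeffs X i j)\<^sup>2 = (2 - minuscule_coeffs X i i) * (2 - minuscule_coeffs X j j)"
proof -
  obtain x y where x: "x \<in> outer" "lab x = fundamental i" and y: "y \<in> outer" "lab y = fundamental j"
    using assms(2,4) by (auto simp: dominant_labels_def)
  obtain n where "form x y = of_int n"
    using root_form_Ints[OF outerD(5)[OF x(1)] outerD(5)[OF y(1)]] by (auto elim: Ints_cases)
  then show ?thesis
    using outer_square[OF x(1) y(1)] x(2) y(2) weight_coeffs_minuscule[OF X] assms(1,3) minuscule_less[OF X]
    by (intro exI[of _ n]) (simp add: pairing_fundamental)
qed

lemma minuscule_square_0:
  assumes "i \<in> minuscule X" "fundamental i \<in> dominant_labels" "(\<lambda>_. 0) \<in> dominant_labels"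
  shows "\<exists>n::int. (of_int n)\<^sup>2 = 2 * (2 - minuscule_coeffs X i i)"
proof -
  obtain x y where x: "x \<in> outer" "lab x = fundamental i" and y: "y \<in> outer" "lab y = (\<lambda>_. 0)"
    using assms(2,3) by (auto simp: dominant_labels_def)
  obtain n where "form x y = of_int n"
    using root_form_Ints[OF outerD(5)[OF x(1)] outerD(5)[OF y(1)]] by (auto elim: Ints_cases)
  then show ?thesis
    using outer_square[OF x(1) y(1)] x(2) y(2) weight_coeffs_minuscule[OF X assms(1)] weight_coeffs_0 minuscule_less[OF X assms(1)]
    by (intro exI[of _ n]) (fastforce simp: pairing_fundamental)
qed

end

section \<open>Integral orthonormal coordinates\<close>

lemma int_abs_1: "\<bar>x\<bar> = 1 \<Longrightarrow> x = 1 \<or> x = -1" for x :: int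
  by linarith

text \<open>Nonzero integers have squares at least 1, and 4 is too large. So the integral vectors of
  norm two are those with two entries of absolute value 1 and zeros elsewhere.\<close>

lemma int_norm_two:
  fixes f :: "'k \<Rightarrow> int"
  assumes I: "finite I" and n: "(\<Sum>k\<in>I. f k * f k) = 2"
  obtains p q where "p \<in> I" "q \<in> I" "p \<noteq> q" "\<bar>f p\<bar> = 1" "\<bar>f q\<bar> = 1" "\<And>k. k \<in> I \<Longrightarrow> k \<noteq> p \<Longrightarrow> k \<noteq> q \<Longrightarrow> f k = 0"
proof -
  have sq: "f k * f k \<ge> 1" if "f k \<noteq> 0" for k
  proof -
    have "f k * f k \<noteq> 0" "0 \<le> f k * f k"
      using that by simp_all
    then show ?thesis by linarith
  qed
  have "\<exists>p\<in>I. f p \<noteq> 0"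
    by (rule ccontr) (use n in simp)
  then obtain p where p: "p \<in> I" "f p \<noteq> 0"
    by blast
  have n1: "f p * f p + (\<Sum>k\<in>I - {p}. f k * f k) = 2"
    using n I p(1) by (simp add: sum.remove)
  have "0 \<le> (\<Sum>k\<in>I - {p}. f k * f k)"
    by (intro sum_nonneg) simp
  then have "f p * f p \<le> 2"
    using n1 by linarith
  have abs1: "\<bar>f k\<bar> = 1" if "f k \<noteq> 0" "f k * f k \<le> 2" for k
  proof (rule ccontr)
    assume "\<bar>f k\<bar> \<noteq> 1"
    then have "2 \<le> \<bar>f k\<bar>"
      using that(1) by linarith
    then have "2 * 2 \<le> \<bar>f k\<bar> * \<bar>f k\<bar>"
      by (intro mult_mono) auto
    then show False
      using that(2) by simp
  qed
  have ap: "\<bar>f p\<bar> = 1"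
    using abs1 p(2) \<open>f p * f p \<le> 2\<close> by blast
  then have "f p * f p = 1"
    using int_abs_1 by fastforce
  then have n2: "(\<Sum>k\<in>I - {p}. f k * f k) = 1"
    using n1 by linarith
  have "\<exists>q\<in>I - {p}. f q \<noteq> 0"
    by (rule ccontr) (use n2 in simp)
  then obtain q where q: "q \<in> I - {p}" "f q \<noteq> 0"
    by blast
  have n3: "f q * f q + (\<Sum>k\<in>I - {p} - {q}. f k * f k) = 1"
    using n2 I q(1) by (simp add: sum.remove)
  moreover have nn: "0 \<le> (\<Sum>k\<in>I - {p} - {q}. f k * f k)"
    by (intro sum_nonneg) simp
  ultimately have "f q * f q \<le> 2" "(\<Sum>k\<in>I - {p} - {q}. f k * f k) = 0"
    using sq[OF q(2)] by linarith+
  then have "\<forall>k\<in>I - {p} - {q}. f k * f k = 0"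
    using I by (subst (asm) sum_nonneg_eq_0_iff) auto
  then show ?thesis
    using that[of p q] p q ap abs1[OF q(2) \<open>f q * f q \<le> 2\<close>] by auto
qed

lemma sum_two_support:
  fixes f :: "'k \<Rightarrow> int"
  assumes "finite I" "p \<in> I" "q \<in> I" "p \<noteq> q" "\<And>k. k \<in> I \<Longrightarrow> k \<noteq> p \<Longrightarrow> k \<noteq> q \<Longrightarrow> f k = 0"
  shows "(\<Sum>k\<in>I. f k) = f p + f q"
proof -
  have "(\<Sum>k\<in>I. f k) = (\<Sum>k\<in>{p, q}. f k)"
    using assms by (intro sum.mono_neutral_right) auto
  then show ?thesis using assms(4) by simp
qed

text \<open>Each \<open>a i\<close> shares exactly one of the two support points of \<open>c\<close>, so two of them share the same
  one, and orthogonality makes their other entries cancel.\<close>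

lemma three_orthogonal_neighbours:
  fixes c :: "'k \<Rightarrow> int" and a :: "nat \<Rightarrow> 'k \<Rightarrow> int"
  assumes I: "finite I" and c: "(\<Sum>k\<in>I. c k * c k) = 2"
    and a: "\<And>i. i < 3 \<Longrightarrow> (\<Sum>k\<in>I. a i k * a i k) = 2"
    and ca: "\<And>i. i < 3 \<Longrightarrow> (\<Sum>k\<in>I. c k * a i k) = -1"
    and orth: "\<And>i j. i < 3 \<Longrightarrow> j < 3 \<Longrightarrow> i \<noteq> j \<Longrightarrow> (\<Sum>k\<in>I. a i k * a j k) = 0"
  obtains i j p s where "i < 3" "j < 3" "i < j" "p \<in> I" "\<bar>s\<bar> = 1" "\<And>k. k \<in> I \<Longrightarrow> a i k + a j k = (if k = p then 2 * s else 0)"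
proof -
  obtain p q where pq: "p \<in> I" "q \<in> I" "p \<noteq> q" "\<bar>c p\<bar> = 1" "\<bar>c q\<bar> = 1"
    and cz: "\<And>k. k \<in> I \<Longrightarrow> k \<noteq> p \<Longrightarrow> k \<noteq> q \<Longrightarrow> c k = 0"
    using int_norm_two[OF I c] by metis
  have small: "a i k \<in> {-1, 0, 1}" if "i < 3" "k \<in> I" for i k
  proof (rule int_norm_two[OF I a[OF that(1)]])
    fix p q
    assume "\<bar>a i p\<bar> = 1" "\<bar>a i q\<bar> = 1" "\<And>k. k \<in> I \<Longrightarrow> k \<noteq> p \<Longrightarrow> k \<noteq> q \<Longrightarrow> a i k = 0"
    then show ?thesis
      using int_abs_1[of "a i p"] int_abs_1[of "a i q"] that(2) by (cases "k = p"; cases "k = q") auto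
  qed
  have choice: "a i p = - c p \<or> a i q = - c q" if "i < 3" for i
  proof -
    have "c p * a i p + c q * a i q = -1"
      using ca[OF that] cz pq by (subst (asm) sum_two_support[OF I pq(1-3)]) auto
    then show ?thesis
      using small[OF that pq(1)] small[OF that pq(2)] int_abs_1[OF pq(4)] int_abs_1[OF pq(5)]
      by (elim disjE) auto
  qed
  obtain i j s where ij: "i < 3" "j < 3" "i < j" "s \<in> {p, q}" "a i s = - c s" "a j s = - c s"
  proof -
    have "\<exists>i<3. \<exists>j<3. i < j \<and> (\<exists>s\<in>{p, q}. a i s = - c s \<and> a j s = - c s)"
    proof -
      have lt: "0 < (3::nat)" "1 < (3::nat)" "2 < (3::nat)" "0 < (1::nat)" "0 < (2::nat)" "1 < (2::nat)"
        by simp_all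
      show ?thesis
        using choice[OF lt(1)] choice[OF lt(2)] choice[OF lt(3)] lt by blast
    qed
    then show ?thesis using that by blast
  qed
  have sI: "s \<in> I" and cs: "\<bar>c s\<bar> = 1"
    using ij(4) pq by auto
  have other: "\<exists>u\<in>I. u \<noteq> s \<and> \<bar>a m u\<bar> = 1 \<and> (\<forall>k\<in>I. k \<noteq> s \<longrightarrow> k \<noteq> u \<longrightarrow> a m k = 0)"
    if "m < 3" "a m s = - c s" for m
  proof (rule int_norm_two[OF I a[OF that(1)]])
    fix p q
    assume "p \<in> I" "q \<in> I" "p \<noteq> q" "\<bar>a m p\<bar> = 1" "\<bar>a m q\<bar> = 1"
      and z: "\<And>k. k \<in> I \<Longrightarrow> k \<noteq> p \<Longrightarrow> k \<noteq> q \<Longrightarrow> a m k = 0"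
    moreover have "s = p \<or> s = q"
      using z[OF sI] that(2) cs by (metis abs_zero neg_equal_0_iff_equal zero_neq_one)
    ultimately show ?thesis by metis
  qed
  obtain u where u: "u \<in> I" "u \<noteq> s" "\<bar>a i u\<bar> = 1" "\<And>k. k \<in> I \<Longrightarrow> k \<noteq> s \<Longrightarrow> k \<noteq> u \<Longrightarrow> a i k = 0"
    using other[OF ij(1,5)] by blast
  obtain w where w: "w \<in> I" "w \<noteq> s" "\<bar>a j w\<bar> = 1" "\<And>k. k \<in> I \<Longrightarrow> k \<noteq> s \<Longrightarrow> k \<noteq> w \<Longrightarrow> a j k = 0"
    using other[OF ij(2,6)] by blast
  have "a i s * a j s + a i u * a j u = 0"
  proof -
    have "(\<Sum>k\<in>I. a i k * a j k) = a i s * a j s + a i u * a j u"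
      by (rule sum_two_support[OF I sI u(1)]) (use u in auto)
    then show ?thesis
      using orth[OF ij(1,2)] ij(3) by simp
  qed
  moreover have "a i s * a j s = 1"
    using ij(5,6) int_abs_1[OF cs] by auto
  ultimately have au: "a i u * a j u = -1"
    by linarith
  have uw: "u = w"
    using w(4)[OF u(1,2)] au by fastforce
  have "a i u + a j u = 0"
    using au int_abs_1[OF u(3)] by auto
  then have "a i k + a j k = (if k = s then 2 * (- c s) else 0)" if "k \<in> I" for k
    using u(2) u(4)[OF that] w(4)[OF that] ij(5,6) unfolding uw by (cases "k = s"; cases "k = w") simp_all
  then show ?thesis
    using that[of i j s "- c s"] ij(1-3) sI cs by auto
qed

definition coord :: "dynkin \<Rightarrow> nat \<Rightarrow> rvec \<Rightarrow> real" where
  "coord T = (case T of DynA l \<Rightarrow> coord_A l | DynD l \<Rightarrow> coord_D l | DynE l \<Rightarrow> (\<lambda>_ _. 0))"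

definition coord_index :: "dynkin \<Rightarrow> nat set" where
  "coord_index T = (case T of DynA l \<Rightarrow> {..l} | DynD l \<Rightarrow> {..<l} | DynE l \<Rightarrow> {})"

definition int_coord :: "dynkin \<Rightarrow> rvec \<Rightarrow> nat \<Rightarrow> int" where
  "int_coord T x k = \<lfloor>coord T k x\<rfloor>"

lemma finite_coord_index: "finite (coord_index T)"
  by (cases T) (auto simp: coord_index_def)

lemma coord_Ints: "x \<in> root_lattice T \<Longrightarrow> coord T k x \<in> \<int>"
  by (cases T) (auto simp: coord_def coord_A_def coord_D_def root_lattice_def)

lemma root_form_int_coord:
  assumes "is_dynkin T" "\<And>l. T \<noteq> DynE l" "x \<in> root_lattice T" "y \<in> root_lattice T"
  shows "root_form T x y = of_int (\<Sum>k\<in>coord_index T. int_coord T x k * int_coord T y k)"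
proof -
  have "of_int (int_coord T z k) = coord T k z" if "z \<in> root_lattice T" for z k
    using coord_Ints[OF that] by (simp add: int_coord_def)
  moreover have "root_form T x y = (\<Sum>k\<in>coord_index T. coord T k x * coord T k y)"
    using assms(1,2) by (cases T) (auto simp: coord_def coord_index_def root_form_coord_A root_form_coord_D)
  ultimately show ?thesis
    using assms(3,4) by simp
qed

lemma sum_int_coord_A:
  assumes "1 \<le> l" "x \<in> root_lattice (DynA l)"
  shows "(\<Sum>k\<in>coord_index (DynA l). int_coord (DynA l) x k) = 0"
proof -
  have "of_int (int_coord (DynA l) x k) = coord_A l k x" for k
    using coord_Ints[OF assms(2), of k] by (simp add: int_coord_def coord_def)
  then have "of_int (\<Sum>k\<in>coord_index (DynA l). int_coord (DynA l) x k) = (\<Sum>k\<le>l. coord_A l k x)"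
    by (simp add: coord_index_def)
  also have "\<dots> = 0"
    using assms(1) by (rule sum_coord_A)
  finally show ?thesis
    by (simp only: of_int_eq_0_iff)
qed

context corank_one
begin

text \<open>The three neighbours of the branch node are pairwise orthogonal and each has product -1
  with it. In types A and D, where integral orthonormal coordinates exist, two of them must
  therefore add up to twice a signed unit vector.\<close>

lemma branch_neighbours:
  assumes "\<And>l. T \<noteq> DynE l"
  defines "b \<equiv> branch_node X" and "f \<equiv> (\<lambda>k. int_coord T (t k))"
  obtains i j p s where "(i, j) \<in> {(b - 1, b + 1), (b - 1, l - 1), (b + 1, l - 1)}" "p \<in> coord_index T" "\<bar>s\<bar> = 1"
    "\<And>k. k \<in> coord_index T \<Longrightarrow> f i k + f j k = (if k = p then 2 * s else 0)"
proof -
  have b: "0 < b" "b < l - 2" "4 \<le> l"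
    using branched_node_count[OF X] by (auto simp: b_def)
  define n where "n i = (if i = 0 then b - 1 else if i = 1 then b + 1 else l - 1)" for i :: nat
  have nl: "n i < l" for i
    using b by (auto simp: n_def)
  have inner: "(\<Sum>k\<in>coord_index T. f i k * f j k) = m" if "i < l" "j < l" "g i j = of_int m" for i j m
  proof -
    have "of_int (\<Sum>k\<in>coord_index T. f i k * f j k) = (of_int m :: real)"
      unfolding f_def root_form_int_coord[OF T assms(1) root_in_lattice[OF t_root[OF that(1)]]
          root_in_lattice[OF t_root[OF that(2)]], symmetric]
      using form_t that by simp
    then show ?thesis
      by (simp only: of_int_eq_iff)
  qed
  have "n i \<noteq> n j" "n i \<noteq> b" if "i < 3" "j < 3" "i \<noteq> j" for i j
    using that b by (auto simp: n_def)
  then have orth: "g (n i) (n j) = 0" if "i < 3" "j < 3" "i \<noteq> j" for i j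
    using that b by (auto simp: gram_branched[OF X] n_def b_def[symmetric])
  have adj: "g b (n i) = -1" if "i < 3" for i
    using that b by (auto simp: gram_branched[OF X] n_def b_def[symmetric])
  show ?thesis
  proof (rule three_orthogonal_neighbours[where I = "coord_index T" and c = "f b" and a = "\<lambda>i. f (n i)",
      OF finite_coord_index])
    show "(\<Sum>k\<in>coord_index T. f b k * f b k) = 2"
      using b by (intro inner) (auto simp: gram_def)
    show "(\<Sum>k\<in>coord_index T. f (n i) k * f (n i) k) = 2" if "i < 3" for i
      using nl by (intro inner) (auto simp: gram_def)
    show "(\<Sum>k\<in>coord_index T. f b k * f (n i) k) = -1" if "i < 3" for i
      using b nl adj[OF that] by (intro inner) auto
    show "(\<Sum>k\<in>coord_index T. f (n i) k * f (n j) k) = 0" if "i < 3" "j < 3" "i \<noteq> j" for i j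
      using nl orth[OF that] by (intro inner) auto
  next
    fix i j p s
    assume *: "i < 3" "j < (3::nat)" "i < j" "p \<in> coord_index T" "\<bar>s\<bar> = 1"
      "\<And>k. k \<in> coord_index T \<Longrightarrow> f (n i) k + f (n j) k = (if k = p then 2 * s else 0)"
    have "i = 0 \<and> j = 1 \<or> i = 0 \<and> j = 2 \<or> i = 1 \<and> j = 2"
      using *(1-3) by linarith
    then have "(n i, n j) \<in> {(b - 1, b + 1), (b - 1, l - 1), (b + 1, l - 1)}"
      by (auto simp: n_def)
    then show ?thesis
      using that *(4-6) by blast
  qed
qed

text \<open>In type A the coordinates of a root sum to zero, whereas those of twice a signed unit
  vector sum to 2 or -2.\<close>

lemma not_DynA: "T \<noteq> DynA n"
proof
  assume A: "T = DynA n"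
  let ?b = "branch_node X" and ?f = "\<lambda>k. int_coord T (t k)"
  have b: "0 < ?b" "?b < l - 2" "4 \<le> l"
    using branched_node_count[OF X] by auto
  obtain i j p s where ij: "(i, j) \<in> {(?b - 1, ?b + 1), (?b - 1, l - 1), (?b + 1, l - 1)}"
    and p: "p \<in> coord_index T" "\<bar>s\<bar> = (1::int)" "\<And>k. k \<in> coord_index T \<Longrightarrow> ?f i k + ?f j k = (if k = p then 2 * s else 0)"
    using branch_neighbours A by blast
  have il: "i < l" "j < l"
    using ij b by auto
  have zero: "(\<Sum>k\<in>coord_index T. ?f m k) = 0" if "m < l" for m
    using sum_int_coord_A[of n "t m"] root_in_lattice[OF t_root[OF that]] T A by simp
  have "(\<Sum>k\<in>coord_index T. ?f i k + ?f j k) = (\<Sum>k\<in>coord_index T. if k = p then 2 * s else 0)"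
    by (intro sum.cong p(3) refl)
  also have "\<dots> = 2 * s"
    using p(1) finite_coord_index by simp
  finally show False
    using zero[OF il(1)] zero[OF il(2)] p(2) by (simp add: sum.distrib)
qed

text \<open>Two neighbours \<open>u\<close>, \<open>v\<close> of the branch node add up to twice a
  signed unit vector, so the labels of any lattice vector at \<open>u\<close> and \<open>v\<close>
  have an even sum. If \<open>u\<close> is the chain neighbour \<open>l' - 4\<close>, the root at
  \<open>l' - 5\<close>, which exists as \<open>5 \<le> l'\<close>, violates this with the sum -1.
  So \<open>u\<close> and \<open>v\<close> are the two end nodes, where a half-spin label has the
  odd sum 1.\<close>

lemma not_DynD_if_spin:
  assumes "T = DynD n" "X = DynD l'" "5 \<le> l'" "i \<in> {l' - 2, l' - 1}"
  shows "fundamental i \<notin> dominant_labels"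
proof
  assume "fundamental i \<in> dominant_labels"
  then obtain x where x: "x \<in> outer" "lab x = fundamental i"
    by (auto simp: dominant_labels_def)
  have l: "l = l'"
    using assms(2) by simp
  let ?f = "int_coord T"
  obtain u v p s where uv: "(u, v) \<in> {(l' - 4, l' - 2), (l' - 4, l' - 1), (l' - 2, l' - 1)}"
    and p: "p \<in> coord_index T" "\<bar>s\<bar> = (1::int)"
      "\<And>k. k \<in> coord_index T \<Longrightarrow> ?f (t u) k + ?f (t v) k = (if k = p then 2 * s else 0)"
  proof (rule branch_neighbours)
    fix i j p s
    assume "(i, j) \<in> {(branch_node X - 1, branch_node X + 1), (branch_node X - 1, l - 1), (branch_node X + 1, l - 1)}"
      and "p \<in> coord_index T" "\<bar>s\<bar> = (1::int)"
      and "\<And>k. k \<in> coord_index T \<Longrightarrow> ?f (t i) k + ?f (t j) k = (if k = p then 2 * s else 0)"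
    moreover have "branch_node X - 1 = l' - 4" "branch_node X + 1 = l' - 2"
      using assms(2,3) by auto
    ultimately show thesis
      using that[of i j p s] l by simp
  qed (use assms(1) in simp)
  have ul: "u < l" "v < l"
    using uv assms(2,3) by auto
  have even: "\<exists>m::int. root_form T z (t u) + root_form T z (t v) = 2 * of_int m" if z: "z \<in> root_lattice T" for z
  proof -
    have "root_form T z (t w) = of_int (\<Sum>k\<in>coord_index T. ?f z k * ?f (t w) k)" if "w < l" for w
      using z root_in_lattice[OF t_root[OF that]] assms(1) by (intro root_form_int_coord T) auto
    then have "root_form T z (t u) + root_form T z (t v) = of_int (\<Sum>k\<in>coord_index T. ?f z k * (?f (t u) k + ?f (t v) k))"
      using ul by (simp add: sum.distrib distrib_left)
    also have "(\<Sum>k\<in>coord_index T. ?f z k * (?f (t u) k + ?f (t v) k)) = (\<Sum>k\<in>coord_index T. if k = p then 2 * (?f z p * s) else 0)"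
      using p(3) by (intro sum.cong) auto
    also have "\<dots> = 2 * (?f z p * s)"
      using p(1) finite_coord_index by simp
    finally show ?thesis
      by (metis of_int_mult of_int_numeral)
  qed
  have odd: False if z: "root_form T z (t u) + root_form T z (t v) = r" "r = 1 \<or> r = -1" "z \<in> root_lattice T" for z r
  proof -
    obtain m :: int where "r = 2 * of_int m"
      using even[OF z(3)] z(1) by auto
    then have "real_of_int (2 * m) = of_int 1 \<or> real_of_int (2 * m) = of_int (-1)"
      using z(2) by auto
    then have "2 * m = 1 \<or> 2 * m = -1"
      by (metis of_int_eq_iff)
    then show False
      by presburger
  qed
  show False
  proof (cases "u = l' - 4")
    case True
    have "v = l' - 2 \<or> v = l' - 1"
      using uv assms(3) True by auto
    then have "g (l' - 5) u = -1" "g (l' - 5) v = 0"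
      unfolding gram_branched[OF X] using True assms(2,3) by auto
    then show False
      using odd[of "t (l' - 5)" "-1"] form_t[of "l' - 5"] ul assms(3) l root_in_lattice[OF t_root[of "l' - 5"]] by simp
  next
    case False
    then have uv': "u = l' - 2" "v = l' - 1"
      using uv assms(3) by auto
    have "form x (t w) = fundamental i w" if "w < l" for w
      using fun_cong[OF x(2), of w] that by (simp add: labels_def)
    then have "form x (t u) + form x (t v) = 1"
      using ul uv' assms(3,4) by (auto simp: fundamental_def)
    then show False
      using odd[of x 1] outerD(5)[OF x(1)] by simp
  qed
qed

end

section \<open>Dominant linkage labels\<close>

text \<open>For \<open>E\<^sub>6\<close> and \<open>E\<^sub>8\<close> the Cartan matrix is invertible modulo \<open>2\<close>, so \<open>v\<close> is twice a lattice vector and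
  its norm is divisible by \<open>8\<close>; for \<open>E\<^sub>7\<close> the norm may also be \<open>6\<close> modulo \<open>8\<close>.\<close>

lemma DynE_even_vector_norm:
  assumes l: "l \<in> {6, 7, 8}" and v: "v \<in> root_lattice (DynE l)"
    and even: "\<And>k. k < l \<Longrightarrow> root_form (DynE l) v (simple_root k) / 2 \<in> \<int>"
  shows "root_form (DynE l) v v \<noteq> 4"
proof
  assume four: "root_form (DynE l) v v = 4"
  define n where "n i = \<lfloor>Poly_Mapping.lookup v i\<rfloor>" for i
  have n: "Poly_Mapping.lookup v i = of_int (n i)" for i
    using v by (auto simp: n_def root_lattice_def)
  have row: "even (2 * n k - (if 0 < k \<and> k < l - 1 then n (k - 1) else 0) - (if k + 1 < l - 1 then n (k + 1) else 0)
     - (if k = 2 then n (l - 1) else 0) - (if k = l - 1 then n 2 else 0))" (is "even ?e") if k: "k < l" for k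
  proof -
    have "root_form (DynE l) v (simple_root k) = (\<Sum>i<l. Poly_Mapping.lookup v i * gram (dynkin_diagram (DynE l)) i k)"
    proof -
      have "root_form (DynE l) v (simple_root k) = (\<Sum>i<l. \<Sum>j<l. if j = k then Poly_Mapping.lookup v i * gram (dynkin_diagram (DynE l)) i k else 0)"
        unfolding root_form_def node_count.simps
        by (intro sum.cong refl) (simp add: lookup_single when_def del: dynkin_diagram.simps)
      then show ?thesis
        using k by (simp del: dynkin_diagram.simps)
    qed
    also have "\<dots> = of_int ?e"
      unfolding sum_gram_DynE[OF l k] n by (simp split: if_split)
    finally have "of_int ?e / 2 \<in> (\<int> :: real set)"
      using even[OF k] by simp
    then obtain m where "of_int ?e / 2 = (of_int m :: real)"
      by (auto elim: Ints_cases)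
    then have "of_int ?e = (of_int (2 * m) :: real)"
      by simp
    then have "?e = 2 * m"
      by (simp only: of_int_eq_iff)
    then show ?thesis by simp
  qed
  consider "l = 6" | "l = 7" | "l = 8"
    using l by auto
  then show False
  proof cases
    case 1
    have "even (n 0) \<and> even (n 1) \<and> even (n 2) \<and> even (n 3) \<and> even (n 4) \<and> even (n 5)"
      using row[of 0] row[of 1] row[of 2] row[of 3] row[of 4] row[of 5] by (simp add: 1 numeral_eq_Suc)
    then obtain m0 m1 m2 m3 m4 m5 where m: "n 0 = 2 * m0" "n 1 = 2 * m1" "n 2 = 2 * m2" "n 3 = 2 * m3" "n 4 = 2 * m4" "n 5 = 2 * m5"
      by (auto elim!: evenE)
    have "of_int (8 * (m0*m0 + m1*m1 + m2*m2 + m3*m3 + m4*m4 + m5*m5 - m0*m1 - m1*m2 - m2*m3 - m3*m4 - m2*m5)) = (of_int 4 :: real)"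
      using four unfolding 1 root_form_DynE chain_form_numeral n m by (simp add: algebra_simps)
    then show False
      unfolding of_int_eq_iff by presburger
  next
    case 2
    \<comment> \<open>Modulo 2 the kernel of the Cartan matrix of \<open>E_7\<close> is spanned by
      the vector supported on the nodes 3, 5 and 6.\<close>
    have p: "even (n 0) \<and> even (n 1) \<and> even (n 2) \<and> even (n 4) \<and> (even (n 3) \<longleftrightarrow> even (n 5)) \<and> (even (n 3) \<longleftrightarrow> even (n 6))"
      using row[of 0] row[of 1] row[of 2] row[of 3] row[of 4] row[of 5] row[of 6] by (simp add: 2 numeral_eq_Suc)
    then obtain m0 m1 m2 m4 where m: "n 0 = 2 * m0" "n 1 = 2 * m1" "n 2 = 2 * m2" "n 4 = 2 * m4"
      by (auto elim!: evenE)
    show False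
    proof (cases "even (n 3)")
      case True
      then obtain m3 m5 m6 where m': "n 3 = 2 * m3" "n 5 = 2 * m5" "n 6 = 2 * m6"
        using p by (auto elim!: evenE)
      have "of_int (8 * (m0*m0 + m1*m1 + m2*m2 + m3*m3 + m4*m4 + m5*m5 + m6*m6 - m0*m1 - m1*m2 - m2*m3 - m3*m4 - m4*m5 - m2*m6)) = (of_int 4 :: real)"
        using four unfolding 2 root_form_DynE chain_form_numeral n m m' by (simp add: algebra_simps)
      then show False
        unfolding of_int_eq_iff by presburger
    next
      case False
      then obtain m3 m5 m6 where m': "n 3 = 2 * m3 + 1" "n 5 = 2 * m5 + 1" "n 6 = 2 * m6 + 1"
        using p by (auto elim!: oddE)
      have "of_int (6 + 8 * (m0*m0 + m1*m1 + m2*m2 + m3*m3 + m3 + m4*m4 + m5*m5 + m5 + m6*m6 + m6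
          - m0*m1 - m1*m2 - m2*m3 - m3*m4 - m4*m5 - m2*m6 - m2 - m4)) = (of_int 4 :: real)"
        using four unfolding 2 root_form_DynE chain_form_numeral n m m' by (simp add: algebra_simps)
      then show False
        unfolding of_int_eq_iff by presburger
    qed
  next
    case 3
    have "even (n 0) \<and> even (n 1) \<and> even (n 2) \<and> even (n 3) \<and> even (n 4) \<and> even (n 5) \<and> even (n 6) \<and> even (n 7)"
      using row[of 0] row[of 1] row[of 2] row[of 3] row[of 4] row[of 5] row[of 6] row[of 7] by (simp add: 3 numeral_eq_Suc)
    then obtain m0 m1 m2 m3 m4 m5 m6 m7 where m: "n 0 = 2 * m0" "n 1 = 2 * m1" "n 2 = 2 * m2" "n 3 = 2 * m3" "n 4 = 2 * m4" "n 5 = 2 * m5"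
      "n 6 = 2 * m6" "n 7 = 2 * m7"
      by (auto elim!: evenE)
    have "of_int (8 * (m0*m0 + m1*m1 + m2*m2 + m3*m3 + m4*m4 + m5*m5 + m6*m6 + m7*m7
        - m0*m1 - m1*m2 - m2*m3 - m3*m4 - m4*m5 - m5*m6 - m2*m7)) = (of_int 4 :: real)"
      using four unfolding 3 root_form_DynE chain_form_numeral n m by (simp add: algebra_simps)
    then show False
      unfolding of_int_eq_iff by presburger
  qed
qed

text \<open>The equations that \<open>outer_square\<close> would impose on pairs of dominant labels
  that are to be excluded. With the label 0 the right side is \<open>2 (2 - (q, q))\<close>: this
  gives 2 for the vector weight of \<open>D_l\<close> and the half-spin weights of
  \<open>D_4\<close>, 3/2 and 1/2 for half-spin weights of \<open>D_5\<close> and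
  \<open>D_7\<close>, and 4/3 for \<open>E_6\<close>. The shift 1/2 is the inner product of the
  vector and a half-spin weight, with \<open>2 - l/4\<close> on the right for \<open>l\<close> = 4,
  5, 6; its first instance also covers the two half-spin weights of \<open>D_4\<close>. The last
  line belongs to those of \<open>D_6\<close>.\<close>

lemma int_square_neq:
  fixes n :: int
  shows "(real_of_int n)\<^sup>2 \<noteq> 2" "(real_of_int n)\<^sup>2 \<noteq> 3 / 2" "(real_of_int n)\<^sup>2 \<noteq> 1 / 2" "(real_of_int n)\<^sup>2 \<noteq> 4 / 3"
    "(real_of_int n - 1 / 2)\<^sup>2 \<noteq> 1" "(real_of_int n - 1 / 2)\<^sup>2 \<noteq> 3 / 4" "(real_of_int n - 1 / 2)\<^sup>2 \<noteq> 1 / 2"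
    "(real_of_int n - 1)\<^sup>2 \<noteq> 1 / 4"
proof -
  have sq: "(real_of_int n)\<^sup>2 = of_int (n * n)" "(real_of_int n - 1 / 2)\<^sup>2 = of_int (4 * (n * n) - 4 * n + 1) / 4"
    "(real_of_int n - 1)\<^sup>2 = of_int (n * n - 2 * n + 1)"
    by (simp_all add: power2_eq_square algebra_simps)
  have two: "n * n \<noteq> 2"
  proof
    assume *: "n * n = 2"
    then have "\<bar>n\<bar> < 2"
      using abs_mult_self_eq[of n] mult_mono[of 2 "\<bar>n\<bar>" 2 "\<bar>n\<bar>"] by (cases "\<bar>n\<bar> < 2") auto
    then have "n = 0 \<or> n = 1 \<or> n = -1"
      by linarith
    then show False using * by auto
  qed
  have real_int: False if "real_of_int a = of_int b" "a \<noteq> b" for a b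
    using that by simp
  show "(real_of_int n)\<^sup>2 \<noteq> 2"
    using real_int[of "n * n" 2] two unfolding sq by auto
  show "(real_of_int n)\<^sup>2 \<noteq> 3 / 2"
    using real_int[of "2 * (n * n)" 3] unfolding sq by (auto, presburger)
  show "(real_of_int n)\<^sup>2 \<noteq> 1 / 2"
    using real_int[of "2 * (n * n)" 1] unfolding sq by (auto, presburger)
  show "(real_of_int n)\<^sup>2 \<noteq> 4 / 3"
    using real_int[of "3 * (n * n)" 4] unfolding sq by (auto, presburger)
  show "(real_of_int n - 1 / 2)\<^sup>2 \<noteq> 1"
    using real_int[of "4 * (n * n) - 4 * n + 1" 4] unfolding sq by (auto, presburger)
  show "(real_of_int n - 1 / 2)\<^sup>2 \<noteq> 3 / 4"
    using real_int[of "4 * (n * n) - 4 * n + 1" 3] unfolding sq by (auto, presburger)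
  show "(real_of_int n - 1 / 2)\<^sup>2 \<noteq> 1 / 2"
    using real_int[of "4 * (n * n) - 4 * n + 1" 2] unfolding sq by (auto, presburger)
  show "(real_of_int n - 1)\<^sup>2 \<noteq> 1 / 4"
    using real_int[of "4 * (n * n - 2 * n + 1)" 1] unfolding sq by (auto, presburger)
qed

lemma minuscule_DynD [simp]: "minuscule (DynD l) = {0, l - 2, l - 1}"
  by (simp add: minuscule_def)

lemma minuscule_coeffs_DynD:
  assumes "4 \<le> l"
  shows "minuscule_coeffs (DynD l) 0 0 = 1"
    and "i \<in> {l - 2, l - 1} \<Longrightarrow> minuscule_coeffs (DynD l) 0 i = 1 / 2"
    and "i \<in> {l - 2, l - 1} \<Longrightarrow> minuscule_coeffs (DynD l) i i = l / 4"
    and "minuscule_coeffs (DynD l) (l - 2) (l - 1) = (real l - 2) / 4"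
  using assms by (auto simp: minuscule_coeffs_def)

context corank_one
begin

abbreviation "D \<equiv> dominant_labels"

lemma dominant_subset: "D \<subseteq> insert (\<lambda>_. 0) (fundamental ` minuscule X)"
  using dominant_cases by blast

text \<open>Reflecting at the branch node changes both end labels equally, reflecting at an end node
  changes one of them by an even number, and the other reflections change neither. The parity of the
  difference is the character of the weight lattice modulo the root lattice that separates half-spin
  weights from 0 and the vector weight.\<close>

lemma orbit_parity:
  assumes "X = DynD l'" "p \<in> label_orbit X d" "\<And>i. d i \<in> \<int>" "(d (l' - 1) - d (l' - 2)) / 2 \<in> \<int>"
  shows "(\<forall>i. p i \<in> \<int>) \<and> (p (l' - 1) - p (l' - 2)) / 2 \<in> \<int>"
  using assms(2)
proof (induction rule: label_orbit.induct)
  case base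
  then show ?case using assms(3,4) by blast
next
  case (reflect q i)
  have l: "4 \<le> l'" "l = l'"
    using X assms(1) by auto
  have int: "reflect_labels X i q j \<in> \<int>" for j
    using reflect.IH by (auto simp: reflect_labels_def gram_Ints intro!: Ints_diff Ints_mult)
  have "g i (l' - 1) = (if i = l' - 1 then 2 else if i = l' - 3 then -1 else 0)"
    "g i (l' - 2) = (if i = l' - 2 then 2 else if i = l' - 3 then -1 else 0)"
    unfolding gram_branched[OF X] using reflect.hyps(2) l assms(1) by auto
  then have "g i (l' - 1) - g i (l' - 2) \<in> {0, 2, -2}"
    using l(1) by auto
  then have "(g i (l' - 1) - g i (l' - 2)) / 2 \<in> \<int>"
    by auto
  then have "q i * ((g i (l' - 1) - g i (l' - 2)) / 2) \<in> \<int>"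
    using reflect.IH by (intro Ints_mult) auto
  moreover have "(reflect_labels X i q (l' - 1) - reflect_labels X i q (l' - 2)) / 2
      = (q (l' - 1) - q (l' - 2)) / 2 - q i * ((g i (l' - 1) - g i (l' - 2)) / 2)"
    using l by (simp add: reflect_labels_def field_simps)
  ultimately show ?case
    using reflect.IH int by (metis Ints_diff)
qed

text \<open>Suppose that no half-spin label occurs. Then every root of \<open>T\<close> has labels
  of equal parity at the two end nodes: for roots outside \<open>L\<close> by
  \<open>orbit_parity\<close>, and for roots in \<open>L\<close> because their product with an outer
  root of vector label is an integer plus half the sum of these two labels. So the difference of the
  two end roots, a vector of norm 4, has even products with all simple roots, which
  \<open>DynE_even_vector_norm\<close> forbids.\<close>

lemma spin_if_DynE:
  assumes "T = DynE n" "X = DynD l'" "5 \<le> l'"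
  shows "\<exists>i\<in>{l' - 2, l' - 1}. fundamental i \<in> D"
proof (rule ccontr)
  assume no: "\<not> ?thesis"
  have l: "l = l'" "l' < n" and n: "n \<in> {6, 7, 8}"
    using assms rank T by auto
  have V: "fundamental 0 \<in> D"
    using ex_minuscule no assms(2) by auto
  then obtain y where y: "y \<in> outer" "lab y = fundamental 0"
    by (auto simp: dominant_labels_def)
  have parity: "(lab x (l' - 1) - lab x (l' - 2)) / 2 \<in> \<int>" if x: "x \<in> root_system T" for x
  proof (cases "x \<in> L")
    case True
    let ?c = "minuscule_coeffs X 0"
    have w: "weight_coeffs X (lab y) ?c"
      unfolding y(2) by (rule weight_coeffs_minuscule[OF X]) (simp add: assms(2))
    have "form y x = form (comb ?c) x"
      using orthogonal_part(2)[OF w True] by (simp add: root_form_linear)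
    also have "\<dots> = pairing X ?c (lab x)"
      by (simp add: form_comb_right root_form_commute[of T "comb ?c"])
    also have "\<dots> = (\<Sum>k<l' - 2. lab x k) + (lab x (l' - 2) + lab x (l' - 1)) / 2"
    proof -
      obtain m where m: "l' = Suc (Suc m)"
        using assms(3) by (cases l'; cases "l' - 1") auto
      show ?thesis
        unfolding pairing_def l(1) by (simp add: m assms(2) minuscule_coeffs_def field_simps)
    qed
    finally have "(lab x (l' - 2) + lab x (l' - 1)) / 2 = form y x - (\<Sum>k<l' - 2. lab x k)"
      by simp
    also have "\<dots> \<in> \<int>"
      using root_form_Ints[OF outerD(5)[OF y(1)] root_in_lattice[OF x]] lab_Ints[OF root_in_lattice[OF x]]
      by (intro Ints_diff Ints_sum) auto
    finally have "(lab x (l' - 2) + lab x (l' - 1)) / 2 - lab x (l' - 2) \<in> \<int>"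
      using lab_Ints[OF root_in_lattice[OF x]] by (intro Ints_diff)
    then show ?thesis
      by (simp add: field_simps)
  next
    case False
    then have "lab x \<in> lab ` outer"
      using x by (simp add: outer_def)
    then obtain d where d: "d \<in> D" "lab x \<in> label_orbit X d"
      unfolding labels_outer_eq by blast
    have "d = (\<lambda>_. 0) \<or> d = fundamental 0"
      using dominant_cases[OF d(1)] no d(1) assms(2) by auto
    then have "\<And>i. d i \<in> \<int>" "(d (l' - 1) - d (l' - 2)) / 2 \<in> \<int>"
      using assms(3) by (auto simp: fundamental_def)
    then show ?thesis
      using orbit_parity[OF assms(2) d(2)] by blast
  qed
  let ?v = "t (l' - 1) - t (l' - 2)"
  have il: "l' - 1 < l" "l' - 2 < l"
    using l assms(3) by auto
  have "?v \<in> root_lattice T"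
    using root_in_lattice[OF t_root] il by (intro root_lattice_diff)
  moreover have "root_form T ?v (simple_root k) / 2 \<in> \<int>" if "k < n" for k
    using parity[OF root_system.simple, of k] that assms(1) il
    by (simp add: labels_def root_form_linear root_form_commute[of _ "simple_root k"])
  moreover have "g (l' - 1) (l' - 2) = 0" "g (l' - 2) (l' - 1) = 0"
    unfolding gram_branched[OF X] using assms(2,3) by auto
  then have "root_form T ?v ?v = 4"
    using form_t il by (simp add: root_form_linear, simp add: gram_def)
  ultimately show False
    using DynE_even_vector_norm[OF n, of ?v] assms(1) by blast
qed

text \<open>A minuscule label must occur, but \<open>E_8\<close> has no minuscule node. So the class
  of \<open>E_8\<close> has no extensions, and its full linkage systems are empty.\<close>

lemma X_not_DynE8: "X \<noteq> DynE 8"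
  using ex_minuscule by (auto simp: minuscule_def)

lemma dominant_DynE7:
  assumes "X = DynE 7"
  shows "D = {\<lambda>_. 0, fundamental 5}"
proof -
  have 5: "fundamental 5 \<in> D"
    using ex_minuscule assms by (simp add: minuscule_def)
  have "(\<lambda>_. 0) \<in> lab ` outer"
  \<comment> \<open>Twice the minuscule weight of \<open>E_7\<close> lies in the root lattice, and
    its squared length 3/2 gives \<open>4 (2 - 3/2) = 2\<close>.\<close>
  proof (rule minuscule_shift[OF _ 5 weight_coeffs_0, of 2])
    fix j assume "j < l"
    then have "j = 0 \<or> j = 1 \<or> j = 2 \<or> j = 3 \<or> j = 4 \<or> j = 5 \<or> j = 6"
      using assms by auto
    then show "0 - real_of_int 2 * minuscule_coeffs X 5 j \<in> \<int>"
      unfolding assms by (elim disjE; simp add: minuscule_coeffs_def)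
  qed (simp_all add: assms minuscule_def minuscule_coeffs_def)
  then show ?thesis
    using 5 dominant_subset zero_dominant_iff assms by (auto simp: minuscule_def)
qed

lemma dominant_DynE6:
  assumes "X = DynE 6"
  shows "D = {fundamental 0, fundamental 4}"
proof -
  have shift: "fundamental j \<in> D" if "fundamental i \<in> D" "i = 0 \<and> j = 4 \<or> i = 4 \<and> j = 0" for i j
  proof -
    have m: "i \<in> minuscule X" "j \<in> minuscule X"
      using that(2) assms by (auto simp: minuscule_def)
    have "fundamental j \<in> lab ` outer"
    \<comment> \<open>The factor -1 reflects that the two minuscule weights of \<open>E_6\<close>
      are negatives of each other modulo the root lattice; both have squared length 4/3, so the norm
      condition holds.\<close>
    proof (rule minuscule_shift[OF m(1) that(1) weight_coeffs_minuscule[OF X m(2)], of "-1"])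
      fix k assume "k < l"
      then have "k = 0 \<or> k = 1 \<or> k = 2 \<or> k = 3 \<or> k = 4 \<or> k = 5"
        using assms by auto
      then show "minuscule_coeffs X j k - real_of_int (-1) * minuscule_coeffs X i k \<in> \<int>"
        using that(2) unfolding assms by (elim disjE conjE; simp add: minuscule_coeffs_def)
    qed (use that(2) assms in \<open>auto simp: pairing_fundamental minuscule_coeffs_def\<close>)
    then show ?thesis
      by (simp add: fundamental_dominant_iff)
  qed
  have "fundamental 0 \<in> D \<or> fundamental 4 \<in> D"
    using ex_minuscule assms by (auto simp: minuscule_def)
  then have 04: "fundamental 0 \<in> D" "fundamental 4 \<in> D"
    using shift by blast+
  have "(\<lambda>_. 0) \<notin> D"
    using minuscule_square_0[OF _ 04(1)] int_square_neq(4) assms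
    by (auto simp: minuscule_def minuscule_coeffs_def)
  then show ?thesis
    using 04 dominant_subset assms by (auto simp: minuscule_def)
qed

section \<open>Dominant labels for \<open>X\<close> of type D\<close>

lemma X_DynD_ge_4: "X = DynD l' \<Longrightarrow> 4 \<le> l'"
  using X by simp

lemma DynD_not_0_and_0:
  assumes "X = DynD l'" "fundamental 0 \<in> D"
  shows "(\<lambda>_. 0) \<notin> D"
proof
  assume "(\<lambda>_. 0) \<in> D"
  then obtain n :: int where "(of_int n)\<^sup>2 = 2 * (2 - minuscule_coeffs X 0 0)"
    using minuscule_square_0[OF _ assms(2)] assms(1) by auto
  then show False
    using int_square_neq(1)[of n] minuscule_coeffs_DynD(1)[OF X_DynD_ge_4[OF assms(1)]] assms(1) by simp
qed

text \<open>The squared length of a half-spin weight is \<open>l'/4\<close>, and projections of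
  outer roots have squared length below 2.\<close>

lemma DynD_spin_less_8:
  assumes "X = DynD l'" "i \<in> {l' - 2, l' - 1}" "fundamental i \<in> D"
  shows "l' < 8"
proof -
  have "minuscule_coeffs X i i < 2"
    using minuscule_norm[OF _ assms(3)] assms(1,2) by auto
  then show ?thesis
    using minuscule_coeffs_DynD(3)[OF X_DynD_ge_4[OF assms(1)] assms(2)] assms(1) by simp
qed

lemma DynD_spin_not_0:
  assumes "X = DynD l'" "i \<in> {l' - 2, l' - 1}" "fundamental i \<in> D" "l' \<in> {4, 5, 7}"
  shows "(\<lambda>_. 0) \<notin> D"
proof
  assume "(\<lambda>_. 0) \<in> D"
  then obtain n :: int where "(of_int n)\<^sup>2 = 2 * (2 - minuscule_coeffs X i i)"
    using minuscule_square_0[OF _ assms(3)] assms(1,2) by auto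
  then have "(real_of_int n)\<^sup>2 = 2 * (2 - real l' / 4)"
    using minuscule_coeffs_DynD(3)[OF X_DynD_ge_4[OF assms(1)] assms(2)] assms(1) by simp
  then show False
    using int_square_neq(1-3)[of n] assms(4) by auto
qed

lemma DynD_spin_not_vector:
  assumes "X = DynD l'" "i \<in> {l' - 2, l' - 1}" "fundamental i \<in> D" "l' \<in> {4, 5, 6}"
  shows "fundamental 0 \<notin> D"
proof
  assume "fundamental 0 \<in> D"
  then obtain n :: int where "(of_int n - minuscule_coeffs X 0 i)\<^sup>2 = (2 - minuscule_coeffs X 0 0) * (2 - minuscule_coeffs X i i)"
    using minuscule_square[OF _ _ _ assms(3), of 0] assms(1,2) by auto
  then have "(real_of_int n - 1 / 2)\<^sup>2 = 2 - real l' / 4"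
    using minuscule_coeffs_DynD(1)[OF X_DynD_ge_4[OF assms(1)]]
      minuscule_coeffs_DynD(2,3)[OF X_DynD_ge_4[OF assms(1)] assms(2)] assms(1) by simp
  then show False
    using int_square_neq(5-7)[of n] assms(4) by auto
qed

lemma DynD_not_both_spins:
  assumes "X = DynD l'" "l' \<in> {4, 6}" "fundamental (l' - 2) \<in> D"
  shows "fundamental (l' - 1) \<notin> D"
proof
  assume "fundamental (l' - 1) \<in> D"
  then obtain n :: int where "(of_int n - minuscule_coeffs X (l' - 2) (l' - 1))\<^sup>2 =
      (2 - minuscule_coeffs X (l' - 2) (l' - 2)) * (2 - minuscule_coeffs X (l' - 1) (l' - 1))"
    using minuscule_square[OF _ assms(3), of "l' - 1"] assms(1) by auto
  then have "(of_int n - (real l' - 2) / 4)\<^sup>2 = (2 - real l' / 4) * (2 - real l' / 4)"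
    by (simp only: assms(1) minuscule_coeffs_DynD(4)[OF X_DynD_ge_4[OF assms(1)]]
      minuscule_coeffs_DynD(3)[OF X_DynD_ge_4[OF assms(1)] insertI1]
      minuscule_coeffs_DynD(3)[OF X_DynD_ge_4[OF assms(1)] insertI2[OF insertI1]])
  then show False
    using int_square_neq(5)[of n] int_square_neq(8)[of n] assms(2) by auto
qed

lemma dominant_DynD_cases:
  assumes "X = DynD l'"
  shows "D \<subseteq> {\<lambda>_. 0, fundamental 0, fundamental (l' - 2), fundamental (l' - 1)}"
    and "fundamental 0 \<in> D \<or> fundamental (l' - 2) \<in> D \<or> fundamental (l' - 1) \<in> D"
  using dominant_subset ex_minuscule assms by auto

lemma dominant_DynD_no_spin:
  assumes "X = DynD l'" "fundamental (l' - 2) \<notin> D" "fundamental (l' - 1) \<notin> D"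
  shows "D = {fundamental 0}"
proof -
  have "fundamental 0 \<in> D"
    using dominant_DynD_cases(2)[OF assms(1)] assms(2,3) by blast
  then show ?thesis
    using dominant_DynD_cases(1)[OF assms(1)] assms(2,3) DynD_not_0_and_0[OF assms(1)] by blast
qed

text \<open>All three minuscule weights have squared length 1, and the square condition forbids any
  two of the candidates together. It cannot decide which one occurs, since triality permutes them
  when the \<open>D_4\<close>-set is relabelled.\<close>

lemma dominant_DynD4:
  assumes "X = DynD 4"
  shows "D \<in> {{fundamental 0}, {fundamental 2}, {fundamental 3}}"
  using dominant_DynD_cases[OF assms] DynD_not_0_and_0[OF assms] DynD_spin_not_0[OF assms, of 2] DynD_spin_not_0[OF assms, of 3]
    DynD_spin_not_vector[OF assms, of 2] DynD_spin_not_vector[OF assms, of 3] DynD_not_both_spins[OF assms]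
  by simp blast

lemma dominant_DynD_large:
  assumes "X = DynD l'" "8 \<le> l'"
  shows "D = {fundamental 0}"
  using dominant_DynD_no_spin[OF assms(1)] DynD_spin_less_8[OF assms(1)] assms(2) by fastforce

lemma dominant_DynD_in_DynD:
  assumes "X = DynD l'" "T = DynD n" "5 \<le> l'"
  shows "D = {fundamental 0}"
  using dominant_DynD_no_spin[OF assms(1)] not_DynD_if_spin[OF assms(2,1,3)] by blast

text \<open>For odd rank the two half-spin weights are negatives of each other modulo the root
  lattice: their coefficients add up to \<open>k + 1\<close> on the chain and to
  \<open>(l' - 1)/2\<close> at the two end nodes.\<close>

lemma spin_shift:
  assumes "X = DynD l'" "l' \<in> {5, 7}" "fundamental i \<in> D" "i \<in> {l' - 2, l' - 1}" "j \<in> {l' - 2, l' - 1}"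
  shows "fundamental j \<in> D"
proof (cases "i = j")
  case False
  have m: "i \<in> minuscule X" "j \<in> minuscule X"
    using assms by auto
  have "fundamental j \<in> lab ` outer"
  proof (rule minuscule_shift[OF m(1) assms(3) weight_coeffs_minuscule[OF X m(2)], of "-1"])
    fix k assume "k < l"
    have "minuscule_coeffs X j k - real_of_int (-1) * minuscule_coeffs X i k = (if k < l' - 2 then real (k + 1) else (real l' - 1) / 2)"
      using assms \<open>k < l\<close> False by (auto simp: minuscule_coeffs_def field_simps)
    also have "\<dots> \<in> \<int>"
      using assms(2) by auto
    finally show "minuscule_coeffs X j k - real_of_int (-1) * minuscule_coeffs X i k \<in> \<int>" .
  next
    have "j < l"
      using assms by auto
    moreover have "minuscule_coeffs X i i = real l' / 4" "minuscule_coeffs X j j = real l' / 4"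
      using minuscule_coeffs_DynD(3)[OF X_DynD_ge_4[OF assms(1)]] assms(1,4,5) by blast+
    ultimately show "(real_of_int (-1))\<^sup>2 * (2 - minuscule_coeffs X i i) + pairing X (minuscule_coeffs X j) (fundamental j) = 2"
      by (simp add: pairing_fundamental)
  qed simp
  then show ?thesis
    by (simp add: fundamental_dominant_iff)
qed (use assms in simp)

text \<open>The three results reflect the gradings of \<open>E_6\<close>, \<open>E_7\<close>,
  \<open>E_8\<close> by the component orthogonal to \<open>L\<close>. The half-spin weights sit in
  degrees 1 and -1; the degrees 2 and -2 are empty for \<open>E_6\<close>, contain the label 0 for
  \<open>E_7\<close> and the vector weight for \<open>E_8\<close>.\<close>

lemma dominant_DynD_in_DynE:
  assumes "X = DynD l'" "T = DynE n"
  shows "l' = 5 \<Longrightarrow> D = {fundamental 3, fundamental 4}"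
    and "l' = 6 \<Longrightarrow> D \<in> {{\<lambda>_. 0, fundamental 4}, {\<lambda>_. 0, fundamental 5}}"
    and "l' = 7 \<Longrightarrow> D = {fundamental 0, fundamental 5, fundamental 6}"
proof -
  note spin = spin_if_DynE[OF assms(2,1)]
  have both: "fundamental (l' - 2) \<in> D" "fundamental (l' - 1) \<in> D" if l': "l' \<in> {5, 7}"
  proof -
    have "5 \<le> l'"
      using l' by auto
    then obtain i where i: "i \<in> {l' - 2, l' - 1}" "fundamental i \<in> D"
      using spin by blast
    show "fundamental (l' - 2) \<in> D" "fundamental (l' - 1) \<in> D"
      using spin_shift[OF assms(1) l' i(2,1)] by blast+
  qed
  show "D = {fundamental 3, fundamental 4}" if l': "l' = 5"
  proof -
    have 34: "fundamental 3 \<in> D" "fundamental 4 \<in> D"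
      using both by (simp_all add: l')
    have "(\<lambda>_. 0) \<notin> D" "fundamental 0 \<notin> D"
      using DynD_spin_not_0[OF assms(1) _ 34(1)] DynD_spin_not_vector[OF assms(1) _ 34(1)] by (simp_all add: l')
    moreover have "D \<subseteq> {\<lambda>_. 0, fundamental 0, fundamental 3, fundamental 4}"
      using dominant_DynD_cases(1)[OF assms(1)] by (simp add: l')
    ultimately show ?thesis
      using 34 by blast
  qed
  show "D \<in> {{\<lambda>_. 0, fundamental 4}, {\<lambda>_. 0, fundamental 5}}" if l': "l' = 6"
  proof -
    obtain i where i: "i \<in> {4, 5}" "fundamental i \<in> D"
      using spin unfolding l' by auto
    have im: "i \<in> minuscule X"
      using i(1) assms(1) l' by auto
    have "(\<lambda>_. 0) \<in> lab ` outer"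
    \<comment> \<open>Degree 2 in \<open>E_7\<close>: \<open>4 (2 - 6/4) = 2\<close> leaves nothing
      for the component in \<open>L\<close>.\<close>
    proof (rule minuscule_shift[OF im i(2) weight_coeffs_0, of 2])
      fix k
      have "0 - real_of_int 2 * minuscule_coeffs X i k = (if k < 4 then - real (k + 1) else if k = i then -3 else -2)"
        using i(1) by (auto simp: minuscule_coeffs_def assms(1) l' field_simps)
      also have "\<dots> \<in> \<int>"
        by (cases "k < 4"; cases "k = i") (simp_all del: of_nat_add of_nat_Suc)
      finally show "0 - real_of_int 2 * minuscule_coeffs X i k \<in> \<int>" .
    qed (use i(1) in \<open>auto simp: minuscule_coeffs_def assms(1) l'\<close>)
    then have 0: "(\<lambda>_. 0) \<in> D"
      by (simp add: zero_dominant_iff)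
    have "fundamental 0 \<notin> D"
      using DynD_spin_not_vector[OF assms(1) _ i(2)] i(1) by (simp add: l')
    moreover have "\<not> (fundamental 4 \<in> D \<and> fundamental 5 \<in> D)"
      using DynD_not_both_spins[OF assms(1)] by (simp add: l')
    moreover have "D \<subseteq> {\<lambda>_. 0, fundamental 0, fundamental 4, fundamental 5}"
      using dominant_DynD_cases(1)[OF assms(1)] by (simp add: l')
    ultimately show ?thesis
      using 0 i by blast
  qed
  show "D = {fundamental 0, fundamental 5, fundamental 6}" if l': "l' = 7"
  proof -
    have 56: "fundamental 5 \<in> D" "fundamental 6 \<in> D"
      using both by (simp_all add: l')
    have m: "5 \<in> minuscule X" "0 \<in> minuscule X"
      using assms(1) by (auto simp: l')
    have "fundamental 0 \<in> lab ` outer"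
    \<comment> \<open>Degree 2 in \<open>E_8\<close>: \<open>4 (2 - 7/4) + 1 = 2\<close>, where 1 is
      the squared length of the vector weight.\<close>
    proof (rule minuscule_shift[OF m(1) 56(1) weight_coeffs_minuscule[OF X m(2)], of 2])
      fix k
      have "minuscule_coeffs X 0 k - real_of_int 2 * minuscule_coeffs X 5 k =
          (if k < 5 then - real k else if k = 5 then -3 else -2)"
        by (auto simp: minuscule_coeffs_def assms(1) l' field_simps)
      also have "\<dots> \<in> \<int>"
        by (cases "k < 5"; cases "k = 5") simp_all
      finally show "minuscule_coeffs X 0 k - real_of_int 2 * minuscule_coeffs X 5 k \<in> \<int>" .
    qed (auto simp: minuscule_coeffs_def assms(1) l' pairing_fundamental)
    then have 0: "fundamental 0 \<in> D"
      by (simp add: fundamental_dominant_iff)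
    moreover have "D \<subseteq> {\<lambda>_. 0, fundamental 0, fundamental 5, fundamental 6}"
      using dominant_DynD_cases(1)[OF assms(1)] by (simp add: l')
    ultimately show ?thesis
      using 56 DynD_not_0_and_0[OF assms(1) 0] by blast
  qed
qed

end

section \<open>Comparison of full linkage systems\<close>

definition outer_labels :: "dynkin \<Rightarrow> nat \<Rightarrow> (nat \<Rightarrow> rvec) \<Rightarrow> (nat \<Rightarrow> real) set" where
  "outer_labels T l t = labels T l t ` {x \<in> root_system T. x \<notin> span (t ` {..<l})}"

lemma partial_linkage_system_eq:
  "partial_linkage_system T G t = (\<lambda>p. map p [0..<num_nodes G]) ` outer_labels T (num_nodes G) t"
proof -
  have "linkage_label_vector T G t x = map (labels T (num_nodes G) t x) [0..<num_nodes G]" for x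
    by (simp add: linkage_label_vector_def labels_def)
  then show ?thesis
    by (auto simp: partial_linkage_system_def outer_labels_def)
qed

lemma outer_labels_in_space: "outer_labels T l t \<subseteq> label_space l"
  using labels_in_label_space by (auto simp: outer_labels_def)

lemma inj_on_map_label_space: "inj_on (\<lambda>p. map p [0..<l]) (label_space l)"
proof (rule inj_onI)
  fix p q :: "nat \<Rightarrow> real"
  assume pq: "p \<in> label_space l" "q \<in> label_space l" "map p [0..<l] = map q [0..<l]"
  show "p = q"
  proof
    fix i
    show "p i = q i"
      using pq by (cases "i < l") (auto simp: label_space_def)
  qed
qed

definition extensions :: "dynkin \<Rightarrow> dynkin set" where
  "extensions X = {T. is_dynkin T \<and> node_count T = node_count X + 1 \<and> (\<exists>t. labelled_gamma_set T (dynkin_diagram X) t)}"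

definition selection :: "dynkin \<Rightarrow> (dynkin \<Rightarrow> nat \<Rightarrow> rvec) \<Rightarrow> bool" where
  "selection X s \<longleftrightarrow> (\<forall>T\<in>extensions X. labelled_gamma_set T (dynkin_diagram X) (s T))"

definition union_labels :: "dynkin \<Rightarrow> (dynkin \<Rightarrow> nat \<Rightarrow> rvec) \<Rightarrow> (nat \<Rightarrow> real) set" where
  "union_labels X s = (\<Union>T\<in>extensions X. outer_labels T (node_count X) (s T))"

lemma extensions_eq: "G \<in> homogeneous_class X \<Longrightarrow> {T. vertex_extension G T} = extensions X"
  by (simp add: extensions_def vertex_extension_iff)

text \<open>Every selected \<open>G\<close>-set is traced back to an \<open>X\<close>-set,
  separately for each extension, but the label map \<open>\<phi>\<close> is common to all of them.
  It is therefore injective on the union and preserves its size, overlaps included.\<close>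

lemma full_linkage_system_transfer:
  assumes "G \<in> homogeneous_class X" "gamma_set_selection G s'"
  shows "\<exists>s. selection X s \<and> card (full_linkage_system G s') = card (union_labels X s)"
proof -
  let ?l = "node_count X"
  have n: "num_nodes G = ?l"
    using homogeneous_class_branched(3)[OF assms(1)] .
  obtain \<phi> where \<phi>: "inj_on \<phi> (label_space ?l)" "\<phi> ` label_space ?l \<subseteq> label_space ?l"
    "\<And>T t'. is_dynkin T \<Longrightarrow> labelled_gamma_set T G t' \<Longrightarrow>
        \<exists>t. labelled_gamma_set T (dynkin_diagram X) t \<and> span (t' ` {..<?l}) = span (t ` {..<?l}) \<and>
             (\<forall>x. labels T ?l t' x = \<phi> (labels T ?l t x))"
    using homogeneous_class_transfer[OF assms(1), THEN conjunct2] by (elim exE conjE) metis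
  have "\<exists>t. T \<in> extensions X \<longrightarrow> labelled_gamma_set T (dynkin_diagram X) t \<and>
      span (s' T ` {..<?l}) = span (t ` {..<?l}) \<and> (\<forall>x. labels T ?l (s' T) x = \<phi> (labels T ?l t x))" for T
  proof (cases "T \<in> extensions X")
    case True
    then have "is_dynkin T" "labelled_gamma_set T G (s' T)"
      using assms extensions_eq[OF assms(1)] by (auto simp: extensions_def gamma_set_selection_def)
    from \<phi>(3)[OF this] show ?thesis by blast
  qed simp
  then obtain s where s: "\<And>T. T \<in> extensions X \<Longrightarrow> labelled_gamma_set T (dynkin_diagram X) (s T) \<and>
      span (s' T ` {..<?l}) = span (s T ` {..<?l}) \<and> (\<forall>x. labels T ?l (s' T) x = \<phi> (labels T ?l (s T) x))"
    by metis
  let ?m = "\<lambda>p. map p [0..<?l]"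
  have "outer_labels T ?l (s' T) = \<phi> ` outer_labels T ?l (s T)" if "T \<in> extensions X" for T
    using s[OF that] by (simp add: outer_labels_def image_image)
  then have "full_linkage_system G s' = ?m ` \<phi> ` union_labels X s"
    by (simp add: full_linkage_system_def extensions_eq[OF assms(1)] partial_linkage_system_eq n
        union_labels_def image_UN)
  moreover have "union_labels X s \<subseteq> label_space ?l"
    using outer_labels_in_space by (auto simp: union_labels_def)
  moreover have "inj_on (?m \<circ> \<phi>) (label_space ?l)"
    using \<phi>(1,2) inj_on_map_label_space by (metis comp_inj_on inj_on_subset)
  ultimately have "card (full_linkage_system G s') = card (union_labels X s)"
    by (metis card_image image_comp inj_on_subset)
  then show ?thesis
    using s by (auto simp: selection_def)
qed

lemma extension_corank_one:
  assumes "branched X" "selection X s" "T \<in> extensions X"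
  shows "corank_one T X (s T)"
  using assms by unfold_locales (auto simp: extensions_def selection_def)

lemma outer_labels_eq_orbits:
  assumes "branched X" "selection X s" "T \<in> extensions X"
  shows "outer_labels T (node_count X) (s T) = (\<Union>d\<in>corank_one.dominant_labels T X (s T). label_orbit X d)"
  using corank_one.labels_outer_eq[OF extension_corank_one[OF assms]]
  by (simp add: outer_labels_def corank_one.outer_def[OF extension_corank_one[OF assms]])

section \<open>Diagram symmetries and independence of the selection\<close>

definition node_swap :: "nat \<Rightarrow> nat \<Rightarrow> nat \<Rightarrow> nat" where
  "node_swap a b k = (if k = a then b else if k = b then a else k)"

definition diagram_swap :: "dynkin \<Rightarrow> nat \<Rightarrow> nat \<Rightarrow> bool" where
  "diagram_swap X a b \<longleftrightarrow> a < node_count X \<and> b < node_count X \<and>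
     (\<forall>i<node_count X. \<forall>j<node_count X.
        gram (dynkin_diagram X) (node_swap a b i) (node_swap a b j) = gram (dynkin_diagram X) i j)"

lemma node_swap_node_swap [simp]: "node_swap a b (node_swap a b k) = k"
  by (simp add: node_swap_def)

lemma node_swap_same [simp]: "node_swap a a = (\<lambda>k. k)"
  by (auto simp: node_swap_def)

lemma fundamental_node_swap: "fundamental i \<circ> node_swap a b = fundamental (node_swap a b i)"
  by (auto simp: fundamental_def node_swap_def fun_eq_iff)

lemma label_orbit_node_swap_subset:
  assumes "diagram_swap X a b" "q \<in> label_orbit X p"
  shows "q \<circ> node_swap a b \<in> label_orbit X (p \<circ> node_swap a b)"
  using assms(2)
proof (induction rule: label_orbit.induct)
  case (reflect q i)
  let ?w = "node_swap a b"
  have w: "?w j < node_count X \<longleftrightarrow> j < node_count X" for j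
    using assms(1) by (auto simp: diagram_swap_def node_swap_def)
  have "reflect_labels X i q \<circ> ?w = reflect_labels X (?w i) (q \<circ> ?w)"
  proof
    fix j
    show "(reflect_labels X i q \<circ> ?w) j = reflect_labels X (?w i) (q \<circ> ?w) j"
    proof (cases "j < node_count X")
      case True
      then have "gram (dynkin_diagram X) i (?w j) = gram (dynkin_diagram X) (?w i) j"
        using assms(1) w[of j] reflect.hyps(2) unfolding diagram_swap_def by (metis node_swap_node_swap w)
      then show ?thesis
        by (simp add: reflect_labels_def w)
    qed (simp add: reflect_labels_def w)
  qed
  moreover have "?w i < node_count X"
    using w reflect.hyps(2) by blast
  ultimately show ?case
    using label_orbit.reflect[OF reflect.IH] by metis
qed (rule label_orbit.base)

lemma label_orbit_node_swap:
  assumes "diagram_swap X a b"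
  shows "label_orbit X (p \<circ> node_swap a b) = (\<lambda>q. q \<circ> node_swap a b) ` label_orbit X p"
proof
  show "(\<lambda>q. q \<circ> node_swap a b) ` label_orbit X p \<subseteq> label_orbit X (p \<circ> node_swap a b)"
    using label_orbit_node_swap_subset[OF assms] by blast
  show "label_orbit X (p \<circ> node_swap a b) \<subseteq> (\<lambda>q. q \<circ> node_swap a b) ` label_orbit X p"
  proof
    fix q assume "q \<in> label_orbit X (p \<circ> node_swap a b)"
    then have "q \<circ> node_swap a b \<in> label_orbit X p"
      using label_orbit_node_swap_subset[OF assms, of q "p \<circ> node_swap a b"] by (simp add: comp_def)
    moreover have "q = (q \<circ> node_swap a b) \<circ> node_swap a b"
      by (simp add: fun_eq_iff)
    ultimately show "q \<in> (\<lambda>q. q \<circ> node_swap a b) ` label_orbit X p"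
      by blast
  qed
qed

lemma inj_comp_node_swap: "inj_on (\<lambda>q :: nat \<Rightarrow> real. q \<circ> node_swap a b) A"
  by (rule inj_onI) (metis comp_apply ext node_swap_node_swap)

text \<open>Orbits depend on \<open>X\<close> only, so a symmetry that matches the dominant labels
  of two selections matches all their labels. The swap is fixed before \<open>T\<close>, which makes
  it a bijection between the unions and not merely between the parts.\<close>

lemma card_union_labels_swap:
  assumes X: "branched X" and s: "selection X s" "selection X s'" and w: "diagram_swap X a b"
    and D: "\<And>T. T \<in> extensions X \<Longrightarrow>
      corank_one.dominant_labels T X (s' T) = (\<lambda>d. d \<circ> node_swap a b) ` corank_one.dominant_labels T X (s T)"
  shows "card (union_labels X s) = card (union_labels X s')"
proof -
  have "outer_labels T (node_count X) (s' T) = (\<lambda>q. q \<circ> node_swap a b) ` outer_labels T (node_count X) (s T)"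
    if T: "T \<in> extensions X" for T
    unfolding outer_labels_eq_orbits[OF X s(1) T] outer_labels_eq_orbits[OF X s(2) T] D[OF T]
    by (simp add: label_orbit_node_swap[OF w] image_UN)
  then have "union_labels X s' = (\<lambda>q. q \<circ> node_swap a b) ` union_labels X s"
    by (simp add: union_labels_def image_UN)
  then show ?thesis
    by (simp add: card_image inj_comp_node_swap)
qed

lemma diagram_swap_refl: "branched X \<Longrightarrow> diagram_swap X 0 0"
  using branched_node_count[of X] by (auto simp: diagram_swap_def node_swap_def)

lemma diagram_swap_D4:
  assumes "a \<in> {0, 2, 3}" "b \<in> {0, 2, 3}"
  shows "diagram_swap (DynD 4) a b"
  using assms
  by (elim insertE emptyE; simp add: diagram_swap_def gram_branched node_swap_def All_less_Suc numeral_eq_Suc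
      del: dynkin_diagram.simps)

lemma diagram_swap_D6:
  assumes "a \<in> {4, 5}" "b \<in> {4, 5}"
  shows "diagram_swap (DynD 6) a b"
proof -
  have "diagram_swap (DynD 6) 4 5" "diagram_swap (DynD 6) 5 4" "diagram_swap (DynD 6) 4 4" "diagram_swap (DynD 6) 5 5"
    by (simp_all add: diagram_swap_def gram_branched node_swap_def All_less_Suc numeral_eq_Suc del: dynkin_diagram.simps)
  then show ?thesis using assms by auto
qed

lemma extension_types:
  assumes "branched X" "selection X s" "T \<in> extensions X"
  shows "T = DynD (node_count X + 1) \<or> (T = DynE (node_count X + 1) \<and> node_count X \<in> {5, 6, 7})"
proof -
  have "is_dynkin T" "node_count T = node_count X + 1"
    using assms(3) by (auto simp: extensions_def)
  then show ?thesis
    using corank_one.not_DynA[OF extension_corank_one[OF assms]] by (cases T) auto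
qed

lemma card_union_labels_unique:
  assumes X: "branched X" and s: "selection X s" "selection X s'"
  shows "card (union_labels X s) = card (union_labels X s')"
proof -
  note c = extension_corank_one[OF X s(1)] and c' = extension_corank_one[OF X s(2)]
  have fixed: ?thesis if "\<And>T. T \<in> extensions X \<Longrightarrow> corank_one.dominant_labels T X (s' T) = corank_one.dominant_labels T X (s T)"
    by (rule card_union_labels_swap[OF X s diagram_swap_refl[OF X]]) (simp add: that comp_def)
  show ?thesis
    using X
  proof (cases X rule: branched_cases)
    case (D l)
    consider "l = 4" | "l = 6" | "l = 5 \<or> l = 7" | "8 \<le> l"
      using D(2) by linarith
    then show ?thesis
    proof cases
      case 1
      have X4: "X = DynD 4"
        using D 1 by simp
      show ?thesis
      proof (cases "extensions X = {}")
        case True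
        then show ?thesis by (simp add: union_labels_def)
      next
        case False
        then obtain T where T: "T \<in> extensions X"
          by blast
        \<comment> \<open>The rank must be 5, where type E has no member and type A is excluded;
          only \<open>D_5\<close> remains, so one swap serves trivially for all extensions.\<close>
        have only: "extensions X = {T}"
          using extension_types[OF X s(1)] T X4 by auto
        obtain a b where ab: "a \<in> {0, 2, 3}" "b \<in> {0, 2, 3}"
          "corank_one.dominant_labels T X (s T) = {fundamental a}" "corank_one.dominant_labels T X (s' T) = {fundamental b}"
          using corank_one.dominant_DynD4[OF c[OF T] X4] corank_one.dominant_DynD4[OF c'[OF T] X4] by auto
        have "diagram_swap X a b"
          unfolding X4 using ab(1,2) by (rule diagram_swap_D4)
        then show ?thesis
          by (rule card_union_labels_swap[OF X s])
            (use only ab(3,4) in \<open>auto simp: fundamental_node_swap, auto simp: node_swap_def\<close>)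
      qed
    next
      case 2
      have X6: "X = DynD 6"
        using D 2 by simp
      have types: "T = DynD 7 \<or> T = DynE 7" if "T \<in> extensions X" for T
        using extension_types[OF X s(1) that] X6 by auto
      obtain a b where ab: "a \<in> {4, 5}" "b \<in> {4, 5}"
        "DynE 7 \<in> extensions X \<Longrightarrow> corank_one.dominant_labels (DynE 7) X (s (DynE 7)) = {\<lambda>_. 0, fundamental a}"
        "DynE 7 \<in> extensions X \<Longrightarrow> corank_one.dominant_labels (DynE 7) X (s' (DynE 7)) = {\<lambda>_. 0, fundamental b}"
      proof (cases "DynE 7 \<in> extensions X")
        case True
        have "\<exists>a\<in>{4, 5}. corank_one.dominant_labels (DynE 7) X (s (DynE 7)) = {\<lambda>_. 0, fundamental a}"
          using corank_one.dominant_DynD_in_DynE(2)[OF c[OF True] X6 refl refl] by simp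
        moreover have "\<exists>b\<in>{4, 5}. corank_one.dominant_labels (DynE 7) X (s' (DynE 7)) = {\<lambda>_. 0, fundamental b}"
          using corank_one.dominant_DynD_in_DynE(2)[OF c'[OF True] X6 refl refl] by simp
        ultimately show ?thesis
          by (elim bexE) (rule that; assumption)
      \<comment> \<open>If \<open>E_7\<close> is not among the extensions, \<open>a\<close> and
        \<open>b\<close> are unconstrained and the trivial swap is chosen.\<close>
      qed (rule that[of 4 4], simp_all)
      have w: "diagram_swap X a b"
        unfolding X6 using ab(1,2) by (rule diagram_swap_D6)
      have "corank_one.dominant_labels T X (s' T) = (\<lambda>d. d \<circ> node_swap a b) ` corank_one.dominant_labels T X (s T)"
        if T: "T \<in> extensions X" for T
        using types[OF T]
      proof
        assume T7: "T = DynD 7"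
        \<comment> \<open>Exchanging half-spin nodes leaves the vector node 0 alone, so the
          contribution of \<open>D_7\<close> is not disturbed by a swap chosen for
          \<open>E_7\<close>.\<close>
        have "fundamental 0 \<circ> node_swap a b = fundamental 0"
          using ab(1,2) by (auto simp: fundamental_node_swap node_swap_def)
        then show ?thesis
          using corank_one.dominant_DynD_in_DynD[OF c[OF T] X6 T7] corank_one.dominant_DynD_in_DynD[OF c'[OF T] X6 T7] by simp
      next
        assume T7: "T = DynE 7"
        have "fundamental a \<circ> node_swap a b = fundamental b" "(\<lambda>_. 0) \<circ> node_swap a b = (\<lambda>_. 0::real)"
          by (auto simp: fundamental_node_swap, auto simp: node_swap_def)
        then show ?thesis
          using ab(3,4) T T7 by simp
      qed
      then show ?thesis
        by (rule card_union_labels_swap[OF X s w])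
    next
      case 3
      have "corank_one.dominant_labels T X (s' T) = corank_one.dominant_labels T X (s T)" if T: "T \<in> extensions X" for T
        using extension_types[OF X s(1) T]
      proof
        assume "T = DynD (node_count X + 1)"
        then show ?thesis
          using corank_one.dominant_DynD_in_DynD[OF c[OF T] D(1)] corank_one.dominant_DynD_in_DynD[OF c'[OF T] D(1)] 3 by auto
      next
        assume "T = DynE (node_count X + 1) \<and> node_count X \<in> {5, 6, 7}"
        then show ?thesis
          using corank_one.dominant_DynD_in_DynE[OF c[OF T] D(1)] corank_one.dominant_DynD_in_DynE[OF c'[OF T] D(1)] 3 by auto
      qed
      then show ?thesis by (rule fixed)
    next
      case 4
      then show ?thesis
        by (intro fixed) (simp add: corank_one.dominant_DynD_large[OF c D(1)] corank_one.dominant_DynD_large[OF c' D(1)])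
    qed
  next
    case E6
    show ?thesis
      by (intro fixed) (simp only: corank_one.dominant_DynE6[OF c E6] corank_one.dominant_DynE6[OF c' E6])
  next
    case E7
    show ?thesis
      by (intro fixed) (simp only: corank_one.dominant_DynE7[OF c E7] corank_one.dominant_DynE7[OF c' E7])
  next
    case E8
    then have "extensions X = {}"
      using corank_one.X_not_DynE8[OF c] by blast
    then show ?thesis by (simp add: union_labels_def)
  qed
qed

section \<open>The upper bound\<close>

context corank_one
begin

text \<open>Coordinates in the simple roots of \<open>X\<close> are reused as coordinates in the
  tuple \<open>t\<close>. The Gram matrices agree, so norm two and integrality carry over, and
  independence of the tuple gives injectivity.\<close>

lemma embed_roots:
  shows "(\<lambda>x. comb (Poly_Mapping.lookup x)) ` root_system X \<subseteq> root_system T \<inter> L"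
    and "inj_on (\<lambda>x. comb (Poly_Mapping.lookup x)) (root_system X)"
proof -
  show "(\<lambda>x. comb (Poly_Mapping.lookup x)) ` root_system X \<subseteq> root_system T \<inter> L"
  proof clarify
    fix x assume x: "x \<in> root_system X"
    let ?y = "comb (Poly_Mapping.lookup x)"
    have "form (comb a) (comb a) = (\<Sum>i<l. \<Sum>j<l. a i * g j i * a j)" for a
      by (simp add: comb_def root_form_linear form_t sum_distrib_left mult_ac)
    then have "form ?y ?y = root_form X x x"
      by (simp add: root_form_def gram_commute)
    then have "form ?y ?y = 2"
      using root_norm[OF x] by simp
    moreover have "?y \<in> root_lattice T"
      unfolding comb_def using root_in_lattice[OF t_root] root_in_lattice[OF x]
      by (intro root_lattice_sum root_lattice_scaleR) (auto simp: root_lattice_def)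
    ultimately show "?y \<in> root_system T \<inter> L"
      using comb_in_L by (simp add: root_system_iff T)
  qed
  show "inj_on (\<lambda>x. comb (Poly_Mapping.lookup x)) (root_system X)"
  proof (rule inj_onI)
    fix x y assume x: "x \<in> root_system X" and y: "y \<in> root_system X"
      and e: "comb (Poly_Mapping.lookup x) = comb (Poly_Mapping.lookup y)"
    have "(\<Sum>i<l. (Poly_Mapping.lookup x i - Poly_Mapping.lookup y i) *\<^sub>R t i) = 0"
      using e by (simp add: comb_def scaleR_diff_left sum_subtractf)
    from tuple[unfolded root_tuple_def, THEN conjunct2, THEN conjunct1, rule_format, OF this]
    have "\<forall>i<l. Poly_Mapping.lookup x i - Poly_Mapping.lookup y i = 0"
      by blast
    moreover have "Poly_Mapping.lookup x i = Poly_Mapping.lookup y i" if "\<not> i < l" for i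
      using root_supported[OF x] root_supported[OF y] that by (simp add: supported_def)
    ultimately have "Poly_Mapping.lookup x i = Poly_Mapping.lookup y i" for i
      by (cases "i < l") simp_all
    then show "x = y"
      by (rule poly_mapping_eqI)
  qed
qed

text \<open>Two estimates meet here: several outer roots may share their labels, as roots with the
  same projection to \<open>L\<close> do, and the roots in \<open>L\<close> are at least as many as
  those of \<open>X\<close>. Integers avoid truncated subtraction.\<close>

lemma card_outer_labels_le: "int (card (lab ` outer)) \<le> int (card (root_system T)) - int (card (root_system X))"
proof -
  have fin: "finite (root_system T)"
    using T by (rule finite_root_system)
  have "card (root_system X) \<le> card (root_system T \<inter> L)"
    using embed_roots fin by (intro card_inj_on_le[of "\<lambda>x. comb (Poly_Mapping.lookup x)"]) auto
  moreover have "card (root_system T) = card (root_system T \<inter> L) + card outer"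
  proof -
    have "root_system T = (root_system T \<inter> L) \<union> outer"
      by (auto simp: outer_def)
    then show ?thesis
      using fin card_Un_disjoint[of "root_system T \<inter> L" outer] by (auto simp: outer_def)
  qed
  moreover have "card (lab ` outer) \<le> card outer"
    using fin by (intro card_image_le) (simp add: outer_def)
  ultimately show ?thesis by linarith
qed

end

lemma finite_extensions: "finite (extensions X)"
proof (rule finite_subset)
  let ?n = "node_count X + 1"
  show "extensions X \<subseteq> {DynA ?n, DynD ?n, DynE ?n}"
  proof
    fix T assume "T \<in> extensions X"
    then have "node_count T = ?n"
      by (simp add: extensions_def)
    then show "T \<in> {DynA ?n, DynD ?n, DynE ?n}"
      by (cases T) auto
  qed
qed simp

lemma card_union_labels_le:
  assumes X: "branched X" and s: "selection X s"
  shows "int (card (union_labels X s)) \<le> (\<Sum>T\<in>extensions X. int (card (root_system T)) - int (card (root_system X)))"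
proof -
  have "int (card (union_labels X s)) \<le> int (\<Sum>T\<in>extensions X. card (outer_labels T (node_count X) (s T)))"
    unfolding union_labels_def using card_UN_le[OF finite_extensions] by (simp only: of_nat_le_iff)
  also have "\<dots> = (\<Sum>T\<in>extensions X. int (card (outer_labels T (node_count X) (s T))))"
    by simp
  also have "\<dots> \<le> (\<Sum>T\<in>extensions X. int (card (root_system T)) - int (card (root_system X)))"
  proof (rule sum_mono)
    fix T assume T: "T \<in> extensions X"
    note c = extension_corank_one[OF X s T]
    show "int (card (outer_labels T (node_count X) (s T))) \<le> int (card (root_system T)) - int (card (root_system X))"
      using corank_one.card_outer_labels_le[OF c] by (simp add: outer_labels_def corank_one.outer_def[OF c])
  qed
  finally show ?thesis .
qed

theorem proposition4p3:
  fixes X :: dynkin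
  shows
    "(\<forall>G G' \<sigma> \<sigma>'.
        G \<in> homogeneous_class X \<longrightarrow> G' \<in> homogeneous_class X \<longrightarrow>
        gamma_set_selection G \<sigma> \<longrightarrow> gamma_set_selection G' \<sigma>' \<longrightarrow>
        card (full_linkage_system G \<sigma>) = card (full_linkage_system G' \<sigma>'))
   \<and> (\<forall>G' \<sigma> \<sigma>'.
        G' \<in> homogeneous_class X \<longrightarrow>
        gamma_set_selection (dynkin_diagram X) \<sigma> \<longrightarrow> gamma_set_selection G' \<sigma>' \<longrightarrow>
        card (full_linkage_system G' \<sigma>') = card (full_linkage_system (dynkin_diagram X) \<sigma>) \<and>
        int (card (full_linkage_system G' \<sigma>'))
          \<le> (\<Sum>T | vertex_extension G' T.
                int (card (root_system T)) - int (card (root_system X))))"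
proof -
  have card_eq: "card (full_linkage_system G s) = card (full_linkage_system G' s')"
    if "G \<in> homogeneous_class X" "G' \<in> homogeneous_class X" "gamma_set_selection G s" "gamma_set_selection G' s'"
    for G G' s s'
    using full_linkage_system_transfer[OF that(1,3)] full_linkage_system_transfer[OF that(2,4)]
      card_union_labels_unique[OF homogeneous_class_branched(1)[OF that(1)]] by metis
  have "int (card (full_linkage_system G s))
      \<le> (\<Sum>T | vertex_extension G T. int (card (root_system T)) - int (card (root_system X)))"
    if "G \<in> homogeneous_class X" "gamma_set_selection G s" for G s
    unfolding extensions_eq[OF that(1)]
    using full_linkage_system_transfer[OF that] card_union_labels_le[OF homogeneous_class_branched(1)[OF that(1)]]
    by metis
  \<comment> \<open>The Dynkin diagram is itself a member of its class, so the equality in the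
    second part is an instance of the first.\<close>
  then show ?thesis
    using card_eq homogeneous_class_branched(2) by blast
qed

end
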